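(* The eigenvalues of the operators of multiplication by the quantum tautological classes $\hat\tau$ on the partial flag variety $G/P$ are the symmetric functions $\tau(\{s_{i,k}\})$ of Bethe roots $s_{i,k}$ ($1\le i\le n-1$, $1\le k\le\mathbf v_i$), i.e. of solutions of the Bethe ansatz equations (generalizations of the ones for the five-vertex model) $$\prod_{j=1}^{\mathbf w_{n-1}}\frac{s_{n-1,k}-a_j}{a_j}\prod_{j=1}^{\mathbf v_{n-2}}\frac{s_{n-1,k}}{s_{n-2,j}-s_{n-1,k}}=z_{n-1}^\sharp\prod_{j=1,\,j\ne k}^{\mathbf v_{n-1}}\frac{-s_{n-1,k}}{s_{n-1,j}},\qquad k=1,\dots,\mathbf v_{n-1},$$ $$\prod_{j=1}^{\mathbf v_{i+1}}\frac{s_{i,k}-s_{i+1,j}}{s_{i+1,j}}\prod_{j=1}^{\mathbf v_{i-1}}\frac{s_{i,k}}{s_{i-1,j}-s_{i,k}}=z_i^\sharp\prod_{j=1,\,j\ne k}^{\mathbf v_i}\frac{-s_{i,k}}{s_{i,j}},\qquad k=1,\dots,\mathbf v_i,\ i=2,\dots,n-2,$$ $$\prod_{j=1}^{\mathbf v_{2}}\frac{s_{1,k}-s_{2,j}}{s_{2,j}}=z_1^\sharp\prod_{j=1,\,j\ne k}^{\mathbf v_1}\frac{-s_{1,k}}{s_{1,j}},\qquad k=1,\dots,\mathbf v_1.$$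
   Context: Let $G/P$ be the variety of partial flags in $\mathbb C^{\mathbf w_{n-1}}$ with dimensions $\mathbf v_1\le\dots\le\mathbf v_{n-1}\le\mathbf w_{n-1}$, and $X=T^*(G/P)$, realized as a Nakajima quiver variety: $R=\mathrm{Hom}(W_{n-1},V_{n-1})\oplus\bigoplus_{i=1}^{n-2}\mathrm{Hom}(V_{i+1},V_i)$ with $\dim V_i=\mathbf v_i$, $\dim W_{n-1}=\mathbf w_{n-1}$, $\mathsf G=\prod GL(V_i)$, $X=\mu^{-1}(0)_{ss}/\mathsf G$ with $\mu$ the moment map on $T^*R$ and stability making the maps $W_{n-1}\to V_{n-1}$, $V_{i+1}\to V_i$ surjective. Torus $\mathsf T$: coordinates $a_1,\dots,a_{\mathbf w_{n-1}}$ on a maximal torus of $GL(W_{n-1})$ and $\hbar$ scaling cotangent directions. Put $\mathbf v_1'=\mathbf v_2$, $\mathbf v_i'=\mathbf v_{i+1}-\mathbf v_{i-1}$ ($2\le i\le n-2$), $\mathbf v_{n-1}'=\mathbf w_{n-1}-\mathbf v_{n-2}$, and $z_i^\sharp=z_i(-\hbar^{1/2})^{\mathbf v_i'}$, where $z_i$ are the Kähler parameters of $X$ recording quasimap degrees. **Bare vertex.** For a tensorial polynomial $\tau$ in the tautological bundles $V_i$ and their duals, identified with a symmetric Laurent polynomial in the Chern roots of each $V_i$, the bare vertex of $X$ is $V^{(\tau)}(z)=\sum_{\mathbf d}z^{\mathbf d}\mathrm{ev}_{p_2,*}(\mathsf{QM}^{\mathbf d}_{\mathrm{nonsing}\,p_2},\widehat{\mathcal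 O}_{\mathrm{vir}}\tau(\mathscr V_i|_{p_1}))$, the generating function over degrees $\mathbf d$ of the equivariant pushforwards from the moduli spaces of quasimaps $\mathbb P^1\dashrightarrow X$ nonsingular at $p_2$ (with $\widehat{\mathcal O}_{\mathrm{vir}}$ the symmetrized virtual structure sheaf and $\mathscr V_i$ the bundles on $\mathbb P^1$ that are part of the quasimap data), with $\mathbb C^\times_q$ scaling $\mathbb P^1$ and fixing $p_1,p_2$. Explicitly, at a torus fixed point $\mathbf p$ given by a chain of subsets $\{x_{1,1},\dots,x_{1,\mathbf v_1}\}\subset\dots\subset\{x_{n-1,1},\dots,x_{n-1,\mathbf v_{n-1}}\}\subset\{a_1,\dots,a_{\mathbf w_{n-1}}\}$ its component is $$V^{(\tau)}_{\mathbf p}(z)=\sum_{(d_{i,j})\in C}z^{\mathbf d}q^{\frac12\sum_i\mathbf v_i'd_i}\prod_{i=1}^{n-1}\prod_{j,k=1}^{\mathbf v_i}\{x_{i,j}/x_{i,k}\}^{-1}_{d_{i,j}-d_{i,k}}\prod_{j=1}^{\mathbf v_{n-1}}\prod_{k=1}^{\mathbf w_{n-1}}\{x_{n-1,j}/a_k\}_{d_{n-1,j}}\prod_{i=1}^{n-2}\prod_{j=1}^{\mathbf v_i}\prod_{k=1}^{\mathbf v_{i+1}}\{x_{i,j}/x_{i+1,k}\}_{d_{i,j}-d_{i+1,k}}\ \tau(x_{i,j}q^{-d_{i,j}}),$$ with $d_i=\sum_jd_{i,j}$, $z^{\mathbf d}=\prod_i z_i^{d_i}$, $\{x\}_d=\frac{(\hbar/x,q)_d}{(q/x,q)_d}(-q^{1/2}\hbar^{-1/2})^d$,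 $(x,q)_d=\varphi(x)/\varphi(q^dx)$, $\varphi(x)=\prod_{i\ge0}(1-q^ix)$. The set $C$ consists of collections with $d_{i,j}\ge0$ such that for each $i\le n-2$ there are $\mathbf v_i$ distinct indices $j_1,\dots,j_{\mathbf v_i}$ with $d_{i,k}\ge d_{i+1,j_k}$. **Quantum tautological classes on $G/P$.** These are obtained by counting only quasimaps to the compact space $G/P$, suppressing the contribution of the cotangent fibre, i.e. by taking $\hbar\to\infty$ with all $z_i^\sharp$ (and $a_j$) fixed. The eigenvalue of the operator of multiplication by the class $\hat\tau$ at the fixed point $\mathbf p$ is $\lim_{q\to1}\overline V^{(\tau)}_{\mathbf p}/\overline V^{(1)}_{\mathbf p}$, where $\overline V^{(\tau)}_{\mathbf p}=\lim_{\hbar\to\infty}V^{(\tau)}_{\mathbf p}$ at fixed $z^\sharp$.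
   Formalization: The right-hand sides of the Bethe equations carry (-1)^{v'_i} z_i^♯ in place of z_i^♯: with the stated vertex and z_i^♯ = z_i(-ħ^{1/2})^{v'_i} the displayed sign fails, e.g. for n=2, v_1=w_1=1 the eigenvalue is a(1-z^♯), so (s-a)/a = -z^♯. *)

theory Defs
  imports
    "HOL-Analysis.Analysis"
    "HOL-Library.Poly_Mapping"
    "HOL-Computational_Algebra.Fraction_Field"
    "HOL-Combinatorics.Permutations"
begin

section \<open>Formal power series in several variables\<close>

text \<open>
  Formal power series in variables indexed by natural numbers; a monomial is its
  exponent vector. The variables play the role of the Kaehler parameters.
\<close>

typedef 'a mfps = "UNIV :: ((nat \<Rightarrow>\<^sub>0 nat) \<Rightarrow> 'a) set"
  morphisms mfps_nth Abs_mfps ..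

lemma mfps_nth_Abs [simp]: "mfps_nth (Abs_mfps f) m = f m"
  by (simp add: Abs_mfps_inverse)

lemma mfps_eqI: "(\<And>m. mfps_nth f m = mfps_nth g m) \<Longrightarrow> f = g"
  by (metis ext mfps_nth_inject)

definition splits :: "(nat \<Rightarrow>\<^sub>0 nat) \<Rightarrow> ((nat \<Rightarrow>\<^sub>0 nat) \<times> (nat \<Rightarrow>\<^sub>0 nat)) set" where
  "splits m = {(b, c). b + c = m}"

lemma finite_below_mono:
  "finite {b :: nat \<Rightarrow>\<^sub>0 nat. \<forall>i. Poly_Mapping.lookup b i \<le> Poly_Mapping.lookup m i}"
    (is "finite ?A")
proof -
  have "finite (Poly_Mapping.lookup ` ?A)"
  proof (rule finite_subset)
    let ?K = "Poly_Mapping.keys m"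
    let ?N = "\<Sum>i\<in>?K. Poly_Mapping.lookup m i"
    show "Poly_Mapping.lookup ` ?A \<subseteq> {f. \<forall>i. (i \<in> ?K \<longrightarrow> f i \<in> {..?N}) \<and> (i \<notin> ?K \<longrightarrow> f i = 0)}"
    proof (clarsimp, intro conjI impI)
      fix b :: "nat \<Rightarrow>\<^sub>0 nat" and i
      assume b: "\<forall>i. Poly_Mapping.lookup b i \<le> Poly_Mapping.lookup m i"
      show "Poly_Mapping.lookup b i \<le> ?N" if "i \<in> ?K"
        using b[rule_format, of i] member_le_sum[of i ?K "Poly_Mapping.lookup m"] that by simp
      show "Poly_Mapping.lookup b i = 0" if "i \<notin> ?K"
        using b[rule_format, of i] that by (simp add: in_keys_iff)
    qed
    show "finite {f :: nat \<Rightarrow> nat. \<forall>i. (i \<in> ?K \<longrightarrow> f i \<in> {..?N}) \<and> (i \<notin> ?K \<longrightarrow> f i = 0)}"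
      by (rule finite_set_of_finite_funs) auto
  qed
  then show ?thesis
    by (rule finite_imageD) (auto simp: inj_on_def intro: poly_mapping_eqI)
qed

lemma finite_splits [simp]: "finite (splits m)"
proof (rule finite_subset)
  let ?A = "{b :: nat \<Rightarrow>\<^sub>0 nat. \<forall>i. Poly_Mapping.lookup b i \<le> Poly_Mapping.lookup m i}"
  show "splits m \<subseteq> ?A \<times> ?A"
    by (auto simp: splits_def lookup_add)
  show "finite (?A \<times> ?A)"
    using finite_below_mono by blast
qed

instantiation mfps :: (comm_ring_1) comm_ring_1
begin

definition zero_mfps :: "'a mfps" where "0 = Abs_mfps (\<lambda>m. 0)"
definition one_mfps :: "'a mfps" where "1 = Abs_mfps (\<lambda>m. if m = 0 then 1 else 0)"
definition plus_mfps :: "'a mfps \<Rightarrow> 'a mfps \<Rightarrow> 'a mfps" where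
  "f + g = Abs_mfps (\<lambda>m. mfps_nth f m + mfps_nth g m)"
definition minus_mfps :: "'a mfps \<Rightarrow> 'a mfps \<Rightarrow> 'a mfps" where
  "f - g = Abs_mfps (\<lambda>m. mfps_nth f m - mfps_nth g m)"
definition uminus_mfps :: "'a mfps \<Rightarrow> 'a mfps" where
  "- f = Abs_mfps (\<lambda>m. - mfps_nth f m)"
definition times_mfps :: "'a mfps \<Rightarrow> 'a mfps \<Rightarrow> 'a mfps" where
  "f * g = Abs_mfps (\<lambda>m. \<Sum>(b, c)\<in>splits m. mfps_nth f b * mfps_nth g c)"

instance
proof
  fix f g h :: "'a mfps"
  show "f * g * h = f * (g * h)"
  proof (rule mfps_eqI)
    fix m
    let ?t = "\<lambda>b c d. mfps_nth f b * mfps_nth g c * mfps_nth h d"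
    have "mfps_nth (f * g * h) m =
        (\<Sum>(e, d)\<in>splits m. \<Sum>(b, c)\<in>splits e. ?t b c d)"
      by (auto simp: times_mfps_def sum_distrib_right intro!: sum.cong)
    also have "\<dots> = (\<Sum>((e, d), (b, c))\<in>(SIGMA p:splits m. splits (fst p)). ?t b c d)"
      by (subst sum.Sigma[symmetric]) (auto intro!: sum.cong)
    also have "\<dots> = (\<Sum>((b, e), (c, d))\<in>(SIGMA p:splits m. splits (snd p)). ?t b c d)"
      by (rule sum.reindex_bij_witness[where
            i = "\<lambda>((b, e), (c, d)). ((b + c, d), (b, c))" and
            j = "\<lambda>((e, d), (b, c)). ((b, c + d), (c, d))"])
        (auto simp: splits_def add.assoc)
    also have "\<dots> = (\<Sum>(b, e)\<in>splits m. \<Sum>(c, d)\<in>splits e. ?t b c d)"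
      by (subst sum.Sigma[symmetric]) (auto intro!: sum.cong)
    also have "\<dots> = mfps_nth (f * (g * h)) m"
      by (auto simp: times_mfps_def sum_distrib_left mult.assoc intro!: sum.cong)
    finally show "mfps_nth (f * g * h) m = mfps_nth (f * (g * h)) m" .
  qed
  show "f * g = g * f"
  proof (rule mfps_eqI)
    fix m
    show "mfps_nth (f * g) m = mfps_nth (g * f) m"
      unfolding times_mfps_def mfps_nth_Abs
      by (rule sum.reindex_bij_witness[where i = prod.swap and j = prod.swap])
        (auto simp: splits_def add.commute mult.commute)
  qed
  show "1 * f = f"
  proof (rule mfps_eqI)
    fix m
    have "mfps_nth (1 * f) m = (\<Sum>p\<in>splits m. if p = (0, m) then mfps_nth f m else 0)"
      unfolding times_mfps_def mfps_nth_Abs one_mfps_def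
      by (rule sum.cong) (auto simp: splits_def split: if_splits)
    also have "\<dots> = mfps_nth f m"
      by (subst sum.delta[OF finite_splits]) (auto simp: splits_def)
    finally show "mfps_nth (1 * f) m = mfps_nth f m" .
  qed
  show "(f + g) * h = f * h + g * h"
    by (rule mfps_eqI)
      (simp add: times_mfps_def plus_mfps_def distrib_right sum.distrib case_prod_beta)
  show "f + g + h = f + (g + h)" "f + g = g + f" "0 + f = f" "- f + f = 0" "f - g = f + - g"
    by (rule mfps_eqI;
        simp add: plus_mfps_def zero_mfps_def uminus_mfps_def minus_mfps_def algebra_simps)+
  show "(0 :: 'a mfps) \<noteq> 1"
  proof
    assume "(0 :: 'a mfps) = 1"
    then have "mfps_nth (0 :: 'a mfps) 0 = mfps_nth 1 0" by simp
    then show False by (simp add: zero_mfps_def one_mfps_def)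
  qed
qed

end

text \<open>
  Encoding exponent vectors as natural numbers through prime factorization gives a
  multiplicative well-order on monomials, hence there are no zero divisors.
\<close>

lemma monomial_weight:
  obtains \<omega> :: "(nat \<Rightarrow>\<^sub>0 nat) \<Rightarrow> nat"
  where "inj \<omega>" "\<And>b c. \<omega> (b + c) = \<omega> b * \<omega> c" "\<And>b. \<omega> b > 0"
proof -
  obtain p :: "nat \<Rightarrow> nat" where p: "inj p" "range p \<subseteq> {n. prime n}"
    using infinite_countable_subset[OF primes_infinite] by blast
  define \<omega> where "\<omega> b = (\<Prod>i\<in>Poly_Mapping.keys b. p i ^ Poly_Mapping.lookup b i)"
    for b :: "nat \<Rightarrow>\<^sub>0 nat"
  have pr: "prime (p i)" for i using p(2) by auto
  have ext: "\<omega> b = (\<Prod>i\<in>K. p i ^ Poly_Mapping.lookup b i)"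
    if "finite K" "Poly_Mapping.keys b \<subseteq> K" for b K
    unfolding \<omega>_def using that
    by (intro prod.mono_neutral_left) (auto simp: in_keys_iff)
  have add: "\<omega> (b + c) = \<omega> b * \<omega> c" for b c
  proof -
    let ?K = "Poly_Mapping.keys b \<union> Poly_Mapping.keys c"
    have "\<omega> (b + c) = (\<Prod>i\<in>?K. p i ^ Poly_Mapping.lookup (b + c) i)"
      by (rule ext) (auto simp: in_keys_iff lookup_add)
    also have "\<dots> = \<omega> b * \<omega> c"
      by (simp add: ext[of ?K] lookup_add power_add prod.distrib)
    finally show ?thesis .
  qed
  have mult: "multiplicity (p i) (\<omega> b) = Poly_Mapping.lookup b i" for b i
  proof -
    let ?K = "insert i (Poly_Mapping.keys b)"
    define f where "f = (\<lambda>x. Poly_Mapping.lookup b (inv p x))"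
    have f: "f (p j) = Poly_Mapping.lookup b j" for j
      using p(1) by (simp add: f_def)
    have "\<omega> b = (\<Prod>j\<in>?K. p j ^ Poly_Mapping.lookup b j)" by (rule ext) auto
    also have "\<dots> = (\<Prod>x\<in>p ` ?K. x ^ f x)"
      by (subst prod.reindex) (use p(1) in \<open>auto simp: f inj_on_def inj_def\<close>)
    finally have "\<omega> b = (\<Prod>x\<in>p ` ?K. x ^ f x)" .
    moreover have "multiplicity (p i) (\<Prod>x\<in>p ` ?K. x ^ f x) =
        (if p i \<in> p ` ?K then f (p i) else 0)"
      by (rule multiplicity_prod_prime_powers) (use pr in auto)
    ultimately show ?thesis by (simp add: f)
  qed
  have "inj \<omega>"
    by (rule injI, rule poly_mapping_eqI) (metis mult)
  moreover have "\<omega> b > 0" for b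
    unfolding \<omega>_def using pr by (intro prod_pos) (simp add: prime_gt_0_nat)
  ultimately show ?thesis using that add by blast
qed

instance mfps :: (idom) idom
proof
  fix f g :: "'a mfps"
  assume fg: "f \<noteq> 0" "g \<noteq> 0"
  obtain \<omega> :: "(nat \<Rightarrow>\<^sub>0 nat) \<Rightarrow> nat"
    where w: "inj \<omega>" "\<And>b c. \<omega> (b + c) = \<omega> b * \<omega> c" "\<And>b. \<omega> b > 0"
    using monomial_weight by blast
  have least: "\<exists>b. mfps_nth h b \<noteq> 0 \<and> (\<forall>c. mfps_nth h c \<noteq> 0 \<longrightarrow> \<omega> b \<le> \<omega> c)"
    if "h \<noteq> 0" for h :: "'a mfps"
  proof -
    from that obtain c where "mfps_nth h c \<noteq> 0"
      by (metis mfps_eqI mfps_nth_Abs zero_mfps_def)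
    then show ?thesis
      using ex_has_least_nat[of "\<lambda>c. mfps_nth h c \<noteq> 0" c \<omega>] by blast
  qed
  obtain b where b: "mfps_nth f b \<noteq> 0" "\<And>c. mfps_nth f c \<noteq> 0 \<Longrightarrow> \<omega> b \<le> \<omega> c"
    using least[OF fg(1)] by blast
  obtain c where c: "mfps_nth g c \<noteq> 0" "\<And>d. mfps_nth g d \<noteq> 0 \<Longrightarrow> \<omega> c \<le> \<omega> d"
    using least[OF fg(2)] by blast
  have zero: "mfps_nth f d * mfps_nth g e = 0"
    if "d + e = b + c" "(d, e) \<noteq> (b, c)" for d e
  proof (rule ccontr)
    assume "mfps_nth f d * mfps_nth g e \<noteq> 0"
    then have le: "\<omega> b \<le> \<omega> d" "\<omega> c \<le> \<omega> e" using b(2) c(2) by auto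
    have eq: "\<omega> d * \<omega> e = \<omega> b * \<omega> c" using that(1) w(2) by metis
    have "\<omega> d = \<omega> b"
    proof (rule ccontr)
      assume "\<omega> d \<noteq> \<omega> b"
      then have "\<omega> b * \<omega> c < \<omega> d * \<omega> c" using le(1) w(3) by simp
      also have "\<dots> \<le> \<omega> d * \<omega> e" using le(2) by simp
      finally show False using eq by simp
    qed
    then have "d = b" using w(1) by (simp add: inj_eq)
    with that show False by simp
  qed
  have "mfps_nth (f * g) (b + c) =
      (\<Sum>p\<in>splits (b + c). if p = (b, c) then mfps_nth f b * mfps_nth g c else 0)"
    unfolding times_mfps_def mfps_nth_Abs
  proof (rule sum.cong[OF refl])
    fix p assume "p \<in> splits (b + c)"
    then show "(case p of (b, c) \<Rightarrow> mfps_nth f b * mfps_nth g c) =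
        (if p = (b, c) then mfps_nth f b * mfps_nth g c else 0)"
      using zero[of "fst p" "snd p"] by (auto simp: splits_def case_prod_beta)
  qed
  also have "\<dots> = mfps_nth f b * mfps_nth g c"
    by (subst sum.delta[OF finite_splits]) (auto simp: splits_def)
  finally have "mfps_nth (f * g) (b + c) \<noteq> 0" using b c by simp
  then show "f * g \<noteq> 0" by (auto simp: zero_mfps_def)
qed

definition mfps_const :: "'a::zero \<Rightarrow> 'a mfps" where
  "mfps_const c = Abs_mfps (\<lambda>m. if m = 0 then c else 0)"

definition mfps_var :: "nat \<Rightarrow> 'a::zero_neq_one mfps" where
  "mfps_var i = Abs_mfps (\<lambda>m. if m = Poly_Mapping.single i 1 then 1 else 0)"

definition mfps_tendsto ::
    "('b \<Rightarrow> 'a::topological_space mfps) \<Rightarrow> 'a mfps \<Rightarrow> 'b filter \<Rightarrow> bool" where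
  "mfps_tendsto F L \<F> \<longleftrightarrow> (\<forall>m. ((\<lambda>t. mfps_nth (F t) m) \<longlongrightarrow> mfps_nth L m) \<F>)"

definition to_fract :: "'a::idom \<Rightarrow> 'a fract" where
  "to_fract f = Fraction_Field.Fract f 1"


section \<open>Partial flags, fixed points and tautological classes\<close>

text \<open>
  The partial flag variety is given by \<open>n\<close>, the dimensions \<open>v 1, ..., v (n - 1)\<close> and
  \<open>w\<close>, the dimension of the framing space at the node \<open>n - 1\<close>.
\<close>

definition flag_dims :: "nat \<Rightarrow> nat \<Rightarrow> (nat \<Rightarrow> nat) \<Rightarrow> bool" where
  "flag_dims n w v \<longleftrightarrow> n \<ge> 2 \<and> (\<forall>i\<in>{1..n - 2}. v i \<le> v (i + 1)) \<and> v (n - 1) \<le> w"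

text \<open>
  The numbers \<open>v'\<^sub>i\<close>, that is the difference of the dimensions of the two
  neighbouring nodes. For \<open>n = 2\<close> the single node has \<open>v'\<^sub>1 = w\<close>. The
  subtraction never truncates when \<open>flag_dims n w v\<close> holds.
\<close>

definition dim' :: "nat \<Rightarrow> nat \<Rightarrow> (nat \<Rightarrow> nat) \<Rightarrow> nat \<Rightarrow> nat" where
  "dim' n w v i = (if i = n - 1 then w else v (i + 1)) - (if i = 1 then 0 else v (i - 1))"

text \<open>
  A fixed point is a chain of subsets of \<open>{a 1, ..., a w}\<close>; \<open>x i\<close> enumerates the
  \<open>i\<close>-th one.
\<close>

definition fixed_point ::
    "nat \<Rightarrow> nat \<Rightarrow> (nat \<Rightarrow> nat) \<Rightarrow> (nat \<Rightarrow> complex) \<Rightarrow> (nat \<Rightarrow> nat \<Rightarrow> complex) \<Rightarrow> bool" where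
  "fixed_point n w v a x \<longleftrightarrow>
     (\<forall>i\<in>{1..n - 1}. inj_on (x i) {1..v i}) \<and>
     (\<forall>i\<in>{1..n - 2}. x i ` {1..v i} \<subseteq> x (i + 1) ` {1..v (i + 1)}) \<and>
     x (n - 1) ` {1..v (n - 1)} \<subseteq> a ` {1..w}"

text \<open>
  Laurent polynomials in variables indexed by pairs \<open>(i, j)\<close>, standing for the
  \<open>j\<close>-th Chern root of the \<open>i\<close>-th tautological bundle, as elements of the group
  algebra of exponent vectors.
\<close>

type_synonym laurent = "((nat \<times> nat) \<Rightarrow>\<^sub>0 int) \<Rightarrow>\<^sub>0 complex"

definition tautological :: "nat \<Rightarrow> (nat \<Rightarrow> nat) \<Rightarrow> laurent \<Rightarrow> bool" where
  "tautological n v \<tau> \<longleftrightarrow>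
     (\<forall>m\<in>Poly_Mapping.keys \<tau>. Poly_Mapping.keys m \<subseteq> (SIGMA i:{1..n - 1}. {1..v i})) \<and>
     (\<forall>\<sigma> m. (\<forall>i. \<sigma> i permutes {1..v i}) \<longrightarrow>
        Poly_Mapping.lookup \<tau> (Poly_Mapping.map_key (\<lambda>(i, j). (i, \<sigma> i j)) m) =
        Poly_Mapping.lookup \<tau> m)"

definition laurent_eval ::
    "(complex \<Rightarrow> 'k::field) \<Rightarrow> laurent \<Rightarrow> (nat \<Rightarrow> nat \<Rightarrow> 'k) \<Rightarrow> 'k" where
  "laurent_eval \<iota> \<tau> s =
     (\<Sum>m\<in>Poly_Mapping.keys \<tau>. \<iota> (Poly_Mapping.lookup \<tau> m) *
        (\<Prod>(i, j)\<in>Poly_Mapping.keys m. s i j powi Poly_Mapping.lookup m (i, j)))"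


section \<open>The bare vertex\<close>

definition phi :: "complex \<Rightarrow> complex \<Rightarrow> complex" where
  "phi q x = prodinf (\<lambda>i. 1 - q ^ i * x)"

definition qpoch :: "complex \<Rightarrow> complex \<Rightarrow> int \<Rightarrow> complex" where
  "qpoch q x d = phi q x / phi q (q powi d * x)"

text \<open>
  The symbol \<open>{x}\<^sub>d\<close>. For \<open>x = 1\<close> and \<open>d < 0\<close> the denominator \<open>(q, q)\<^sub>d\<close> is infinite, so
  that \<open>{1}\<^sub>d = 0\<close>; with division by zero equal to zero, \<open>qpoch q q d\<close> is \<open>0\<close>
  and \<open>curly q h 1 d\<close> is \<open>0\<close> as well, so this convention gives the right value.
\<close>

definition curly :: "complex \<Rightarrow> complex \<Rightarrow> complex \<Rightarrow> int \<Rightarrow> complex" where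
  "curly q h x d = qpoch q (h / x) d / qpoch q (q / x) d * (- (csqrt q / csqrt h)) powi d"

text \<open>
  The index set \<open>C\<close>; collections are extended by zero outside of their range.
\<close>

definition vertex_degrees :: "nat \<Rightarrow> (nat \<Rightarrow> nat) \<Rightarrow> (nat \<Rightarrow> nat \<Rightarrow> nat) set" where
  "vertex_degrees n v =
     {d. (\<forall>i j. (i, j) \<notin> (SIGMA i:{1..n - 1}. {1..v i}) \<longrightarrow> d i j = 0) \<and>
         (\<forall>i\<in>{1..n - 2}. \<exists>J. inj_on J {1..v i} \<and> J ` {1..v i} \<subseteq> {1..v (i + 1)} \<and>
            (\<forall>k\<in>{1..v i}. d i k \<ge> d (i + 1) (J k)))}"

definition vertex_term ::
    "nat \<Rightarrow> nat \<Rightarrow> (nat \<Rightarrow> nat) \<Rightarrow> (nat \<Rightarrow> complex) \<Rightarrow> (nat \<Rightarrow> nat \<Rightarrow> complex) \<Rightarrow>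
     laurent \<Rightarrow> complex \<Rightarrow> complex \<Rightarrow> (nat \<Rightarrow> nat \<Rightarrow> nat) \<Rightarrow> complex" where
  "vertex_term n w v a x \<tau> q h d =
     csqrt q ^ (\<Sum>i=1..n - 1. dim' n w v i * (\<Sum>j=1..v i. d i j)) *
     (\<Prod>i=1..n - 1. \<Prod>j=1..v i. \<Prod>k=1..v i.
        inverse (curly q h (x i j / x i k) (int (d i j) - int (d i k)))) *
     (\<Prod>j=1..v (n - 1). \<Prod>k=1..w. curly q h (x (n - 1) j / a k) (int (d (n - 1) j))) *
     (\<Prod>i=1..n - 2. \<Prod>j=1..v i. \<Prod>k=1..v (i + 1).
        curly q h (x i j / x (i + 1) k) (int (d i j) - int (d (i + 1) k))) *
     laurent_eval id \<tau> (\<lambda>i j. x i j * q powi (- int (d i j)))"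

text \<open>The bare vertex at a fixed point, as a power series in \<open>z\<^sub>1, ..., z\<^sub>n\<^sub>-\<^sub>1\<close>.\<close>

definition bare_vertex ::
    "nat \<Rightarrow> nat \<Rightarrow> (nat \<Rightarrow> nat) \<Rightarrow> (nat \<Rightarrow> complex) \<Rightarrow> (nat \<Rightarrow> nat \<Rightarrow> complex) \<Rightarrow>
     laurent \<Rightarrow> complex \<Rightarrow> complex \<Rightarrow> complex mfps" where
  "bare_vertex n w v a x \<tau> q h = Abs_mfps (\<lambda>m.
     if Poly_Mapping.keys m \<subseteq> {1..n - 1}
     then \<Sum>d \<in> {d \<in> vertex_degrees n v.
                   \<forall>i\<in>{1..n - 1}. (\<Sum>j=1..v i. d i j) = Poly_Mapping.lookup m i}.
            vertex_term n w v a x \<tau> q h d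
     else 0)"

text \<open>
  The same series in the variables \<open>z\<^sup>\<sharp>\<^sub>i = z\<^sub>i (- h\<^sup>1\<^sup>/\<^sup>2)^v'\<^sub>i\<close>, i.e. after
  substituting \<open>z\<^sub>i = z\<^sup>\<sharp>\<^sub>i / (- h\<^sup>1\<^sup>/\<^sup>2)^v'\<^sub>i\<close>.
\<close>

definition bare_vertex_sharp ::
    "nat \<Rightarrow> nat \<Rightarrow> (nat \<Rightarrow> nat) \<Rightarrow> (nat \<Rightarrow> complex) \<Rightarrow> (nat \<Rightarrow> nat \<Rightarrow> complex) \<Rightarrow>
     laurent \<Rightarrow> complex \<Rightarrow> complex \<Rightarrow> complex mfps" where
  "bare_vertex_sharp n w v a x \<tau> q h = Abs_mfps (\<lambda>m.
     mfps_nth (bare_vertex n w v a x \<tau> q h) m /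
     (\<Prod>i=1..n - 1. ((- csqrt h) ^ dim' n w v i) ^ Poly_Mapping.lookup m i))"


section \<open>Quantum tautological classes of the partial flag variety\<close>

text \<open>
  The coefficients of the vertex are rational functions of \<open>q\<^sup>1\<^sup>/\<^sup>2\<close>, \<open>h\<^sup>1\<^sup>/\<^sup>2\<close> and
  the \<open>a\<^sub>j\<close>, written above as quotients of infinite products. The limits run over the
  parameters for which no numerator and denominator in \<open>(x, q)\<^sub>d = phi x / phi (q^d x)\<close>
  vanish simultaneously, apart from the degenerate case \<open>{1}\<^sub>d\<close>.
\<close>

definition generic_q :: "nat \<Rightarrow> (nat \<Rightarrow> complex) \<Rightarrow> complex set" where
  "generic_q w a = {q. 0 < norm q \<and> norm q < 1 \<and>
     (\<forall>j\<in>{1..w}. \<forall>k\<in>{1..w}. \<forall>m::int. j \<noteq> k \<longrightarrow> a j \<noteq> q powi m * a k)}"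

definition generic_h :: "nat \<Rightarrow> (nat \<Rightarrow> complex) \<Rightarrow> complex \<Rightarrow> complex set" where
  "generic_h w a q = {h. \<forall>j\<in>{1..w}. \<forall>k\<in>{1..w}. \<forall>m::int. h * a j \<noteq> q powi m * a k}"

text \<open>\<open>Vbar q\<close> is the limit of the vertex as \<open>h\<close> tends to infinity with \<open>z\<^sup>\<sharp>\<close> fixed.\<close>

definition compact_vertex ::
    "nat \<Rightarrow> nat \<Rightarrow> (nat \<Rightarrow> nat) \<Rightarrow> (nat \<Rightarrow> complex) \<Rightarrow> (nat \<Rightarrow> nat \<Rightarrow> complex) \<Rightarrow>
     laurent \<Rightarrow> (complex \<Rightarrow> complex mfps) \<Rightarrow> bool" where
  "compact_vertex n w v a x \<tau> Vbar \<longleftrightarrow>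
     (\<forall>q\<in>generic_q w a.
        mfps_tendsto (\<lambda>h. bare_vertex_sharp n w v a x \<tau> q h) (Vbar q)
          (inf at_infinity (principal (generic_h w a q))))"

text \<open>
  \<open>E\<close>, a power series in the \<open>z\<^sup>\<sharp>\<^sub>i\<close>, is the eigenvalue at the fixed point \<open>x\<close> of
  multiplication by the quantum tautological class attached to \<open>\<tau>\<close>: the limit of the
  quotient of compact vertices as \<open>q\<close> tends to \<open>1\<close>. Both limits are taken
  coefficientwise, and determine \<open>E\<close> uniquely.
\<close>

definition quantum_eigenvalue ::
    "nat \<Rightarrow> nat \<Rightarrow> (nat \<Rightarrow> nat) \<Rightarrow> (nat \<Rightarrow> complex) \<Rightarrow> (nat \<Rightarrow> nat \<Rightarrow> complex) \<Rightarrow>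
     laurent \<Rightarrow> complex mfps \<Rightarrow> bool" where
  "quantum_eigenvalue n w v a x \<tau> E \<longleftrightarrow>
     (\<exists>V\<tau> V1 R.
        compact_vertex n w v a x \<tau> V\<tau> \<and> compact_vertex n w v a x 1 V1 \<and>
        (\<forall>q\<in>generic_q w a. V1 q \<noteq> 0 \<and>
           to_fract (R q) = to_fract (V\<tau> q) / to_fract (V1 q)) \<and>
        mfps_tendsto R E (at 1 within generic_q w a))"


section \<open>Bethe roots\<close>

text \<open>
  The Bethe ansatz equations over a field, with parameters \<open>\<zeta> i\<close> and inhomogeneities
  \<open>a j\<close>. At \<open>i = n - 1\<close> the first factor refers to the framing, at \<open>i = 1\<close> the
  second factor is absent; for \<open>n = 2\<close> both apply to the only node. The first two
  conditions say that the denominators do not vanish.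
\<close>

definition bethe_roots ::
    "nat \<Rightarrow> nat \<Rightarrow> (nat \<Rightarrow> nat) \<Rightarrow> (nat \<Rightarrow> 'k::field) \<Rightarrow> (nat \<Rightarrow> 'k) \<Rightarrow> (nat \<Rightarrow> nat \<Rightarrow> 'k) \<Rightarrow> bool" where
  "bethe_roots n w v a \<zeta> s \<longleftrightarrow>
     (\<forall>i\<in>{1..n - 1}. \<forall>k\<in>{1..v i}. s i k \<noteq> 0) \<and>
     (\<forall>i\<in>{2..n - 1}. \<forall>j\<in>{1..v (i - 1)}. \<forall>k\<in>{1..v i}. s (i - 1) j \<noteq> s i k) \<and>
     (\<forall>i\<in>{1..n - 1}. \<forall>k\<in>{1..v i}.
        (if i = n - 1 then \<Prod>j=1..w. (s i k - a j) / a j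
         else \<Prod>j=1..v (i + 1). (s i k - s (i + 1) j) / s (i + 1) j) *
        (if i = 1 then 1 else \<Prod>j=1..v (i - 1). s i k / (s (i - 1) j - s i k)) =
        \<zeta> i * (\<Prod>j\<in>{1..v i} - {k}. - s i k / s i j))"

text \<open>
  Constants and the parameters \<open>z\<^sup>\<sharp>\<^sub>i\<close> in the fraction field of power series.

  With the vertex above, the right-hand side of the Bethe equations carries the parameter
  \<open>z\<^sub>i h^(v'\<^sub>i / 2)\<close>, which is \<open>(- 1)^v'\<^sub>i z\<^sup>\<sharp>\<^sub>i\<close> and not \<open>z\<^sup>\<sharp>\<^sub>i\<close>, because
  \<open>z\<^sup>\<sharp>\<^sub>i = z\<^sub>i (- h\<^sup>1\<^sup>/\<^sup>2)^v'\<^sub>i\<close>. For the point (\<open>n = 2\<close>, \<open>v 1 = w = 1\<close>) the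
  vertices for \<open>\<tau> = 1\<close> and for the single Chern root are \<open>phi q (q z\<^sup>\<sharp>)\<close> and
  \<open>a * phi q z\<^sup>\<sharp>\<close>, and their quotient is \<open>a (1 - z\<^sup>\<sharp>)\<close>, which solves \<open>(s - a) / a = - z\<^sup>\<sharp>\<close>.
\<close>

definition cst :: "complex \<Rightarrow> complex mfps fract" where
  "cst c = to_fract (mfps_const c)"

definition zsharp :: "nat \<Rightarrow> complex mfps fract" where
  "zsharp i = to_fract (mfps_var i)"

end

(*
The Bethe roots are limits of quotients of vertices. Give every Chern root x_(i,j) its own
variable Z_(i,j), so that the limit of the vertex for large h becomes V = sum_d F_d Z^d, a series
over all d. Inserting the (i,j)-th root x_(i,j) q^(-d_(i,j)) amounts to applying the operator
x_(i,j) T_(i,j), where T_(i,j) shifts Z_(i,j) to Z_(i,j) / q. Hence the vertex with insertion of a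
product of roots, divided by V, is a product of shifts of the quotients r_(i,j) = T_(i,j) V / V. If
these converge as q tends to 1, to R_(i,j) say, then the insertion of any Laurent polynomial f,
divided by V, converges to f(s) with s_(i,j) = x_(i,j) R_(i,j).

The quotient F_(d + e_(i,j)) / F_d is a rational function of the roots, which gives one q-difference
equation for V for each (i,j). Its leading term contains the difference of the (i,j)-th root and of
the root of level i + 1 with the same value at d = 0. Therefore it determines, recursively in the
degree, the coefficients of r_(i,j), and the recursion has a limit as q tends to 1. The limits of the
equations, after setting all Z_(i,j) with the same i equal to z_i, are the Bethe equations.
*)
theory Submission
  imports Defs
begin

section \<open>Algebra and coefficientwise limits of power series\<close>

text \<open>The coefficients of V in general have poles at q = 1, so V itself has no limit; only the
  quotients r_(i,j) have one. This is why all operators are conjugated by V. Separate variables are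
  needed because the power of z_i records only the sum over j of the d_(i,j), so that inserting one
  single root is not an operation on a series in the z_i. The recursion works for three reasons. The
  right-hand side of the equation carries the factor Z_(i,j), so only lower degrees of it enter. On
  the left, the difference of the two shifts applied to 1 is x_(i,j) (r_(i,j) - r_(i+1,l)), without
  constant term; therefore the remaining factors act on its part of degree N by numbers, up to data
  of lower degree, and these numbers have a nonzero limit because the roots of one level are
  distinct and nonzero. Finally r = 1 on the framing level, from which one descends level by level.
  The limits of the equations still contain the factors s_(i,k) - s_(i,j) on both sides; these have
  nonzero constant terms and cancel.\<close>

lemma mfps_nth_simps [simp]:
  "mfps_nth 0 m = 0"
  "mfps_nth (f + g) m = mfps_nth f m + mfps_nth g m"
  "mfps_nth (f - g) m = mfps_nth f m - mfps_nth g m"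
  "mfps_nth (- f) m = - mfps_nth f m"
  by (simp_all add: zero_mfps_def plus_mfps_def minus_mfps_def uminus_mfps_def)

lemma mfps_nth_one: "mfps_nth 1 m = (if m = 0 then 1 else 0)"
  by (simp add: one_mfps_def)

lemma mfps_nth_mult: "mfps_nth (f * g) m = (\<Sum>(b, c)\<in>splits m. mfps_nth f b * mfps_nth g c)"
  by (simp add: times_mfps_def)

lemma mfps_nth_sum: "mfps_nth (sum f A) m = (\<Sum>i\<in>A. mfps_nth (f i) m)"
  by (induction A rule: infinite_finite_induct) auto

lemma splits_zero [simp]: "splits 0 = {(0, 0)}"
proof -
  have "b = 0 \<and> c = 0" if "b + c = 0" for b c :: "nat \<Rightarrow>\<^sub>0 nat"
  proof -
    have "Poly_Mapping.lookup b i + Poly_Mapping.lookup c i = 0" for i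
      using that by (metis lookup_add lookup_zero)
    then have "Poly_Mapping.lookup b i = 0" "Poly_Mapping.lookup c i = 0" for i by simp_all
    then show ?thesis by (simp add: poly_mapping_eq_iff fun_eq_iff)
  qed
  then have "b + c = 0 \<longleftrightarrow> b = 0 \<and> c = 0" for b c :: "nat \<Rightarrow>\<^sub>0 nat" by (metis add_0)
  then show ?thesis unfolding splits_def by blast
qed

lemma mfps_nth_0_mult: "mfps_nth (f * g) 0 = mfps_nth f 0 * mfps_nth g 0"
  by (simp add: mfps_nth_mult)

lemma mfps_nth_const: "mfps_nth (mfps_const c) m = (if m = 0 then c else 0)"
  by (simp add: mfps_const_def)

lemma mfps_nth_const_mult [simp]: "mfps_nth (mfps_const c * f) m = c * mfps_nth f m"
proof -
  have "mfps_nth (mfps_const c * f) m = (\<Sum>p\<in>splits m. if p = (0, m) then c * mfps_nth f m else 0)"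
    unfolding mfps_nth_mult mfps_nth_const by (rule sum.cong) (auto simp: splits_def split: if_splits)
  also have "\<dots> = c * mfps_nth f m"
    by (subst sum.delta[OF finite_splits]) (auto simp: splits_def)
  finally show ?thesis .
qed

lemma mfps_const_1 [simp]: "mfps_const 1 = 1"
  by (rule mfps_eqI) (simp add: mfps_nth_const mfps_nth_one)

lemma mfps_const_mult: "mfps_const (c * d) = mfps_const c * mfps_const d"
  by (rule mfps_eqI) (simp add: mfps_nth_const)

lemma mfps_nth_var_mult:
  "mfps_nth (mfps_var i * f) m =
    (if Poly_Mapping.lookup m i = 0 then 0 else mfps_nth f (m - Poly_Mapping.single i 1))"
proof -
  let ?e = "Poly_Mapping.single i (1::nat)"
  have *: "?e + c = m \<Longrightarrow> c = m - ?e" "?e + c = m \<Longrightarrow> Poly_Mapping.lookup m i \<noteq> 0" for c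
    by (auto simp: lookup_add)
  have **: "?e + (m - ?e) = m" if "Poly_Mapping.lookup m i \<noteq> 0"
    using that by (intro poly_mapping_eqI) (auto simp: lookup_add lookup_minus lookup_single when_def)
  have "mfps_nth (mfps_var i * f) m =
      (\<Sum>p\<in>splits m. if p = (?e, m - ?e) then mfps_nth f (m - ?e) else 0)"
    unfolding mfps_nth_mult mfps_var_def mfps_nth_Abs
  proof (rule sum.cong[OF refl])
    fix p assume "p \<in> splits m"
    then obtain b c where p: "p = (b, c)" and bc: "b + c = m" by (auto simp: splits_def)
    show "(case p of (b, c) \<Rightarrow> (if b = ?e then 1 else 0) * mfps_nth f c) =
        (if p = (?e, m - ?e) then mfps_nth f (m - ?e) else 0)"
    proof (cases "b = ?e")
      case True
      then have "c = m - ?e" using *(1)[of c] bc by simp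
      then show ?thesis using p True by simp
    qed (simp add: p)
  qed
  also have "\<dots> = (if Poly_Mapping.lookup m i = 0 then 0 else mfps_nth f (m - ?e))"
  proof -
    have "(?e, m - ?e) \<in> splits m \<longleftrightarrow> Poly_Mapping.lookup m i \<noteq> 0"
      unfolding splits_def mem_Collect_eq prod.case using *(2)[of "m - ?e"] ** by blast
    then show ?thesis by (subst sum.delta[OF finite_splits]) simp
  qed
  finally show ?thesis .
qed

section \<open>Total degree and inverses by geometric series\<close>

definition mdeg :: "(nat \<Rightarrow>\<^sub>0 nat) \<Rightarrow> nat" where
  "mdeg m = (\<Sum>i\<in>Poly_Mapping.keys m. Poly_Mapping.lookup m i)"

lemma mdeg_add: "mdeg (b + c) = mdeg b + mdeg c"
proof -
  let ?K = "Poly_Mapping.keys b \<union> Poly_Mapping.keys c"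
  have ext: "mdeg m = (\<Sum>i\<in>?K. Poly_Mapping.lookup m i)" if "Poly_Mapping.keys m \<subseteq> ?K" for m
    unfolding mdeg_def using that by (intro sum.mono_neutral_left) (auto simp: in_keys_iff)
  have "Poly_Mapping.keys (b + c) \<subseteq> ?K" by (rule keys_add)
  then show ?thesis by (simp add: ext lookup_add sum.distrib)
qed

lemma mdeg_eq_0_iff [simp]: "mdeg m = 0 \<longleftrightarrow> m = 0"
  by (auto simp: mdeg_def in_keys_iff intro!: poly_mapping_eqI)

lemma mdeg_single: "mdeg (Poly_Mapping.single i k) = k"
  by (auto simp: mdeg_def)

text \<open>Each factor without constant term raises the lowest degree by at least one. This
  truncates the geometric series below.\<close>

lemma mfps_nth_power_eq_0:
  assumes "mfps_nth f 0 = 0" "mdeg m < k"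
  shows "mfps_nth (f ^ k) m = 0"
  using assms(2)
proof (induction k arbitrary: m)
  case (Suc k)
  have "mfps_nth f b * mfps_nth (f ^ k) c = 0" if "b + c = m" for b c
  proof (cases "b = 0")
    case False
    then have "mdeg c < k" using that Suc.prems mdeg_add[of b c] by (simp flip: mdeg_eq_0_iff)
    then show ?thesis using Suc.IH by simp
  qed (use assms in simp)
  then show ?case by (auto simp: mfps_nth_mult splits_def intro!: sum.neutral)
qed simp

text \<open>The geometric series of \<open>1 - f\<close>, cut off at the degree of the monomial.
  Each coefficient is a polynomial in finitely many coefficients of \<open>f\<close>, hence
  compatible with coefficientwise limits. It is the inverse of \<open>f\<close> when the constant
  term is \<open>1\<close>.\<close>

definition mfps_inv :: "'a::comm_ring_1 mfps \<Rightarrow> 'a mfps" where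
  "mfps_inv f = Abs_mfps (\<lambda>m. \<Sum>k\<le>mdeg m. mfps_nth ((1 - f) ^ k) m)"

lemma mfps_inv_right:
  assumes "mfps_nth f 0 = 1"
  shows "f * mfps_inv f = 1"
proof (rule mfps_eqI)
  fix m
  let ?u = "1 - f" and ?N = "mdeg m"
  have u0: "mfps_nth ?u 0 = 0" using assms by (simp add: mfps_nth_one)
  have inv: "mfps_nth (mfps_inv f) c = mfps_nth (\<Sum>k<Suc ?N. ?u ^ k) c" if "mdeg c \<le> ?N" for c
    unfolding mfps_inv_def mfps_nth_Abs mfps_nth_sum
    using that by (intro sum.mono_neutral_left) (auto intro: mfps_nth_power_eq_0[OF u0])
  have "mfps_nth (f * mfps_inv f) m = mfps_nth (f * (\<Sum>k<Suc ?N. ?u ^ k)) m"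
    unfolding mfps_nth_mult by (intro sum.cong) (auto simp: splits_def inv mdeg_add)
  also have "f * (\<Sum>k<Suc ?N. ?u ^ k) = 1 - ?u ^ Suc ?N"
    using one_diff_power_eq[of ?u "Suc ?N"] by simp
  also have "mfps_nth \<dots> m = mfps_nth 1 m"
    using mfps_nth_power_eq_0[OF u0, of m "Suc ?N"] by simp
  finally show "mfps_nth (f * mfps_inv f) m = mfps_nth 1 m" .
qed

lemma mfps_inv_unique:
  assumes "f * g = 1" "mfps_nth f 0 = 1"
  shows "mfps_inv f = g"
  using mfps_inv_right[OF assms(2)] assms(1) by (metis mult.assoc mult.commute mult_1_left)

lemma mfps_nth_0_inv: "mfps_nth (mfps_inv f) 0 = 1"
  by (simp add: mfps_inv_def mdeg_def mfps_nth_one)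

section \<open>Coefficientwise limits\<close>

lemma mfps_tendsto_const [intro]: "mfps_tendsto (\<lambda>_. L) L F"
  by (simp add: mfps_tendsto_def)

lemma mfps_tendsto_add:
  fixes f g :: "'b \<Rightarrow> 'a::{comm_ring_1,real_normed_algebra} mfps"
  shows "mfps_tendsto f L F \<Longrightarrow> mfps_tendsto g M F \<Longrightarrow> mfps_tendsto (\<lambda>t. f t + g t) (L + M) F"
  by (auto simp: mfps_tendsto_def intro: tendsto_intros)

lemma mfps_tendsto_diff:
  fixes f g :: "'b \<Rightarrow> 'a::{comm_ring_1,real_normed_algebra} mfps"
  shows "mfps_tendsto f L F \<Longrightarrow> mfps_tendsto g M F \<Longrightarrow> mfps_tendsto (\<lambda>t. f t - g t) (L - M) F"
  by (auto simp: mfps_tendsto_def intro: tendsto_intros)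

lemma mfps_tendsto_mult:
  fixes f g :: "'b \<Rightarrow> 'a::{comm_ring_1,real_normed_algebra} mfps"
  shows "mfps_tendsto f L F \<Longrightarrow> mfps_tendsto g M F \<Longrightarrow> mfps_tendsto (\<lambda>t. f t * g t) (L * M) F"
  by (auto simp: mfps_tendsto_def mfps_nth_mult case_prod_beta intro!: tendsto_intros)

lemma mfps_tendsto_const_coeff:
  assumes "(c \<longlongrightarrow> l) F"
  shows "mfps_tendsto (\<lambda>t. mfps_const (c t :: 'a :: {zero,topological_space})) (mfps_const l) F"
  using assms by (auto simp: mfps_tendsto_def mfps_nth_const)

lemma mfps_tendsto_power:
  fixes f :: "'b \<Rightarrow> 'a::{comm_ring_1,real_normed_algebra} mfps"
  shows "mfps_tendsto f L F \<Longrightarrow> mfps_tendsto (\<lambda>t. f t ^ k) (L ^ k) F"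
  by (induction k) (auto intro: mfps_tendsto_mult)

lemma mfps_tendsto_inv:
  fixes f :: "'b \<Rightarrow> 'a::{comm_ring_1,real_normed_algebra} mfps"
  assumes "mfps_tendsto f L F"
  shows "mfps_tendsto (\<lambda>t. mfps_inv (f t)) (mfps_inv L) F"
proof -
  have "mfps_tendsto (\<lambda>t. (1 - f t) ^ k) ((1 - L) ^ k) F" for k
    by (intro mfps_tendsto_power mfps_tendsto_diff mfps_tendsto_const assms)
  then show ?thesis
    unfolding mfps_tendsto_def mfps_inv_def mfps_nth_Abs by (auto intro!: tendsto_sum)
qed

lemma mfps_tendsto_unique:
  fixes f :: "'b \<Rightarrow> 'a::t2_space mfps"
  assumes "mfps_tendsto f L F" "mfps_tendsto f M F" "F \<noteq> bot"
  shows "L = M"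
  using assms by (intro mfps_eqI) (auto simp: mfps_tendsto_def intro: tendsto_unique)

lemma mfps_tendsto_cong:
  assumes "mfps_tendsto f L F" "\<forall>\<^sub>F t in F. f t = g t"
  shows "mfps_tendsto g L F"
  unfolding mfps_tendsto_def
proof
  fix m
  have "\<forall>\<^sub>F t in F. mfps_nth (f t) m = mfps_nth (g t) m"
    using assms(2) by (rule eventually_mono) simp
  then show "((\<lambda>t. mfps_nth (g t) m) \<longlongrightarrow> mfps_nth L m) F"
    using assms(1) unfolding mfps_tendsto_def by (blast intro: Lim_transform_eventually)
qed

section \<open>Rescaling of coefficients and substitution of variables\<close>

definition scale_coeffs :: "((nat \<Rightarrow>\<^sub>0 nat) \<Rightarrow> 'a) \<Rightarrow> 'a::comm_ring_1 mfps \<Rightarrow> 'a mfps" where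
  "scale_coeffs g f = Abs_mfps (\<lambda>m. g m * mfps_nth f m)"

lemma mfps_nth_scale_coeffs [simp]: "mfps_nth (scale_coeffs g f) m = g m * mfps_nth f m"
  by (simp add: scale_coeffs_def)

lemma scale_coeffs_mult:
  assumes "\<And>b c. g (b + c) = g b * g c"
  shows "scale_coeffs g (f * h) = scale_coeffs g f * scale_coeffs g h"
  by (rule mfps_eqI)
    (auto simp: mfps_nth_mult sum_distrib_left splits_def assms mult_ac intro!: sum.cong)

definition push :: "nat set \<Rightarrow> (nat \<Rightarrow> nat) \<Rightarrow> (nat \<Rightarrow>\<^sub>0 nat) \<Rightarrow> (nat \<Rightarrow>\<^sub>0 nat)" where
  "push K \<pi> M = (\<Sum>k\<in>K. Poly_Mapping.single (\<pi> k) (Poly_Mapping.lookup M k))"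

lemma push_add: "push K \<pi> (b + c) = push K \<pi> b + push K \<pi> c"
  by (simp add: push_def lookup_add single_add sum.distrib)

lemma lookup_push: "finite K \<Longrightarrow>
  Poly_Mapping.lookup (push K \<pi> M) i = (\<Sum>k\<in>{k\<in>K. \<pi> k = i}. Poly_Mapping.lookup M k)"
  by (simp add: push_def lookup_sum lookup_single sum.inter_filter when_def)

definition push_fiber :: "nat set \<Rightarrow> (nat \<Rightarrow> nat) \<Rightarrow> (nat \<Rightarrow>\<^sub>0 nat) \<Rightarrow> (nat \<Rightarrow>\<^sub>0 nat) set" where
  "push_fiber K \<pi> m = {M. Poly_Mapping.keys M \<subseteq> K \<and> push K \<pi> M = m}"

text \<open>Exponents are natural numbers and cannot cancel, so every exponent of a preimage is
  bounded by the corresponding exponent of \<open>m\<close>.\<close>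

lemma finite_push_fiber:
  assumes "finite K"
  shows "finite (push_fiber K \<pi> m)"
proof (rule finite_subset)
  define B where "B = (\<Sum>k\<in>K. Poly_Mapping.single k (Poly_Mapping.lookup m (\<pi> k)))"
  have B: "Poly_Mapping.lookup B k = (if k \<in> K then Poly_Mapping.lookup m (\<pi> k) else 0)" for k
    using assms by (simp add: B_def lookup_sum lookup_single when_def)
  show "push_fiber K \<pi> m \<subseteq> {M. \<forall>k. Poly_Mapping.lookup M k \<le> Poly_Mapping.lookup B k}"
  proof clarify
    fix M k assume M: "M \<in> push_fiber K \<pi> m"
    show "Poly_Mapping.lookup M k \<le> Poly_Mapping.lookup B k"
    proof (cases "k \<in> K")
      case True
      have "Poly_Mapping.lookup M k \<le> (\<Sum>l\<in>{l\<in>K. \<pi> l = \<pi> k}. Poly_Mapping.lookup M l)"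
        using True assms by (intro member_le_sum) auto
      also have "\<dots> = Poly_Mapping.lookup m (\<pi> k)"
        using M lookup_push[OF assms, of \<pi> M "\<pi> k"] by (simp add: push_fiber_def)
      finally show ?thesis using True B by simp
    next
      case False
      then have "k \<notin> Poly_Mapping.keys M" using M by (auto simp: push_fiber_def)
      then show ?thesis by (simp add: in_keys_iff)
    qed
  qed
  show "finite {M. \<forall>k. Poly_Mapping.lookup M k \<le> Poly_Mapping.lookup B k}"
    by (rule finite_below_mono)
qed

text \<open>
  The substitution of \<open>z (\<pi> k)\<close> for the variable \<open>k \<in> K\<close> and of \<open>0\<close> for all other variables.
\<close>

definition subst_vars :: "nat set \<Rightarrow> (nat \<Rightarrow> nat) \<Rightarrow> 'a::comm_ring_1 mfps \<Rightarrow> 'a mfps" where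
  "subst_vars K \<pi> f = Abs_mfps (\<lambda>m. \<Sum>M\<in>push_fiber K \<pi> m. mfps_nth f M)"

lemma subst_vars_add: "subst_vars K \<pi> (f + g) = subst_vars K \<pi> f + subst_vars K \<pi> g"
  by (rule mfps_eqI) (simp add: subst_vars_def sum.distrib)

lemma subst_vars_diff: "subst_vars K \<pi> (f - g) = subst_vars K \<pi> f - subst_vars K \<pi> g"
  by (rule mfps_eqI) (simp add: subst_vars_def sum_subtractf)

lemma keys_subset_add_iff:
  fixes b c :: "'b \<Rightarrow>\<^sub>0 nat"
  shows "Poly_Mapping.keys (b + c) \<subseteq> K \<longleftrightarrow> Poly_Mapping.keys b \<subseteq> K \<and> Poly_Mapping.keys c \<subseteq> K"
proof -
  have "Poly_Mapping.keys (b + c) = Poly_Mapping.keys b \<union> Poly_Mapping.keys c"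
    by (auto simp: in_keys_iff lookup_add)
  then show ?thesis by simp
qed

text \<open>Splitting a preimage of \<open>m\<close> amounts to splitting \<open>m\<close> and
  choosing preimages of both parts, because \<open>push\<close> is additive and the variables of a
  sum are those of its parts.\<close>

lemma subst_vars_mult:
  assumes "finite K"
  shows "subst_vars K \<pi> (f * g) = subst_vars K \<pi> f * subst_vars K \<pi> g"
proof (rule mfps_eqI)
  fix m
  let ?t = "\<lambda>b c. mfps_nth f b * mfps_nth g c"
  let ?fib = "push_fiber K \<pi>"
  note fin = finite_push_fiber[OF assms]
  have "mfps_nth (subst_vars K \<pi> (f * g)) m = (\<Sum>M\<in>?fib m. \<Sum>(b, c)\<in>splits M. ?t b c)"
    by (simp add: subst_vars_def mfps_nth_mult)
  also have "\<dots> = (\<Sum>(M, (b, c))\<in>(SIGMA M:?fib m. splits M). ?t b c)"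
    using fin by (subst sum.Sigma) (auto intro!: sum.cong)
  also have "\<dots> = (\<Sum>((b', c'), (b, c))\<in>(SIGMA p:splits m. ?fib (fst p) \<times> ?fib (snd p)). ?t b c)"
    by (rule sum.reindex_bij_witness[where
          i = "\<lambda>((b', c'), (b, c)). (b + c, (b, c))" and
          j = "\<lambda>(M, (b, c)). ((push K \<pi> b, push K \<pi> c), (b, c))"])
      (auto simp: splits_def push_fiber_def push_add keys_subset_add_iff
        dest!: subsetD[OF keys_add])
  also have "\<dots> = (\<Sum>(b', c')\<in>splits m. \<Sum>(b, c)\<in>?fib b' \<times> ?fib c'. ?t b c)"
    using fin by (subst sum.Sigma[symmetric]) (auto intro!: sum.cong)
  also have "\<dots> = mfps_nth (subst_vars K \<pi> f * subst_vars K \<pi> g) m"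
    by (simp add: subst_vars_def mfps_nth_mult sum_product sum.cartesian_product)
  finally show "mfps_nth (subst_vars K \<pi> (f * g)) m
      = mfps_nth (subst_vars K \<pi> f * subst_vars K \<pi> g) m" .
qed

lemma push_fiber_0:
  assumes "finite K"
  shows "push_fiber K \<pi> 0 = {0}"
proof -
  have "M = 0" if "Poly_Mapping.keys M \<subseteq> K" "push K \<pi> M = 0" for M
  proof (rule poly_mapping_eqI)
    fix k
    show "Poly_Mapping.lookup M k = Poly_Mapping.lookup 0 k"
    proof (cases "k \<in> K")
      case True
      have "(\<Sum>l\<in>{l\<in>K. \<pi> l = \<pi> k}. Poly_Mapping.lookup M l) = 0"
        using lookup_push[OF assms, of \<pi> M "\<pi> k"] that by simp
      then show ?thesis using True assms by auto
    qed (use that in \<open>auto simp: in_keys_iff\<close>)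
  qed
  then show ?thesis by (auto simp: push_fiber_def push_def)
qed

lemma mfps_nth_0_subst_vars: "finite K \<Longrightarrow> mfps_nth (subst_vars K \<pi> f) 0 = mfps_nth f 0"
  by (simp add: subst_vars_def push_fiber_0)

lemma subst_vars_const:
  assumes "finite K"
  shows "subst_vars K \<pi> (mfps_const c) = mfps_const c"
proof (rule mfps_eqI)
  fix m
  have "0 \<in> push_fiber K \<pi> m \<longleftrightarrow> m = 0" by (auto simp: push_fiber_def push_def)
  then show "mfps_nth (subst_vars K \<pi> (mfps_const c)) m = mfps_nth (mfps_const c) m"
    using finite_push_fiber[OF assms] by (simp add: subst_vars_def mfps_nth_const)
qed

lemma subst_vars_1: "finite K \<Longrightarrow> subst_vars K \<pi> 1 = 1"
  by (metis subst_vars_const mfps_const_1)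

lemma subst_vars_var:
  assumes "finite K" "k \<in> K"
  shows "subst_vars K \<pi> (mfps_var k) = (mfps_var (\<pi> k) :: 'a::comm_ring_1 mfps)"
proof (rule mfps_eqI)
  fix m
  let ?e = "Poly_Mapping.single k (1::nat)"
  have "push K \<pi> ?e = Poly_Mapping.single (\<pi> k) 1"
  proof -
    have "push K \<pi> ?e = (\<Sum>l\<in>K. if l = k then Poly_Mapping.single (\<pi> k) 1 else 0)"
      unfolding push_def by (rule sum.cong) (auto simp: lookup_single when_def)
    then show ?thesis using assms by simp
  qed
  then have "?e \<in> push_fiber K \<pi> m \<longleftrightarrow> m = Poly_Mapping.single (\<pi> k) 1"
    using assms by (auto simp: push_fiber_def)
  then show "mfps_nth (subst_vars K \<pi> (mfps_var k)) m = mfps_nth (mfps_var (\<pi> k) :: 'a mfps) m"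
    using finite_push_fiber[OF assms(1)] by (simp add: subst_vars_def mfps_var_def)
qed

lemma subst_vars_prod:
  "finite K \<Longrightarrow> subst_vars K \<pi> (prod f A) = (\<Prod>i\<in>A. subst_vars K \<pi> (f i))"
  by (induction A rule: infinite_finite_induct) (auto simp: subst_vars_1 subst_vars_mult)

lemma subst_vars_sum:
  "subst_vars K \<pi> (sum f A) = (\<Sum>i\<in>A. subst_vars K \<pi> (f i))"
proof -
  have "subst_vars K \<pi> 0 = 0" by (rule mfps_eqI) (simp add: subst_vars_def)
  then show ?thesis by (induction A rule: infinite_finite_induct) (auto simp: subst_vars_add)
qed

lemma mfps_tendsto_subst_vars:
  fixes f :: "'b \<Rightarrow> 'a::{comm_ring_1,real_normed_algebra} mfps"
  assumes "mfps_tendsto f L F"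
  shows "mfps_tendsto (\<lambda>t. subst_vars K \<pi> (f t)) (subst_vars K \<pi> L) F"
  using assms by (auto simp: mfps_tendsto_def subst_vars_def intro!: tendsto_sum)

section \<open>The embedding into the fraction field\<close>

lemma to_fract_simps:
  "to_fract (f + g) = to_fract f + to_fract g"
  "to_fract (f - g) = to_fract f - to_fract g"
  "to_fract (f * g) = to_fract f * to_fract g"
  "to_fract (- f) = - to_fract f"
  "to_fract 0 = 0" "to_fract 1 = 1"
  by (simp_all add: to_fract_def Zero_fract_def One_fract_def)

lemma to_fract_eq_iff: "to_fract f = to_fract g \<longleftrightarrow> f = g"
  by (simp add: to_fract_def eq_fract)

lemma to_fract_eq_0_iff: "to_fract f = 0 \<longleftrightarrow> f = 0"
  using to_fract_eq_iff[of f 0] by (simp add: to_fract_simps)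

lemma to_fract_prod: "to_fract (prod f A) = (\<Prod>i\<in>A. to_fract (f i))"
  by (induction A rule: infinite_finite_induct) (simp_all add: to_fract_simps)

lemma to_fract_sum: "to_fract (sum f A) = (\<Sum>i\<in>A. to_fract (f i))"
  by (induction A rule: infinite_finite_induct) (simp_all add: to_fract_simps)

lemma to_fract_power: "to_fract (f ^ k) = to_fract f ^ k"
  by (induction k) (simp_all add: to_fract_simps)

section \<open>The limit of large h of the vertex factors\<close>

lemma phi_convergent:
  fixes q x :: complex
  assumes "norm q < 1"
  shows "convergent_prod (\<lambda>i. 1 - q ^ i * x)"
proof -
  have "summable (\<lambda>i. norm q ^ i * norm x)"
    using assms by (intro summable_mult2 summable_geometric) auto
  moreover have "(\<lambda>i. norm ((1 - q ^ i * x) - 1)) = (\<lambda>i. norm q ^ i * norm x)"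
    by (simp add: fun_eq_iff norm_mult norm_power)
  ultimately have "summable (\<lambda>i. norm ((1 - q ^ i * x) - 1))" by simp
  then show ?thesis
    by (intro abs_convergent_prod_imp_convergent_prod) (simp add: abs_convergent_prod_conv_summable)
qed

lemma phi_rec:
  assumes "norm q < 1"
  shows "phi q x = (1 - x) * phi q (q * x)"
proof -
  have *: "(\<lambda>n. \<Prod>i\<le>n. 1 - q ^ i * y) \<longlonglongrightarrow> phi q y" for y
    unfolding phi_def by (intro convergent_prod_LIMSEQ phi_convergent assms)
  have "(\<Prod>i\<le>Suc n. 1 - q ^ i * x) = (1 - x) * (\<Prod>i\<le>n. 1 - q ^ i * (q * x))" for n
    by (subst prod.atMost_Suc_shift) (simp add: mult_ac)
  then have "(\<lambda>n. \<Prod>i\<le>Suc n. 1 - q ^ i * x) \<longlonglongrightarrow> (1 - x) * phi q (q * x)"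
    using tendsto_mult[OF tendsto_const *] by simp
  then show ?thesis
    using LIMSEQ_Suc[OF *[of x]] LIMSEQ_unique by blast
qed

lemma phi_nonzero:
  assumes "norm q < 1" "\<And>i::nat. q ^ i * x \<noteq> 1"
  shows "phi q x \<noteq> 0"
  unfolding phi_def using assms by (intro prodinf_nonzero phi_convergent) auto

lemma phi_eq_0:
  assumes "norm q < 1" "q ^ i * x = 1"
  shows "phi q x = 0"
  using assms(2)
proof (induction i arbitrary: x)
  case 0
  then show ?case using phi_rec[OF assms(1), of x] by simp
next
  case (Suc i)
  then have "phi q (q * x) = 0" by (simp add: mult_ac)
  then show ?case using phi_rec[OF assms(1), of x] by simp
qed

lemma qpoch_rec:
  assumes "norm q < 1" "q \<noteq> 0" "q powi d * x \<noteq> 1"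
  shows "qpoch q x (d + 1) = qpoch q x d * (1 - q powi d * x)"
proof -
  have "phi q (q powi d * x) = (1 - q powi d * x) * phi q (q powi (d + 1) * x)"
    using phi_rec[OF assms(1), of "q powi d * x"] assms(2) by (simp add: power_int_add_1 mult_ac)
  then show ?thesis using assms(3) by (simp add: qpoch_def)
qed

text \<open>
  Up to the power \<open>h\<^sup>d\<^sup>/\<^sup>2\<close>, the limit of \<open>curly q h x d\<close> as \<open>h\<close> tends to infinity. As for
  \<open>curly\<close>, division by zero gives the right value \<open>0\<close> for \<open>x = 1\<close> and \<open>d < 0\<close>.
\<close>

definition curly_limit :: "complex \<Rightarrow> complex \<Rightarrow> int \<Rightarrow> complex" where
  "curly_limit q x d = csqrt q powi (d ^ 2) / (x powi d * qpoch q (q / x) d)"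

lemma csqrt_power_int_Suc_square:
  assumes "q \<noteq> 0"
  shows "csqrt q powi ((d + 1) ^ 2) = csqrt q powi (d ^ 2) * (q powi d * csqrt q)"
proof -
  have "(d + 1) ^ 2 = d ^ 2 + 2 * d + 1" by (simp add: power2_eq_square algebra_simps)
  moreover have "csqrt q powi (2 * d) = q powi d" by (simp add: power_int_mult)
  ultimately show ?thesis using assms by (simp add: power_int_add)
qed

text \<open>Comes from \<open>phi_rec\<close> for the denominator \<open>qpoch\<close>.
  Cross-multiplied, it also covers \<open>x = 1\<close> and \<open>d = -1\<close>, where both sides
  vanish.\<close>

lemma curly_limit_rec:
  assumes "norm q < 1" "q \<noteq> 0" "x \<noteq> 0"
  shows "curly_limit q x (d + 1) * (x - q powi (d + 1)) = csqrt q * q powi d * curly_limit q x d"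
proof -
  let ?a = "q powi (d + 1) / x" and ?P = "phi q (q / x)"
  have "phi q (q powi d * (q / x)) = (1 - ?a) * phi q (q powi (d + 1) * (q / x))"
    using phi_rec[OF assms(1), of ?a] assms by (simp add: power_int_add_1 mult_ac)
  then have "(1 - ?a) * phi q (q powi (d + 1) * (q / x)) = phi q (q powi d * (q / x))" by simp
  then have "curly_limit q x (d + 1) * (1 - ?a)
      = csqrt q powi ((d + 1)^2) * phi q (q powi d * (q / x)) / (x powi (d + 1) * ?P)"
    by (simp add: curly_limit_def qpoch_def mult_ac)
  also have "\<dots> = csqrt q * q powi d * curly_limit q x d / x"
    using assms unfolding csqrt_power_int_Suc_square[OF assms(2)]
    by (simp add: curly_limit_def qpoch_def power_int_add_1 mult_ac)
  finally show ?thesis using assms(3) by (simp add: field_simps)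
qed

lemma curly_limit_nonzero:
  assumes "norm q < 1" "q \<noteq> 0" "x \<noteq> 0" "\<And>m. q powi m \<noteq> x"
  shows "curly_limit q x d \<noteq> 0"
proof -
  have "phi q (q powi m / x) \<noteq> 0" for m
  proof (rule phi_nonzero[OF assms(1)])
    show "q ^ i * (q powi m / x) \<noteq> 1" for i
      using assms(2,3) assms(4)[of "int i + m"] by (simp add: power_int_add field_simps)
  qed
  from this[of 1] this[of "d + 1"] show ?thesis
    using assms(2,3) by (simp add: curly_limit_def qpoch_def power_int_add_1)
qed

lemma phi_self_nonzero:
  assumes "norm q < 1"
  shows "phi q q \<noteq> 0"
proof (rule phi_nonzero[OF assms])
  fix i
  have "norm (q ^ i * q) < 1"
    using power_Suc_less_one[of "norm q" i] assms
    by (cases "q = 0") (auto simp: norm_mult norm_power mult_ac)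
  then show "q ^ i * q \<noteq> 1" by auto
qed

lemma curly_limit_1_0: "norm q < 1 \<Longrightarrow> curly_limit q 1 0 = 1"
  by (simp add: curly_limit_def qpoch_def phi_self_nonzero)

lemma curly_limit_1_neg:
  assumes "norm q < 1" "q \<noteq> 0" "d < 0"
  shows "curly_limit q 1 d = 0"
proof -
  obtain k where d: "d = - int (Suc k)" using assms(3) negD by blast
  have "q ^ k * (q powi d * q) = 1"
    using assms(2) unfolding d power_int_minus power_int_of_nat by (simp add: field_simps)
  then have "phi q (q powi d * q) = 0" by (rule phi_eq_0[OF assms(1)])
  then show ?thesis by (simp add: curly_limit_def qpoch_def)
qed

lemma curly_limit_0:
  assumes "norm q < 1" "q \<noteq> 0" "x \<noteq> 0" "x = 1 \<or> (\<forall>m. q powi m \<noteq> x)"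
  shows "curly_limit q x 0 = 1"
proof (cases "x = 1")
  case False
  then have "curly_limit q x 0 \<noteq> 0" using assms by (intro curly_limit_nonzero) auto
  then show ?thesis by (auto simp: curly_limit_def qpoch_def)
qed (use assms curly_limit_1_0 in auto)

lemma tendsto_affine_over_self:
  "((\<lambda>h. (1 - c * h) / h) \<longlongrightarrow> - c) (at_infinity :: complex filter)"
proof -
  have "((\<lambda>h. inverse h - c) \<longlongrightarrow> 0 - c) (at_infinity :: complex filter)"
    by (intro tendsto_intros tendsto_inverse_0)
  then have "((\<lambda>h. inverse h - c) \<longlongrightarrow> - c) (at_infinity :: complex filter)" by simp
  moreover have "\<forall>\<^sub>F h in at_infinity. inverse h - c = (1 - c * h) / (h::complex)"
    using eventually_not_equal_at_infinity[of 0] by eventually_elim (simp add: field_simps)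
  ultimately show ?thesis by (rule Lim_transform_eventually)
qed

text \<open>Each factor \<open>1 - q^i h / x\<close> of \<open>(h/x, q)_d\<close> grows like
  \<open>- q^i h / x\<close>. Together with the power of \<open>- csqrt q\<close> this gives
  \<open>csqrt q powi (d^2) / x powi d\<close> times \<open>h powi d\<close>, half of which is used
  up by the prefactor of \<open>curly\<close>. The set \<open>S\<close> avoids the zeros of the
  factors, so that the recursion in \<open>d\<close> is valid in both directions.\<close>

lemma curly_tendsto:
  assumes q: "norm q < 1" "q \<noteq> 0" and x: "x \<noteq> 0" and S: "\<And>h m. h \<in> S \<Longrightarrow> h \<noteq> q powi m * x"
  shows "((\<lambda>h. curly q h x d / csqrt h powi d) \<longlongrightarrow> curly_limit q x d)
    (inf at_infinity (principal S))"
proof -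
  let ?F = "inf at_infinity (principal S)"
  let ?E = "\<lambda>d h. qpoch q (h / x) d * (- csqrt q) powi d / h powi d"
  let ?r = "\<lambda>d h. (- csqrt q) * ((1 - q powi d / x * h) / h)"
  have F: "\<forall>\<^sub>F h in ?F. h \<in> S \<and> h \<noteq> 0"
    unfolding eventually_inf_principal
    using eventually_not_equal_at_infinity[of 0] by eventually_elim auto
  have ne: "q powi m * (h / x) \<noteq> 1" if "h \<in> S" for h m
    using S[OF that, of "- m"] q x by (auto simp: power_int_minus field_simps)
  have rec: "?E (d + 1) h = ?E d h * ?r d h" if "h \<in> S" "h \<noteq> 0" for h d
    using qpoch_rec[OF q ne[OF that(1), of d]] that(2) q
    by (simp add: power_int_add_1 mult_ac)
  have r: "(?r d \<longlongrightarrow> csqrt q * q powi d / x) ?F" for d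
  proof -
    have "(?r d \<longlongrightarrow> (- csqrt q) * (- (q powi d / x))) ?F"
      by (intro tendsto_mult tendsto_const tendsto_mono[OF _ tendsto_affine_over_self]) simp
    then show ?thesis by simp
  qed
  have lim: "(?E d \<longlongrightarrow> csqrt q powi (d ^ 2) / x powi d) ?F" for d
  proof (induction d rule: int_induct[where k = 0])
    case base
    have "\<forall>\<^sub>F h in ?F. 1 = ?E 0 h"
      using F
    proof eventually_elim
      case (elim h)
      have "phi q (h / x) \<noteq> 0"
        using ne[of h "int _"] elim by (intro phi_nonzero q) simp
      then show ?case by (simp add: qpoch_def)
    qed
    then have "(?E 0 \<longlongrightarrow> 1) ?F" by (rule Lim_transform_eventually[OF tendsto_const])
    then show ?case by simp
  next
    case (step1 i)
    have "((\<lambda>h. ?E i h * ?r i h) \<longlongrightarrow> csqrt q powi (i ^ 2) / x powi i * (csqrt q * q powi i / x)) ?F"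
      by (intro tendsto_mult step1 r)
    moreover have "\<forall>\<^sub>F h in ?F. ?E i h * ?r i h = ?E (i + 1) h"
      using F by eventually_elim (use rec in simp)
    ultimately have "(?E (i + 1) \<longlongrightarrow> csqrt q powi (i ^ 2) / x powi i * (csqrt q * q powi i / x)) ?F"
      by (rule Lim_transform_eventually)
    then show ?case
      using x unfolding csqrt_power_int_Suc_square[OF q(2)] by (simp add: power_int_add_1 mult_ac)
  next
    case (step2 i)
    let ?j = "i - 1"
    have "((\<lambda>h. ?E i h / ?r ?j h) \<longlongrightarrow> csqrt q powi (i ^ 2) / x powi i / (csqrt q * q powi ?j / x)) ?F"
      using q x by (intro tendsto_divide step2 r) auto
    moreover have "\<forall>\<^sub>F h in ?F. ?E i h / ?r ?j h = ?E ?j h"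
      using F
    proof eventually_elim
      case (elim h)
      have "?r ?j h \<noteq> 0" using ne[of h ?j] elim q by simp
      then show ?case using rec[of h ?j] elim by simp
    qed
    ultimately have "(?E ?j \<longlongrightarrow> csqrt q powi (i ^ 2) / x powi i / (csqrt q * q powi ?j / x)) ?F"
      by (rule Lim_transform_eventually)
    moreover have "csqrt q powi (i ^ 2) / x powi i / (csqrt q * q powi ?j / x)
        = csqrt q powi (?j ^ 2) / x powi ?j"
      using q x csqrt_power_int_Suc_square[OF q(2), of ?j]
      by (simp add: power_int_diff field_simps)
    ultimately show ?case by simp
  qed
  have "((\<lambda>h. ?E d h / qpoch q (q / x) d)
      \<longlongrightarrow> csqrt q powi (d ^ 2) / x powi d / qpoch q (q / x) d) ?F"
    unfolding divide_inverse[of _ "qpoch q (q / x) d"] by (intro tendsto_mult lim tendsto_const)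
  moreover have "\<forall>\<^sub>F h in ?F. ?E d h / qpoch q (q / x) d = curly q h x d / csqrt h powi d"
    using F
  proof eventually_elim
    case (elim h)
    have "h powi d = csqrt h powi d * csqrt h powi d"
      by (metis power2_csqrt power2_eq_square power_int_mult_distrib)
    moreover have "(- (csqrt q / csqrt h)) powi d = (- csqrt q) powi d / csqrt h powi d"
      by (metis minus_divide_left power_int_divide_distrib)
    ultimately show ?case by (simp add: curly_def mult_ac)
  qed
  ultimately have "((\<lambda>h. curly q h x d / csqrt h powi d)
      \<longlongrightarrow> csqrt q powi (d ^ 2) / x powi d / qpoch q (q / x) d) ?F"
    by (rule Lim_transform_eventually)
  then show ?thesis by (simp add: curly_limit_def)
qed

section \<open>Quotients of vertices as q tends to one\<close>

type_synonym symbol = "complex \<Rightarrow> (nat \<Rightarrow>\<^sub>0 nat) \<Rightarrow> complex"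

text \<open>
  A symbol \<open>g\<close> acts on \<open>V q\<close> by multiplying the coefficient of each monomial \<open>m\<close> by \<open>g q m\<close>;
  \<open>conj_op\<close> is the conjugate of this action by \<open>V q\<close>. Applied to \<open>1\<close> it gives the quotient of
  a vertex with insertion by \<open>V q\<close>. The symbol \<open>shift p\<close> is \<open>x p\<close> times the \<open>q\<close>-shift of the
  variable \<open>p\<close>; since \<open>q\<close>-shifts tend to the identity as \<open>q\<close> tends to \<open>1\<close>, its conjugate
  tends to a multiplication operator as soon as \<open>ratio p\<close> converges.
\<close>

locale vertex_asymptotics =
  fixes F :: "complex filter" and V :: "complex \<Rightarrow> complex mfps" and x :: "nat \<Rightarrow> complex"
  assumes F_to_1: "((\<lambda>q. q) \<longlongrightarrow> 1) F" and F_nontrivial: "F \<noteq> bot"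
    and V_0: "\<And>q. mfps_nth (V q) 0 = 1"
begin

definition conj_op :: "complex \<Rightarrow> ((nat \<Rightarrow>\<^sub>0 nat) \<Rightarrow> complex) \<Rightarrow> complex mfps \<Rightarrow> complex mfps" where
  "conj_op q g G = mfps_inv (V q) * scale_coeffs g (V q * G)"

definition shift :: "nat \<Rightarrow> symbol" where
  "shift p q m = x p * inverse q ^ Poly_Mapping.lookup m p"

definition ratio :: "nat \<Rightarrow> complex \<Rightarrow> complex mfps" where
  "ratio p q = conj_op q (\<lambda>m. inverse q ^ Poly_Mapping.lookup m p) 1"

text \<open>Only the existence of limits is tracked, since the recursion gives no closed form for
  them.\<close>

definition convg :: "(complex \<Rightarrow> complex) \<Rightarrow> bool" where
  "convg f \<longleftrightarrow> (\<exists>l. (f \<longlongrightarrow> l) F)"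

lemma convgI: "(f \<longlongrightarrow> l) F \<Longrightarrow> convg f"
  by (auto simp: convg_def)

lemma convg_const: "convg (\<lambda>_. c)"
  by (rule convgI) (rule tendsto_const)

lemma convg_add: "convg f \<Longrightarrow> convg g \<Longrightarrow> convg (\<lambda>q. f q + g q)"
  by (auto simp: convg_def intro: tendsto_add)

lemma convg_diff: "convg f \<Longrightarrow> convg g \<Longrightarrow> convg (\<lambda>q. f q - g q)"
  by (auto simp: convg_def intro: tendsto_diff)

lemma convg_mult: "convg f \<Longrightarrow> convg g \<Longrightarrow> convg (\<lambda>q. f q * g q)"
  by (auto simp: convg_def intro: tendsto_mult)

lemma convg_sum: "(\<And>i. i \<in> A \<Longrightarrow> convg (f i)) \<Longrightarrow> convg (\<lambda>q. \<Sum>i\<in>A. f i q)"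
  by (induction A rule: infinite_finite_induct) (auto intro: convg_add convg_const)

lemma convg_cong: "convg f \<Longrightarrow> \<forall>\<^sub>F q in F. f q = g q \<Longrightarrow> convg g"
  unfolding convg_def using Lim_transform_eventually by blast

lemma convg_inverse_power: "convg (\<lambda>q. inverse q ^ k)"
  by (rule convgI, rule tendsto_power, rule tendsto_inverse, rule F_to_1) simp

lemma V_inv: "V q * mfps_inv (V q) = 1" "mfps_inv (V q) * V q = 1"
  by (simp_all add: mfps_inv_right V_0 mult.commute)

lemma conj_op_comp: "conj_op q (\<lambda>m. g m * h m) G = conj_op q g (conj_op q h G)"
proof -
  have "V q * conj_op q h G = scale_coeffs h (V q * G)"
    by (simp add: conj_op_def mult.assoc[symmetric] V_inv)
  moreover have "scale_coeffs (\<lambda>m. g m * h m) G = scale_coeffs g (scale_coeffs h G)" for G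
    by (rule mfps_eqI) (simp add: mult.assoc)
  ultimately show ?thesis
    unfolding conj_op_def[of q "\<lambda>m. g m * h m"] conj_op_def[of q g] by simp
qed

lemma conj_op_add: "conj_op q (\<lambda>m. g m + h m) G = conj_op q g G + conj_op q h G"
proof -
  have "scale_coeffs (\<lambda>m. g m + h m) G = scale_coeffs g G + scale_coeffs h G" for G
    by (rule mfps_eqI) (simp add: algebra_simps)
  then show ?thesis by (simp add: conj_op_def algebra_simps)
qed

lemma conj_op_diff: "conj_op q (\<lambda>m. g m - h m) G = conj_op q g G - conj_op q h G"
proof -
  have "scale_coeffs (\<lambda>m. g m - h m) G = scale_coeffs g G - scale_coeffs h G" for G
    by (rule mfps_eqI) (simp add: algebra_simps)
  then show ?thesis unfolding conj_op_def by (simp add: right_diff_distrib)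
qed

lemma conj_op_const: "conj_op q (\<lambda>m. c) G = mfps_const c * G"
proof -
  have "scale_coeffs (\<lambda>m. c) G = mfps_const c * G" for G
    by (rule mfps_eqI) simp
  then have "conj_op q (\<lambda>m. c) G = (mfps_inv (V q) * V q) * (mfps_const c * G)"
    by (simp add: conj_op_def mult_ac)
  then show ?thesis by (simp add: V_inv)
qed

text \<open>A multiplicative symbol rescales the variables, which is a ring homomorphism;
  conjugation by \<open>V q\<close> therefore only adds a factor.\<close>

lemma conj_op_character:
  assumes "\<And>b c. g (b + c) = g b * g c"
  shows "conj_op q g G = conj_op q g 1 * scale_coeffs g G"
  by (simp add: conj_op_def scale_coeffs_mult[OF assms] mult_ac)

lemma mfps_nth_0_conj_op: "mfps_nth (conj_op q g G) 0 = g 0 * mfps_nth G 0"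
  by (simp add: conj_op_def mfps_nth_0_mult mfps_nth_0_inv V_0)

lemma conj_op_shift:
  "conj_op q (shift p q) G =
    mfps_const (x p) * (ratio p q * scale_coeffs (\<lambda>m. inverse q ^ Poly_Mapping.lookup m p) G)"
  unfolding ratio_def shift_def conj_op_comp[of q "\<lambda>_. x p"] conj_op_const
  by (subst conj_op_character) (simp_all add: lookup_add power_add)

lemma conj_op_shift_1: "conj_op q (shift p q) 1 = mfps_const (x p) * ratio p q"
  unfolding ratio_def shift_def conj_op_comp[of q "\<lambda>_. x p"] conj_op_const ..

lemma mfps_nth_0_ratio: "mfps_nth (ratio p q) 0 = 1"
  by (simp add: ratio_def mfps_nth_0_conj_op mfps_nth_one)

text \<open>
  Degree \<open>N\<close> is considered only for series without constant term: then the coefficients of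
  degree \<open>N\<close> of the ratios, not yet known to converge, do not enter.
\<close>

definition tame :: "nat \<Rightarrow> symbol \<Rightarrow> complex \<Rightarrow> bool" where
  "tame N g l \<longleftrightarrow> (\<forall>m. ((\<lambda>q. g q m) \<longlongrightarrow> l) F) \<and>
    (\<forall>G. (\<forall>b. mdeg b < N \<longrightarrow> convg (\<lambda>q. mfps_nth (G q) b)) \<longrightarrow>
       (\<forall>b. mdeg b < N \<longrightarrow> convg (\<lambda>q. mfps_nth (conj_op q (g q) (G q)) b)) \<and>
       ((\<forall>q. mfps_nth (G q) 0 = 0) \<longrightarrow>
        (\<forall>m. mdeg m = N \<longrightarrow>
          convg (\<lambda>q. mfps_nth (conj_op q (g q) (G q)) m - g q m * mfps_nth (G q) m))))"

lemma tameI: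
  assumes "\<And>m. ((\<lambda>q. g q m) \<longlongrightarrow> l) F"
    and "\<And>G b. (\<And>b. mdeg b < N \<Longrightarrow> convg (\<lambda>q. mfps_nth (G q) b)) \<Longrightarrow> mdeg b < N \<Longrightarrow>
      convg (\<lambda>q. mfps_nth (conj_op q (g q) (G q)) b)"
    and "\<And>G m. (\<And>b. mdeg b < N \<Longrightarrow> convg (\<lambda>q. mfps_nth (G q) b)) \<Longrightarrow>
      (\<And>q. mfps_nth (G q) 0 = 0) \<Longrightarrow> mdeg m = N \<Longrightarrow>
      convg (\<lambda>q. mfps_nth (conj_op q (g q) (G q)) m - g q m * mfps_nth (G q) m)"
  shows "tame N g l"
  using assms unfolding tame_def by blast

lemma tame_lim: "tame N g l \<Longrightarrow> ((\<lambda>q. g q m) \<longlongrightarrow> l) F"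
  by (simp add: tame_def)

lemma tame_low:
  assumes "tame N g l" "\<And>b. mdeg b < N \<Longrightarrow> convg (\<lambda>q. mfps_nth (G q) b)" "mdeg b < N"
  shows "convg (\<lambda>q. mfps_nth (conj_op q (g q) (G q)) b)"
  using assms unfolding tame_def by blast

lemma tame_top:
  assumes "tame N g l" "\<And>b. mdeg b < N \<Longrightarrow> convg (\<lambda>q. mfps_nth (G q) b)"
    "\<And>q. mfps_nth (G q) 0 = 0" "mdeg m = N"
  shows "convg (\<lambda>q. mfps_nth (conj_op q (g q) (G q)) m - g q m * mfps_nth (G q) m)"
  using assms unfolding tame_def by blast

lemma tame_const:
  assumes "(c \<longlongrightarrow> l) F"
  shows "tame N (\<lambda>q m. c q) l"
  by (rule tameI) (use assms in \<open>auto simp: conj_op_const intro: convg_mult convgI convg_const\<close>)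

text \<open>The error in degree \<open>N\<close> telescopes: it is the error of \<open>g\<close> on
  the series \<open>conj_op q (h q) (G q)\<close>, which again has no constant term, plus
  \<open>g q m\<close> times the error of \<open>h\<close> on \<open>G q\<close>.\<close>

lemma tame_mult:
  assumes g: "tame N g l" and h: "tame N h l'"
  shows "tame N (\<lambda>q m. g q m * h q m) (l * l')"
proof (rule tameI)
  show "((\<lambda>q. g q m * h q m) \<longlongrightarrow> l * l') F" for m
    using g h by (intro tendsto_mult tame_lim)
next
  fix G b
  assume "\<And>b. mdeg b < N \<Longrightarrow> convg (\<lambda>q. mfps_nth (G q) b)" "mdeg b < N"
  then show "convg (\<lambda>q. mfps_nth (conj_op q (\<lambda>m. g q m * h q m) (G q)) b)"
    unfolding conj_op_comp using g h by (intro tame_low[of N g l] tame_low[of N h l']) auto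
next
  fix G m
  assume G: "\<And>b. mdeg b < N \<Longrightarrow> convg (\<lambda>q. mfps_nth (G q) b)"
    "\<And>q. mfps_nth (G q) 0 = 0" "mdeg m = N"
  let ?H = "\<lambda>q. conj_op q (h q) (G q)"
  have "convg (\<lambda>q. mfps_nth (conj_op q (g q) (?H q)) m - g q m * mfps_nth (?H q) m)"
    by (rule tame_top[OF g]) (use G in \<open>auto simp: mfps_nth_0_conj_op intro: tame_low[OF h]\<close>)
  moreover have "convg (\<lambda>q. mfps_nth (?H q) m - h q m * mfps_nth (G q) m)"
    by (rule tame_top[OF h]) (use G in auto)
  then have "convg (\<lambda>q. g q m * (mfps_nth (?H q) m - h q m * mfps_nth (G q) m))"
    by (intro convg_mult) (rule convgI, rule tame_lim[OF g])
  ultimately have "convg (\<lambda>q. (mfps_nth (conj_op q (g q) (?H q)) m - g q m * mfps_nth (?H q) m) +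
      g q m * (mfps_nth (?H q) m - h q m * mfps_nth (G q) m))"
    by (rule convg_add)
  then show "convg (\<lambda>q. mfps_nth (conj_op q (\<lambda>m. g q m * h q m) (G q)) m
      - g q m * h q m * mfps_nth (G q) m)"
    unfolding conj_op_comp by (simp add: algebra_simps)
qed

lemma tame_diff:
  assumes g: "tame N g l" and h: "tame N h l'"
  shows "tame N (\<lambda>q m. g q m - h q m) (l - l')"
proof (rule tameI)
  show "((\<lambda>q. g q m - h q m) \<longlongrightarrow> l - l') F" for m
    using g h by (intro tendsto_diff tame_lim)
next
  fix G b
  assume "\<And>b. mdeg b < N \<Longrightarrow> convg (\<lambda>q. mfps_nth (G q) b)" "mdeg b < N"
  then show "convg (\<lambda>q. mfps_nth (conj_op q (\<lambda>m. g q m - h q m) (G q)) b)"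
    unfolding conj_op_diff mfps_nth_simps using g h
    by (intro convg_diff tame_low[of N g l] tame_low[of N h l']) auto
next
  fix G m
  assume G: "\<And>b. mdeg b < N \<Longrightarrow> convg (\<lambda>q. mfps_nth (G q) b)"
    "\<And>q. mfps_nth (G q) 0 = 0" "mdeg m = N"
  have "convg (\<lambda>q. (mfps_nth (conj_op q (g q) (G q)) m - g q m * mfps_nth (G q) m) -
      (mfps_nth (conj_op q (h q) (G q)) m - h q m * mfps_nth (G q) m))"
    by (intro convg_diff tame_top[OF g] tame_top[OF h]) (use G in auto)
  then show "convg (\<lambda>q. mfps_nth (conj_op q (\<lambda>m. g q m - h q m) (G q)) m
      - (g q m - h q m) * mfps_nth (G q) m)"
    unfolding conj_op_diff by (simp add: algebra_simps)
qed

lemma tame_prod: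
  "(\<And>i. i \<in> A \<Longrightarrow> tame N (g i) (l i)) \<Longrightarrow>
    tame N (\<lambda>q m. \<Prod>i\<in>A. g i q m) (\<Prod>i\<in>A. l i)"
proof (induction A rule: infinite_finite_induct)
  case (insert a A)
  then have "tame N (\<lambda>q m. g a q m * (\<Prod>i\<in>A. g i q m)) (l a * (\<Prod>i\<in>A. l i))"
    by (intro tame_mult) auto
  then show ?case using insert.hyps by simp
qed (simp_all add: tame_const)

text \<open>In the product with \<open>ratio p q\<close>, degree \<open>N\<close> of the ratio meets
  only the constant term of \<open>G q\<close>, which is \<open>0\<close>. Degree \<open>N\<close>
  of \<open>G q\<close> meets only the constant term \<open>1\<close> of the ratio, and this is the
  part subtracted in \<open>tame\<close>.\<close>

lemma tame_shift:
  assumes r: "\<And>b. mdeg b < N \<Longrightarrow> convg (\<lambda>q. mfps_nth (ratio p q) b)"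
  shows "tame N (shift p) (x p)"
proof (rule tameI)
  fix m
  have "((\<lambda>q. x p * inverse q ^ Poly_Mapping.lookup m p) \<longlongrightarrow> x p * inverse 1 ^ Poly_Mapping.lookup m p) F"
    by (intro tendsto_intros F_to_1) simp
  then show "((\<lambda>q. shift p q m) \<longlongrightarrow> x p) F" by (simp add: shift_def)
next
  fix G b
  assume G: "\<And>b. mdeg b < N \<Longrightarrow> convg (\<lambda>q. mfps_nth (G q) b)" and b: "mdeg b < N"
  show "convg (\<lambda>q. mfps_nth (conj_op q (shift p q) (G q)) b)"
    unfolding conj_op_shift mfps_nth_const_mult mfps_nth_mult case_prod_beta mfps_nth_scale_coeffs
    by (intro convg_mult convg_const convg_sum r G convg_inverse_power)
      (use b in \<open>auto simp: splits_def mdeg_add\<close>)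
next
  fix G m
  assume G: "\<And>b. mdeg b < N \<Longrightarrow> convg (\<lambda>q. mfps_nth (G q) b)" "\<And>q. mfps_nth (G q) 0 = 0"
    and m: "mdeg m = N"
  let ?t = "\<lambda>q bc. mfps_nth (ratio p q) (fst bc) *
    (inverse q ^ Poly_Mapping.lookup (snd bc) p * mfps_nth (G q) (snd bc))"
  have "mfps_nth (conj_op q (shift p q) (G q)) m =
      shift p q m * mfps_nth (G q) m + x p * (\<Sum>bc\<in>splits m - {(0, m)}. ?t q bc)" for q
  proof -
    have "(0, m) \<in> splits m" by (simp add: splits_def)
    then have "(\<Sum>bc\<in>splits m. ?t q bc) = ?t q (0, m) + (\<Sum>bc\<in>splits m - {(0, m)}. ?t q bc)"
      by (rule sum.remove[OF finite_splits])
    then show ?thesis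
      unfolding conj_op_shift mfps_nth_const_mult mfps_nth_mult[of "ratio p q"] case_prod_beta
        mfps_nth_scale_coeffs
      by (simp add: mfps_nth_0_ratio shift_def algebra_simps)
  qed
  moreover have "convg (\<lambda>q. x p * (\<Sum>bc\<in>splits m - {(0, m)}. ?t q bc))"
  proof (rule convg_mult[OF convg_const convg_sum])
    fix bc assume "bc \<in> splits m - {(0, m)}"
    then obtain b c where bc: "bc = (b, c)" "b + c = m" "b \<noteq> 0" unfolding splits_def by fastforce
    show "convg (\<lambda>q. ?t q bc)"
    proof (cases "c = 0")
      case True
      then show ?thesis using bc G(2) by (simp add: convg_const)
    next
      case False
      then have "mdeg b < N" "mdeg c < N"
        using bc m mdeg_add[of b c] by (simp_all flip: mdeg_eq_0_iff)
      then show ?thesis using bc by (auto intro!: convg_mult convg_inverse_power r G)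
    qed
  qed
  ultimately show "convg (\<lambda>q. mfps_nth (conj_op q (shift p q) (G q)) m
      - shift p q m * mfps_nth (G q) m)"
    by simp
qed

text \<open>
  The hypothesis on \<open>p\<close> is a \<open>q\<close>-difference equation for \<open>V q\<close> whose leading term is
  \<open>(shift p - shift J) K\<close>. As \<open>K\<close> does not vanish in the limit, it determines the coefficients
  of \<open>ratio p\<close> from those of \<open>ratio J\<close> and from those of lower degree.
\<close>

lemma ratio_coeffs_converge:
  fixes P :: "nat set" and lev :: "nat \<Rightarrow> nat"
  defines "H \<equiv> \<lambda>N. \<forall>p\<in>P. \<forall>b. mdeg b < N \<longrightarrow> convg (\<lambda>q. mfps_nth (ratio p q) b)"
  assumes nz: "\<And>p. p \<in> P \<Longrightarrow> x p \<noteq> 0"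
    and step: "\<And>p. p \<in> P \<Longrightarrow> (\<forall>q. ratio p q = 1) \<or>
      (\<exists>J K B \<kappa> \<beta>. J \<in> P \<and> lev J < lev p \<and> x J = x p \<and> \<kappa> \<noteq> 0 \<and>
        (\<forall>N. H N \<longrightarrow> tame N K \<kappa> \<and> tame N B \<beta>) \<and>
        (\<forall>\<^sub>F q in F. conj_op q (\<lambda>m. K q m * (shift p q m - shift J q m)) 1 =
          mfps_var p * conj_op q (B q) 1))"
  shows "H N"
proof (induction N)
  case 0
  then show ?case by (simp add: H_def)
next
  case (Suc N)
  have "convg (\<lambda>q. mfps_nth (ratio p q) m)" if "p \<in> P" "mdeg m = N" for p m
    using that(1)
  \<comment> \<open>Within one degree the recursion runs over \<open>lev\<close>, because the
    equation yields only the difference of \<open>ratio p\<close> and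
    \<open>ratio J\<close>.\<close>
  proof (induction "lev p" arbitrary: p rule: less_induct)
    case less
    from step[OF less.prems] show ?case
    proof (elim disjE exE conjE)
      assume "\<forall>q. ratio p q = 1"
      then show ?thesis by (simp add: convg_const)
    next
      fix J K B \<kappa> \<beta>
      assume J: "J \<in> P" "lev J < lev p" "x J = x p" and \<kappa>: "\<kappa> \<noteq> 0"
        and "\<forall>N. H N \<longrightarrow> tame N K \<kappa> \<and> tame N B \<beta>"
        and eq: "\<forall>\<^sub>F q in F. conj_op q (\<lambda>m. K q m * (shift p q m - shift J q m)) 1 =
          mfps_var p * conj_op q (B q) 1"
      with Suc have K: "tame N K \<kappa>" and B: "tame N B \<beta>" by auto
      define \<delta> where "\<delta> q = conj_op q (\<lambda>m. shift p q m - shift J q m) 1" for q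
      \<comment> \<open>Thanks to \<open>x J = x p\<close> the constant terms cancel, as
        \<open>tame_top\<close> demands.\<close>
      have \<delta>: "\<delta> q = mfps_const (x p) * (ratio p q - ratio J q)" for q
        unfolding \<delta>_def conj_op_diff conj_op_shift_1 J(3) by (simp add: algebra_simps)
      have low: "convg (\<lambda>q. mfps_nth (ratio p q) b)" if "p \<in> P" "mdeg b < N" for p b
        using Suc that by (simp add: H_def)
      have "convg (\<lambda>q. mfps_nth (conj_op q (K q) (\<delta> q)) m - K q m * mfps_nth (\<delta> q) m)"
      proof (rule tame_top[OF K])
        show "convg (\<lambda>q. mfps_nth (\<delta> q) b)" if "mdeg b < N" for b
          unfolding \<delta> mfps_nth_const_mult mfps_nth_simps
          using low that J(1) less.prems by (intro convg_mult convg_diff convg_const)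
        show "mfps_nth (\<delta> q) 0 = 0" for q
          unfolding \<delta> by (simp add: mfps_nth_0_ratio)
        show "mdeg m = N" by fact
      qed
      \<comment> \<open>The factor \<open>mfps_var p\<close> reduces degree \<open>N\<close> to
        degree \<open>N - 1\<close>, where convergence is already known.\<close>
      moreover have "convg (\<lambda>q. mfps_nth (mfps_var p * conj_op q (B q) 1) m)"
      proof (cases "Poly_Mapping.lookup m p = 0")
        case False
        let ?e = "Poly_Mapping.single p (1::nat)"
        have "m = ?e + (m - ?e)"
          using False by (intro poly_mapping_eqI) (auto simp: lookup_add lookup_minus lookup_single when_def)
        then have "mdeg m = 1 + mdeg (m - ?e)" by (metis mdeg_add mdeg_single)
        then have "mdeg (m - ?e) < N" using \<open>mdeg m = N\<close> by simp
        then have "convg (\<lambda>q. mfps_nth (conj_op q (B q) 1) (m - ?e))"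
          by (intro tame_low[OF B]) (auto simp: convg_const)
        then show ?thesis unfolding mfps_nth_var_mult using False by simp
      qed (simp add: mfps_nth_var_mult convg_const)
      ultimately have "convg (\<lambda>q. mfps_nth (mfps_var p * conj_op q (B q) 1) m -
          (mfps_nth (conj_op q (K q) (\<delta> q)) m - K q m * mfps_nth (\<delta> q) m))"
        by (rule convg_diff[rotated])
      then have "convg (\<lambda>q. K q m * mfps_nth (\<delta> q) m)"
        by (rule convg_cong) (use eq in eventually_elim, simp add: conj_op_comp \<delta>_def)
      moreover have "((\<lambda>q. inverse (K q m)) \<longlongrightarrow> inverse \<kappa>) F"
        using tame_lim[OF K] \<kappa> by (rule tendsto_inverse)
      ultimately have "convg (\<lambda>q. inverse (K q m) * (K q m * mfps_nth (\<delta> q) m))"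
        by (rule convg_mult[rotated, OF _ convgI])
      moreover have "\<forall>\<^sub>F q in F. K q m \<noteq> 0"
        using tame_lim[OF K] \<kappa> by (rule tendsto_imp_eventually_ne)
      ultimately have "convg (\<lambda>q. mfps_nth (\<delta> q) m)"
        by (rule convg_cong[OF _ eventually_mono]) simp
      then have "convg (\<lambda>q. inverse (x p) * mfps_nth (\<delta> q) m + mfps_nth (ratio J q) m)"
        using less.hyps[OF J(2,1)] by (intro convg_add convg_mult convg_const)
      then show ?thesis using nz[OF less.prems] by (simp add: \<delta> flip: mult.assoc)
    qed
  qed
  then show ?case using Suc by (auto simp: H_def less_Suc_eq)
qed

lemma ratio_limit_exists:
  assumes "\<And>b. convg (\<lambda>q. mfps_nth (ratio p q) b)"
  shows "\<exists>R. mfps_tendsto (ratio p) R F"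
proof -
  from assms obtain l where "((\<lambda>q. mfps_nth (ratio p q) b) \<longlongrightarrow> l b) F" for b
    unfolding convg_def by metis
  then have "mfps_tendsto (ratio p) (Abs_mfps l) F" by (simp add: mfps_tendsto_def)
  then show ?thesis ..
qed

text \<open>Testing on all convergent inputs, and not on \<open>1\<close> alone, makes the notion
  stable under composition of symbols.\<close>

definition multiplies :: "symbol \<Rightarrow> complex mfps \<Rightarrow> bool" where
  "multiplies g S \<longleftrightarrow> (\<forall>G L. mfps_tendsto G L F \<longrightarrow>
    mfps_tendsto (\<lambda>q. conj_op q (g q) (G q)) (S * L) F)"

lemma multipliesD:
  "multiplies g S \<Longrightarrow> mfps_tendsto G L F \<Longrightarrow> mfps_tendsto (\<lambda>q. conj_op q (g q) (G q)) (S * L) F"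
  by (simp add: multiplies_def)

lemma multiplies_const:
  assumes "(c \<longlongrightarrow> l) F"
  shows "multiplies (\<lambda>q m. c q) (mfps_const l)"
  unfolding multiplies_def conj_op_const
  by (intro allI impI mfps_tendsto_mult mfps_tendsto_const_coeff assms)

lemma multiplies_mult:
  assumes "multiplies g S" "multiplies h T"
  shows "multiplies (\<lambda>q m. g q m * h q m) (S * T)"
  unfolding multiplies_def conj_op_comp mult.assoc
  by (intro allI impI multipliesD[OF assms(1)] multipliesD[OF assms(2)])

lemma multiplies_add:
  assumes "multiplies g S" "multiplies h T"
  shows "multiplies (\<lambda>q m. g q m + h q m) (S + T)"
  unfolding multiplies_def conj_op_add distrib_right
  by (intro allI impI mfps_tendsto_add multipliesD[OF assms(1)] multipliesD[OF assms(2)])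

lemma multiplies_diff:
  assumes "multiplies g S" "multiplies h T"
  shows "multiplies (\<lambda>q m. g q m - h q m) (S - T)"
  unfolding multiplies_def conj_op_diff left_diff_distrib
  by (intro allI impI mfps_tendsto_diff multipliesD[OF assms(1)] multipliesD[OF assms(2)])

lemma multiplies_1: "multiplies (\<lambda>q m. 1) 1"
  using multiplies_const[OF tendsto_const, of 1] by simp

lemma multiplies_prod:
  "(\<And>i. i \<in> A \<Longrightarrow> multiplies (g i) (S i)) \<Longrightarrow>
    multiplies (\<lambda>q m. \<Prod>i\<in>A. g i q m) (\<Prod>i\<in>A. S i)"
proof (induction A rule: infinite_finite_induct)
  case (insert a A)
  then have "multiplies (\<lambda>q m. g a q m * (\<Prod>i\<in>A. g i q m)) (S a * (\<Prod>i\<in>A. S i))"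
    by (intro multiplies_mult) auto
  then show ?case using insert.hyps by simp
qed (simp_all add: multiplies_1)

lemma multiplies_sum:
  "(\<And>i. i \<in> A \<Longrightarrow> multiplies (g i) (S i)) \<Longrightarrow>
    multiplies (\<lambda>q m. \<Sum>i\<in>A. g i q m) (\<Sum>i\<in>A. S i)"
proof -
  have "mfps_const 0 = (0 :: complex mfps)" by (rule mfps_eqI) (simp add: mfps_nth_const)
  then have 0: "multiplies (\<lambda>q m. 0) 0" using multiplies_const[OF tendsto_const, of 0] by simp
  show "(\<And>i. i \<in> A \<Longrightarrow> multiplies (g i) (S i)) \<Longrightarrow> ?thesis"
  proof (induction A rule: infinite_finite_induct)
    case (insert a A)
    then have "multiplies (\<lambda>q m. g a q m + (\<Sum>i\<in>A. g i q m)) (S a + (\<Sum>i\<in>A. S i))"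
      by (intro multiplies_add) auto
    then show ?case using insert.hyps by simp
  qed (simp_all add: 0)
qed

lemma multiplies_power:
  assumes "multiplies g S"
  shows "multiplies (\<lambda>q m. g q m ^ k) (S ^ k)"
  by (induction k) (auto intro: multiplies_1 multiplies_mult assms)

lemma multiplies_tendsto:
  "multiplies g S \<Longrightarrow> mfps_tendsto (\<lambda>q. conj_op q (g q) 1) S F"
  using multipliesD[OF _ mfps_tendsto_const[of 1 F]] by simp

lemma multiplies_shift:
  assumes "mfps_tendsto (ratio p) R F"
  shows "multiplies (shift p) (mfps_const (x p) * R)"
  unfolding multiplies_def
proof (intro allI impI)
  fix G :: "complex \<Rightarrow> complex mfps" and L assume G: "mfps_tendsto G L F"
  have "((\<lambda>q. inverse q ^ Poly_Mapping.lookup m p * mfps_nth (G q) m)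
      \<longlongrightarrow> inverse 1 ^ Poly_Mapping.lookup m p * mfps_nth L m) F" for m
    using G by (intro tendsto_intros F_to_1) (auto simp: mfps_tendsto_def)
  then have "mfps_tendsto (\<lambda>q. scale_coeffs (\<lambda>m. inverse q ^ Poly_Mapping.lookup m p) (G q)) L F"
    by (simp add: mfps_tendsto_def)
  then show "mfps_tendsto (\<lambda>q. conj_op q (shift p q) (G q)) (mfps_const (x p) * R * L) F"
    unfolding conj_op_shift mult.assoc by (intro mfps_tendsto_mult mfps_tendsto_const assms)
qed

lemma ratio_limit_0:
  assumes "mfps_tendsto (ratio p) R F"
  shows "mfps_nth R 0 = 1"
proof -
  have "((\<lambda>q. 1) \<longlongrightarrow> mfps_nth R 0) F"
    using assms[unfolded mfps_tendsto_def, rule_format, of 0] by (simp add: mfps_nth_0_ratio)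
  then show ?thesis using F_nontrivial tendsto_const tendsto_unique by blast
qed

text \<open>The value at \<open>1\<close> of the conjugated inverse rescaling is the inverse of
  \<open>ratio p q\<close> after rescaling its variable back, and rescalings tend to the
  identity.\<close>

lemma multiplies_inverse_shift:
  assumes "mfps_tendsto (ratio p) R F"
  shows "multiplies (\<lambda>q m. inverse (shift p q m)) (mfps_const (inverse (x p)) * mfps_inv R)"
  unfolding multiplies_def
proof (intro allI impI)
  fix G :: "complex \<Rightarrow> complex mfps" and L assume G: "mfps_tendsto G L F"
  let ?T = "\<lambda>q. scale_coeffs (\<lambda>m. q ^ Poly_Mapping.lookup m p) :: complex mfps \<Rightarrow> complex mfps"
  let ?c = "\<lambda>q m. q ^ Poly_Mapping.lookup m p"
  have T: "mfps_tendsto (\<lambda>q. ?T q (G q)) L F"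
    if "mfps_tendsto G L F" for G :: "complex \<Rightarrow> complex mfps" and L
  proof -
    have "((\<lambda>q. q ^ Poly_Mapping.lookup m p * mfps_nth (G q) m)
        \<longlongrightarrow> 1 ^ Poly_Mapping.lookup m p * mfps_nth L m) F" for m
      using that by (intro tendsto_intros F_to_1) (auto simp: mfps_tendsto_def)
    then show ?thesis by (simp add: mfps_tendsto_def)
  qed
  have char: "conj_op q (?c q) G = conj_op q (?c q) 1 * ?T q G" for q G
    by (rule conj_op_character) (simp add: lookup_add power_add)
  have "mfps_tendsto (\<lambda>q. mfps_const (inverse (x p)) * (mfps_inv (?T q (ratio p q)) * ?T q (G q)))
      (mfps_const (inverse (x p)) * (mfps_inv R * L)) F"
    by (intro mfps_tendsto_mult mfps_tendsto_const mfps_tendsto_inv T assms G)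
  moreover have "\<forall>\<^sub>F q in F. mfps_const (inverse (x p)) * (mfps_inv (?T q (ratio p q)) * ?T q (G q)) =
      conj_op q (\<lambda>m. inverse (shift p q m)) (G q)"
  proof -
    have "\<forall>\<^sub>F q in F. q \<noteq> 0" using F_to_1 by (rule tendsto_imp_eventually_ne) simp
    then show ?thesis
    proof eventually_elim
      case (elim q)
      have "conj_op q (?c q) (ratio p q) = 1"
        using elim unfolding ratio_def conj_op_comp[symmetric]
        by (simp add: conj_op_const flip: power_mult_distrib)
      then have "?T q (ratio p q) * conj_op q (?c q) 1 = 1"
        by (simp add: char[of q "ratio p q"] mult.commute)
      then have "mfps_inv (?T q (ratio p q)) = conj_op q (?c q) 1"
        by (rule mfps_inv_unique) (simp add: mfps_nth_0_ratio)
      moreover have "inverse (shift p q m) = inverse (x p) * q ^ Poly_Mapping.lookup m p" for m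
        by (simp add: shift_def power_inverse)
      ultimately show ?case
        using char[of q "G q"] by (simp add: conj_op_comp[of q "\<lambda>_. inverse (x p)"] conj_op_const)
    qed
  qed
  ultimately show "mfps_tendsto (\<lambda>q. conj_op q (\<lambda>m. inverse (shift p q m)) (G q))
      (mfps_const (inverse (x p)) * mfps_inv R * L) F"
    unfolding mult.assoc by (rule mfps_tendsto_cong)
qed

end

section \<open>Chains of subsets and the limit weights\<close>

lemma levels:
  fixes i n :: nat
  assumes "i \<in> {1..n - 1}"
  shows "i \<in> {1..n}" "i + 1 \<in> {1..n}" "n \<noteq> i"
  using assms unfolding atLeastAtMost_iff by arith+

text \<open>Raising one exponent \<open>d i0 j0\<close> affects only factors having
  \<open>(i0, j0)\<close> as first index, collected here, or as second index, collected in the next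
  lemma.\<close>

lemma prod_at_row:
  assumes "finite I" "i0 \<in> I" "finite (J i0)" "j0 \<in> J i0"
  shows "(\<Prod>i\<in>I. \<Prod>j\<in>J i. \<Prod>k\<in>K i. if i = i0 \<and> j = j0 then f k else (1::'a::comm_monoid_mult)) =
    (\<Prod>k\<in>K i0. f k)"
proof -
  have "(\<Prod>j\<in>J i. \<Prod>k\<in>K i. if i = i0 \<and> j = j0 then f k else 1) =
      (if i = i0 then \<Prod>k\<in>K i0. f k else 1)" for i
  proof (cases "i = i0")
    case True
    have "(\<Prod>j\<in>J i. \<Prod>k\<in>K i. if i = i0 \<and> j = j0 then f k else 1) =
        (\<Prod>j\<in>J i0. if j = j0 then \<Prod>k\<in>K i0. f k else 1)"
      using True by (intro prod.cong) auto
    then show ?thesis using True assms by simp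
  qed simp
  then show ?thesis using assms by simp
qed

lemma prod_at_column:
  assumes "finite I" "i0 \<in> I" "finite (K i0)" "k0 \<in> K i0"
  shows "(\<Prod>i\<in>I. \<Prod>j\<in>J i. \<Prod>k\<in>K i. if i = i0 \<and> k = k0 then f j else (1::'a::comm_monoid_mult)) =
    (\<Prod>j\<in>J i0. f j)"
proof -
  have "(\<Prod>j\<in>J i. \<Prod>k\<in>K i. if i = i0 \<and> k = k0 then f j else 1) =
      (if i = i0 then \<Prod>j\<in>J i0. f j else 1)" for i
  proof (cases "i = i0")
    case True
    have "(\<Prod>j\<in>J i. \<Prod>k\<in>K i. if i = i0 \<and> k = k0 then f j else 1) =
        (\<Prod>j\<in>J i0. \<Prod>k\<in>K i0. if k = k0 then f j else 1)"
      using True by (intro prod.cong) auto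
    then show ?thesis using True assms by simp
  qed simp
  then show ?thesis using assms by simp
qed

lemma prod_if_neq:
  "finite A \<Longrightarrow> (\<Prod>k\<in>A. if k = j then 1 else f k) = (\<Prod>k\<in>A - {j}. (f k :: 'a::comm_monoid_mult))"
  by (intro prod.mono_neutral_cong_right) auto

text \<open>
  Partial flags with the framing as top level: \<open>x n\<close> enumerates the equivariant parameters,
  and there is an empty level \<open>0\<close>. This makes all levels \<open>1, ..., n - 1\<close> look alike.
\<close>

locale flag_chain =
  fixes n :: nat and v :: "nat \<Rightarrow> nat" and x :: "nat \<Rightarrow> nat \<Rightarrow> complex"
  assumes n_pos: "1 \<le> n" and v_0: "v 0 = 0"
    and x_inj: "\<And>i. i \<in> {1..n} \<Longrightarrow> inj_on (x i) {1..v i}"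
    and x_chain: "\<And>i. i \<in> {1..n - 1} \<Longrightarrow> x i ` {1..v i} \<subseteq> x (i + 1) ` {1..v (i + 1)}"
    and x_top: "\<And>k. k \<in> {1..v n} \<Longrightarrow> x n k \<noteq> 0"
begin

lemma v_mono:
  assumes "i \<in> {1..n - 1}"
  shows "v i \<le> v (i + 1)"
proof -
  have "card (x i ` {1..v i}) \<le> card (x (i + 1) ` {1..v (i + 1)})"
    using x_chain[OF assms] by (intro card_mono) auto
  moreover have "i \<in> {1..n}" "i + 1 \<in> {1..n}" using assms by auto
  ultimately show ?thesis using x_inj by (simp add: card_image)
qed

text \<open>Ensures that the subtraction in \<open>v (i + 1) - v (i - 1)\<close> never
  truncates.\<close>

lemma v_pred_le:
  assumes "i \<in> {1..n - 1}"
  shows "v (i - 1) \<le> v (i + 1)"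
proof (cases "i = 1")
  case False
  then have "v (i - 1) \<le> v i" using assms v_mono[of "i - 1"] by force
  then show ?thesis using v_mono[OF assms] by simp
qed (simp add: v_0)

lemma x_in_top:
  assumes "i \<in> {1..n}" "j \<in> {1..v i}"
  shows "x i j \<in> x n ` {1..v n}"
  using assms
proof (induction "n - i" arbitrary: i j)
  case (Suc k)
  then have i: "i \<in> {1..n - 1}" by auto
  obtain l where "l \<in> {1..v (i + 1)}" "x i j = x (i + 1) l"
    using x_chain[OF i] Suc.prems(2) by blast
  then show ?case using Suc.hyps(1)[of "i + 1" l] Suc.hyps(2) i by auto
qed auto

lemma x_nonzero: "i \<in> {1..n} \<Longrightarrow> j \<in> {1..v i} \<Longrightarrow> x i j \<noteq> 0"
  using x_in_top x_top by fastforce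

abbreviation generic :: "complex set" where "generic \<equiv> generic_q (v n) (x n)"

text \<open>Every root is one of the top parameters, and different values come from different
  parameters.\<close>

lemma generic_x:
  assumes "q \<in> generic" "i \<in> {1..n}" "j \<in> {1..v i}" "i' \<in> {1..n}" "k \<in> {1..v i'}"
    "x i j \<noteq> x i' k"
  shows "q powi m \<noteq> x i j / x i' k"
proof
  assume eq: "q powi m = x i j / x i' k"
  obtain l l' where l: "l \<in> {1..v n}" "x i j = x n l" "l' \<in> {1..v n}" "x i' k = x n l'"
    using x_in_top[OF assms(2,3)] x_in_top[OF assms(4,5)] by auto
  then have "l \<noteq> l'" using assms(6) by auto
  then have "x n l \<noteq> q powi m * x n l'" using assms(1) l by (auto simp: generic_q_def)
  then show False using eq l x_top by (auto simp: field_simps)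
qed

text \<open>The coefficient F_d. The framing factors are the case \<open>i = n - 1\<close> of the
  last product. The sign in \<open>- csqrt q\<close> is what remains of the factors
  \<open>- csqrt h\<close> of \<open>z\<^sup>\<sharp>\<close> once the powers of
  \<open>csqrt h\<close> have cancelled.\<close>

definition weight :: "complex \<Rightarrow> (nat \<Rightarrow> nat \<Rightarrow> nat) \<Rightarrow> complex" where
  "weight q d =
    (- csqrt q) ^ (\<Sum>i=1..n - 1. (v (i + 1) - v (i - 1)) * (\<Sum>j=1..v i. d i j)) *
    (\<Prod>i=1..n - 1. \<Prod>j=1..v i. \<Prod>k=1..v i.
      inverse (curly_limit q (x i j / x i k) (int (d i j) - int (d i k)))) *
    (\<Prod>i=1..n - 1. \<Prod>j=1..v i. \<Prod>k=1..v (i + 1).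
      curly_limit q (x i j / x (i + 1) k) (int (d i j) - int (d (i + 1) k)))"

context
  fixes q :: complex
  assumes q: "q \<in> generic"
begin

lemma q_norm: "norm q < 1" and q_nonzero: "q \<noteq> 0"
  using q by (auto simp: generic_q_def)

text \<open>This is \<open>curly_limit_rec\<close> rewritten in the quantities
  \<open>x1 / q^d1\<close> and \<open>x2 / q^d2\<close> that the shifts produce.\<close>

lemma curly_limit_up:
  assumes "x1 \<noteq> 0" "x2 \<noteq> 0"
  shows "curly_limit q (x1 / x2) (int (Suc d1) - int d2) *
      (x1 * inverse q ^ d1 - q * (x2 * inverse q ^ d2)) =
    csqrt q * (x2 * inverse q ^ d2) * curly_limit q (x1 / x2) (int d1 - int d2)"
proof -
  let ?C = "curly_limit q (x1 / x2)" and ?D = "int d1 - int d2"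
  have eq: "?C (?D + 1) * (x1 / x2 - q powi (?D + 1)) = csqrt q * q powi ?D * ?C ?D"
    using assms by (intro curly_limit_rec q_norm q_nonzero) auto
  have D: "q powi ?D = q ^ d1 * inverse q ^ d2"
    using q_nonzero by (simp add: power_int_diff field_simps)
  have "x1 * inverse q ^ d1 - q * (x2 * inverse q ^ d2) =
      (x1 / x2 - q powi (?D + 1)) * (x2 * inverse q ^ d1)"
    using assms q_nonzero unfolding power_int_add_1[OF disjI1[OF q_nonzero]] D by (simp add: field_simps)
  then have "?C (?D + 1) * (x1 * inverse q ^ d1 - q * (x2 * inverse q ^ d2)) =
      (?C (?D + 1) * (x1 / x2 - q powi (?D + 1))) * (x2 * inverse q ^ d1)"
    by simp
  also have "\<dots> = csqrt q * (x2 * inverse q ^ d2) * ?C ?D"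
    unfolding eq D using q_nonzero by (simp add: field_simps)
  finally show ?thesis by (simp add: algebra_simps)
qed

text \<open>The preceding identity at \<open>Suc d2\<close>, read backwards.\<close>

lemma curly_limit_down:
  assumes "x1 \<noteq> 0" "x2 \<noteq> 0"
  shows "curly_limit q (x1 / x2) (int d1 - int (Suc d2)) * (x2 * inverse q ^ d2) =
    csqrt q * (x1 * inverse q ^ d1 - x2 * inverse q ^ d2) *
      curly_limit q (x1 / x2) (int d1 - int d2)"
proof -
  have shift: "int (Suc d1) - int (Suc d2) = int d1 - int d2"
    "q * (x2 * inverse q ^ Suc d2) = x2 * inverse q ^ d2"
    using q_nonzero by simp_all
  have "csqrt q * (curly_limit q (x1 / x2) (int d1 - int d2) *
      (x1 * inverse q ^ d1 - x2 * inverse q ^ d2)) = csqrt q * csqrt q * inverse q *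
      (x2 * inverse q ^ d2 * curly_limit q (x1 / x2) (int d1 - int (Suc d2)))"
    unfolding curly_limit_up[OF assms, of d1 "Suc d2", unfolded shift] by (simp add: mult_ac)
  moreover have "csqrt q * csqrt q * inverse q = 1"
    using q_nonzero power2_csqrt[of q] by (simp add: power2_eq_square)
  ultimately show ?thesis by (metis mult.assoc mult.commute mult_1)
qed

text \<open>The quotient of neighbouring coefficients, cleared of denominators. Only factors pairing
  \<open>(i0, j0)\<close> with a root of level \<open>i0\<close>, \<open>i0 + 1\<close> or
  \<open>i0 - 1\<close> change; they account for the three products on each side.\<close>

lemma weight_step:
  fixes d :: "nat \<Rightarrow> nat \<Rightarrow> nat" and i0 j0 :: nat
  assumes i0: "i0 \<in> {1..n - 1}" and j0: "j0 \<in> {1..v i0}"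
  defines "y \<equiv> \<lambda>i j. x i j * inverse q ^ d i j"
    and "d' \<equiv> d(i0 := (d i0)(j0 := Suc (d i0 j0)))"
  shows "weight q d' * ((\<Prod>k\<in>{1..v i0} - {j0}. q * y i0 k * (y i0 k - y i0 j0)) *
      (\<Prod>k=1..v (i0 + 1). y i0 j0 - q * y (i0 + 1) k) * y i0 j0 ^ v (i0 - 1)) =
    weight q d * ((-1) ^ (v (i0 + 1) - v (i0 - 1)) * q ^ v (i0 + 1) *
      (\<Prod>k\<in>{1..v i0} - {j0}. y i0 j0 * (y i0 j0 - q * y i0 k)) *
      (\<Prod>k=1..v (i0 + 1). y (i0 + 1) k) * (\<Prod>k=1..v (i0 - 1). y (i0 - 1) k - y i0 j0))"
proof -
  let ?c = "csqrt q" and ?v' = "v (i0 + 1) - v (i0 - 1)"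
  define E where "E d = (\<Sum>i=1..n - 1. (v (i + 1) - v (i - 1)) * (\<Sum>j=1..v i. d i j))"
    for d :: "nat \<Rightarrow> nat \<Rightarrow> nat"
  define W where "W d i j k = inverse (curly_limit q (x i j / x i k) (int (d i j) - int (d i k)))"
    for d :: "nat \<Rightarrow> nat \<Rightarrow> nat" and i j k
  define U where "U d i j k = curly_limit q (x i j / x (i + 1) k) (int (d i j) - int (d (i + 1) k))"
    for d :: "nat \<Rightarrow> nat \<Rightarrow> nat" and i j k
  have c2: "?c * ?c = q" using power2_csqrt[of q] by (simp add: power2_eq_square)
  have c0: "?c \<noteq> 0" using q_nonzero by simp
  have i0n: "i0 \<in> {1..n}" using i0 by auto

  have E: "E d' = E d + ?v'"
  proof -
    have "(\<Sum>j=1..v i. d' i j) = (\<Sum>j=1..v i. d i j) + (if i = i0 then 1 else 0)" for i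
    proof (cases "i = i0")
      case True
      have "(\<Sum>j=1..v i0. d' i0 j) = (\<Sum>j=1..v i0. d i0 j + (if j = j0 then 1 else 0))"
        by (rule sum.cong) (auto simp: d'_def)
      then show ?thesis using True j0 by (simp add: sum.distrib)
    qed (simp add: d'_def)
    then have "E d' = (\<Sum>i=1..n - 1. (v (i + 1) - v (i - 1)) * (\<Sum>j=1..v i. d i j) +
        (if i = i0 then ?v' else 0))"
      unfolding E_def by (intro sum.cong) auto
    then show ?thesis using i0 by (simp add: sum.distrib E_def)
  qed

  \<comment> \<open>\<open>AW\<close> and \<open>BW\<close> are the cross-multiplied changes of a
    single factor, from \<open>curly_limit_up\<close> if \<open>(i0, j0)\<close> is its first index
    and from \<open>curly_limit_down\<close> if it is the second. If it is both, the difference of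
    exponents stays \<open>0\<close>.\<close>
  define AW where "AW i j k = (if i = i0 \<and> j = j0 then (if k = j0 then 1 else ?c * y i0 k) else 1) *
      (if i = i0 \<and> k = j0 then (if j = j0 then 1 else ?c * (y i0 j - y i0 j0)) else 1)" for i j k :: nat
  define BW where "BW i j k = (if i = i0 \<and> j = j0 then (if k = j0 then 1 else y i0 j0 - q * y i0 k) else 1) *
      (if i = i0 \<and> k = j0 then (if j = j0 then 1 else y i0 j0) else 1)" for i j k :: nat
  have "W d' i j k * AW i j k = W d i j k * BW i j k"
    if i: "i \<in> {1..n - 1}" and j: "j \<in> {1..v i}" and k: "k \<in> {1..v i}" for i j k
  proof (cases "i = i0 \<and> j \<noteq> k \<and> (j = j0 \<or> k = j0)")
    case False
    then have "AW i j k = 1" "BW i j k = 1" by (auto simp: AW_def BW_def)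
    moreover have "W d' i j k = W d i j k" using False by (auto simp: W_def d'_def)
    ultimately show ?thesis by simp
  next
    case True
    then have "i = i0" "j \<noteq> k" by simp_all
    then have "i \<in> {1..n}" using i0n by simp
    then have ne: "x i j \<noteq> x i k" using inj_onD[OF x_inj, of i j k] j k \<open>j \<noteq> k\<close> by blast
    have x: "x i j \<noteq> 0" "x i k \<noteq> 0" by (intro x_nonzero \<open>i \<in> {1..n}\<close> j k)+
    have C: "curly_limit q (x i j / x i k) D \<noteq> 0" for D
    proof (rule curly_limit_nonzero[OF q_norm q_nonzero])
      show "x i j / x i k \<noteq> 0" using x by simp
      show "q powi m \<noteq> x i j / x i k" for m
        by (intro generic_x[OF q] \<open>i \<in> {1..n}\<close> j k ne)
    qed
    show ?thesis
    proof (cases "j = j0")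
      case True
      with \<open>i = i0 \<and> j \<noteq> k \<and> (j = j0 \<or> k = j0)\<close>
      have t: "i = i0" "j = j0" "k \<noteq> j0" by auto
      have "W d' i j k = inverse (curly_limit q (x i j / x i k) (int (Suc (d i j)) - int (d i k)))"
        using t by (simp add: W_def d'_def)
      moreover have "curly_limit q (x i j / x i k) (int (Suc (d i j)) - int (d i k)) * (y i j - q * y i k) =
          ?c * y i k * curly_limit q (x i j / x i k) (int (d i j) - int (d i k))"
        unfolding y_def by (rule curly_limit_up[OF x])
      ultimately have "W d' i j k * (?c * y i k) = W d i j k * (y i j - q * y i k)"
        using C unfolding W_def by (simp add: field_simps)
      then show ?thesis using t by (simp add: AW_def BW_def)
    next
      case False
      with \<open>i = i0 \<and> j \<noteq> k \<and> (j = j0 \<or> k = j0)\<close>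
      have t: "i = i0" "k = j0" "j \<noteq> j0" by auto
      have "W d' i j k = inverse (curly_limit q (x i j / x i k) (int (d i j) - int (Suc (d i k))))"
        using t by (simp add: W_def d'_def)
      moreover have "curly_limit q (x i j / x i k) (int (d i j) - int (Suc (d i k))) * y i k =
          ?c * (y i j - y i k) * curly_limit q (x i j / x i k) (int (d i j) - int (d i k))"
        unfolding y_def by (rule curly_limit_down[OF x])
      ultimately have "W d' i j k * (?c * (y i j - y i k)) = W d i j k * y i k"
        using C unfolding W_def by (simp add: field_simps)
      then show ?thesis using t by (simp add: AW_def BW_def)
    qed
  qed
  then have "(\<Prod>i=1..n - 1. \<Prod>j=1..v i. \<Prod>k=1..v i. W d' i j k * AW i j k) =
      (\<Prod>i=1..n - 1. \<Prod>j=1..v i. \<Prod>k=1..v i. W d i j k * BW i j k)"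
    by (intro prod.cong) auto
  moreover have row: "(\<Prod>i=1..n - 1. \<Prod>j=1..v i. \<Prod>k=1..v i. if i = i0 \<and> j = j0
      then (if k = j0 then 1 else f k) else 1) = (\<Prod>k\<in>{1..v i0} - {j0}. f k)" for f :: "nat \<Rightarrow> complex"
    using i0 j0 by (subst prod_at_row) (simp_all add: prod_if_neq)
  moreover have col: "(\<Prod>i=1..n - 1. \<Prod>j=1..v i. \<Prod>k=1..v i. if i = i0 \<and> k = j0
      then (if j = j0 then 1 else f j) else 1) = (\<Prod>k\<in>{1..v i0} - {j0}. f k)" for f :: "nat \<Rightarrow> complex"
    using i0 j0 by (subst prod_at_column) (simp_all add: prod_if_neq)
  have "?c * s * (?c * t) = q * s * t" for s t
  proof -
    have "?c * s * (?c * t) = (?c * ?c) * s * t" by (simp only: mult_ac)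
    then show ?thesis by (simp only: c2)
  qed
  then have "(\<Prod>i=1..n - 1. \<Prod>j=1..v i. \<Prod>k=1..v i. AW i j k) =
      (\<Prod>k\<in>{1..v i0} - {j0}. q * y i0 k * (y i0 k - y i0 j0))"
    unfolding AW_def prod.distrib[where A = "{1.._}"] unfolding row col prod.distrib[symmetric] by (simp only:)
  moreover have "(\<Prod>i=1..n - 1. \<Prod>j=1..v i. \<Prod>k=1..v i. BW i j k) =
      (\<Prod>k\<in>{1..v i0} - {j0}. y i0 j0 * (y i0 j0 - q * y i0 k))"
    unfolding BW_def prod.distrib[where A = "{1.._}"] unfolding row col prod.distrib[symmetric]
    by (simp only: mult.commute)
  ultimately have W: "(\<Prod>i=1..n - 1. \<Prod>j=1..v i. \<Prod>k=1..v i. W d' i j k) *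
      (\<Prod>k\<in>{1..v i0} - {j0}. q * y i0 k * (y i0 k - y i0 j0)) =
      (\<Prod>i=1..n - 1. \<Prod>j=1..v i. \<Prod>k=1..v i. W d i j k) *
      (\<Prod>k\<in>{1..v i0} - {j0}. y i0 j0 * (y i0 j0 - q * y i0 k))"
    by (simp add: prod.distrib)

  define AU where "AU i j k = (if i = i0 \<and> j = j0 then y i0 j0 - q * y (i0 + 1) k else 1) *
      (if i = i0 - 1 \<and> k = j0 then y i0 j0 else 1)" for i j k :: nat
  define BU where "BU i j k = (if i = i0 \<and> j = j0 then ?c * y (i0 + 1) k else 1) *
      (if i = i0 - 1 \<and> k = j0 then ?c * (y (i0 - 1) j - y i0 j0) else 1)" for i j k :: nat
  have "U d' i j k * AU i j k = U d i j k * BU i j k"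
    if i: "i \<in> {1..n - 1}" and j: "j \<in> {1..v i}" and k: "k \<in> {1..v (i + 1)}" for i j k
  proof -
    have x: "x i j \<noteq> 0" "x (i + 1) k \<noteq> 0" by (intro x_nonzero levels[OF i] j k)+
    consider "i = i0" "j = j0" | "i + 1 = i0" "k = j0" | "\<not> (i = i0 \<and> j = j0)" "\<not> (i + 1 = i0 \<and> k = j0)"
      by blast
    then show ?thesis
    proof cases
      case 1
      have "i \<noteq> i0 - 1" using 1 i by auto
      moreover have "U d' i j k = curly_limit q (x i j / x (i + 1) k) (int (Suc (d i j)) - int (d (i + 1) k))"
        using 1 by (simp add: U_def d'_def)
      moreover have "curly_limit q (x i j / x (i + 1) k) (int (Suc (d i j)) - int (d (i + 1) k)) *
          (y i j - q * y (i + 1) k) = ?c * y (i + 1) k * U d i j k"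
        unfolding y_def U_def by (rule curly_limit_up[OF x])
      ultimately show ?thesis using 1 by (simp add: AU_def BU_def mult_ac)
    next
      case 2
      have "i0 \<noteq> i" "i = i0 - 1" using 2 by auto
      moreover have "U d' i j k = curly_limit q (x i j / x (i + 1) k) (int (d i j) - int (Suc (d (i + 1) k)))"
        using 2 by (auto simp: U_def d'_def)
      moreover have "curly_limit q (x i j / x (i + 1) k) (int (d i j) - int (Suc (d (i + 1) k))) *
          y (i + 1) k = ?c * (y i j - y (i + 1) k) * U d i j k"
        unfolding y_def U_def by (rule curly_limit_down[OF x])
      ultimately show ?thesis using 2 by (simp add: AU_def BU_def mult_ac)
    next
      case 3
      then have "AU i j k = 1" "BU i j k = 1" using i0 by (auto simp: AU_def BU_def)
      moreover have "U d' i j k = U d i j k" using 3 by (auto simp: U_def d'_def)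
      ultimately show ?thesis by simp
    qed
  qed
  then have "(\<Prod>i=1..n - 1. \<Prod>j=1..v i. \<Prod>k=1..v (i + 1). U d' i j k * AU i j k) =
      (\<Prod>i=1..n - 1. \<Prod>j=1..v i. \<Prod>k=1..v (i + 1). U d i j k * BU i j k)"
    by (intro prod.cong) auto
  moreover have low: "(\<Prod>i=1..n - 1. \<Prod>j=1..v i. \<Prod>k=1..v (i + 1).
      if i = i0 - 1 \<and> k = j0 then f j else 1) = (\<Prod>j=1..v (i0 - 1). f j)" for f :: "nat \<Rightarrow> complex"
  \<comment> \<open>For \<open>i0 = 1\<close> the level \<open>i0 - 1\<close> is \<open>0\<close>,
    outside the range of the outer product, and \<open>v 0 = 0\<close> makes the right-hand side
    empty as well.\<close>
  proof (cases "i0 = 1")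
    case True
    then have "(\<Prod>i=1..n - 1. \<Prod>j=1..v i. \<Prod>k=1..v (i + 1).
        if i = i0 - 1 \<and> k = j0 then f j else 1) = 1"
      by (intro prod.neutral ballI) auto
    then show ?thesis using True v_0 by simp
  next
    case False
    then have "i0 - 1 \<in> {1..n - 1}" "j0 \<in> {1..v (i0 - 1 + 1)}" using i0 j0 by auto
    then show ?thesis by (intro prod_at_column) auto
  qed
  moreover have "(\<Prod>i=1..n - 1. \<Prod>j=1..v i. \<Prod>k=1..v (i + 1). AU i j k) =
      (\<Prod>k=1..v (i0 + 1). y i0 j0 - q * y (i0 + 1) k) * y i0 j0 ^ v (i0 - 1)"
    using i0 j0 unfolding AU_def prod.distrib low by (subst prod_at_row) simp_all
  moreover have "(\<Prod>i=1..n - 1. \<Prod>j=1..v i. \<Prod>k=1..v (i + 1). BU i j k) =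
      ?c ^ v (i0 + 1) * (\<Prod>k=1..v (i0 + 1). y (i0 + 1) k) *
      (?c ^ v (i0 - 1) * (\<Prod>k=1..v (i0 - 1). y (i0 - 1) k - y i0 j0))"
    using i0 j0 unfolding BU_def prod.distrib low
    by (subst prod_at_row) (simp_all add: prod.distrib)
  ultimately have U: "(\<Prod>i=1..n - 1. \<Prod>j=1..v i. \<Prod>k=1..v (i + 1). U d' i j k) *
      ((\<Prod>k=1..v (i0 + 1). y i0 j0 - q * y (i0 + 1) k) * y i0 j0 ^ v (i0 - 1)) =
      (\<Prod>i=1..n - 1. \<Prod>j=1..v i. \<Prod>k=1..v (i + 1). U d i j k) *
      (?c ^ v (i0 + 1) * (\<Prod>k=1..v (i0 + 1). y (i0 + 1) k) *
      (?c ^ v (i0 - 1) * (\<Prod>k=1..v (i0 - 1). y (i0 - 1) k - y i0 j0)))"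
    by (simp add: prod.distrib)

  \<comment> \<open>The degree prefactor supplies exactly the powers of \<open>csqrt q\<close> that
    make the total an integral power of \<open>q\<close>. Its sign survives and becomes the sign of
    the Bethe parameter.\<close>
  have "?v' + v (i0 + 1) + v (i0 - 1) = 2 * v (i0 + 1)" using v_pred_le[OF i0] by simp
  then have "(- ?c) ^ ?v' * ?c ^ v (i0 + 1) * ?c ^ v (i0 - 1) = (-1) ^ ?v' * ?c ^ (2 * v (i0 + 1))"
    by (metis (no_types, lifting) mult.assoc power_add power_minus)
  then have pow: "(- ?c) ^ ?v' * ?c ^ v (i0 + 1) * ?c ^ v (i0 - 1) = (-1) ^ ?v' * q ^ v (i0 + 1)"
    by (simp add: power_mult)
  have weight: "weight q d = (- ?c) ^ E d * (\<Prod>i=1..n - 1. \<Prod>j=1..v i. \<Prod>k=1..v i. W d i j k) *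
      (\<Prod>i=1..n - 1. \<Prod>j=1..v i. \<Prod>k=1..v (i + 1). U d i j k)" for d
    by (simp add: weight_def E_def W_def U_def)
  have combine: "(e * f) * w' * u' * (A * B * C) =
      e * w * u * (s * A2 * Y * L)"
    if "w' * A = w * A2" "u' * (B * C) = u * (g * Y * (h * L))" "f * g * h = s"
    for e f w w' u u' A A2 B C Y L g h s :: complex
  proof -
    have "(e * f) * w' * u' * (A * B * C) = e * f * (w' * A) * (u' * (B * C))" by (simp add: mult_ac)
    also have "\<dots> = e * w * u * ((f * g * h) * A2 * Y * L)" unfolding that(1,2) by (simp add: mult_ac)
    finally show ?thesis unfolding that(3) .
  qed
  show ?thesis
    unfolding weight E power_add by (rule combine[OF W U pow])
qed

text \<open>Equal roots on adjacent levels contribute \<open>curly_limit q 1\<close> at a negative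
  index, which is \<open>0\<close>.\<close>

lemma weight_eq_0:
  assumes i: "i \<in> {1..n - 1}" "j \<in> {1..v i}" "k \<in> {1..v (i + 1)}"
    and "x (i + 1) k = x i j" "d i j < d (i + 1) k"
  shows "weight q d = 0"
proof -
  have "x i j \<noteq> 0" by (intro x_nonzero levels[OF i(1)] i(2))
  then have "curly_limit q (x i j / x (i + 1) k) (int (d i j) - int (d (i + 1) k)) = 0"
    using assms curly_limit_1_neg[OF q_norm q_nonzero] by simp
  then have "\<exists>i\<in>{1..n - 1}. \<exists>j\<in>{1..v i}. \<exists>k\<in>{1..v (i + 1)}.
      curly_limit q (x i j / x (i + 1) k) (int (d i j) - int (d (i + 1) k)) = 0"
    using i by blast
  then show ?thesis by (simp add: weight_def)
qed

text \<open>Normalizes the vertex to constant term \<open>1\<close>, so that it is invertible as a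
  power series.\<close>

lemma weight_0: "weight q (\<lambda>_ _. 0) = 1"
proof -
  have "curly_limit q (x i j / x i' k) 0 = 1"
    if "i \<in> {1..n}" "j \<in> {1..v i}" "i' \<in> {1..n}" "k \<in> {1..v i'}" for i j i' k
  proof -
    have "x i j \<noteq> 0" "x i' k \<noteq> 0" using x_nonzero that by auto
    then show ?thesis
      using generic_x[OF q that] by (intro curly_limit_0 q_norm q_nonzero) auto
  qed
  then have "(\<Prod>i=1..n - 1. \<Prod>j=1..v i. \<Prod>k=1..v i. inverse (curly_limit q (x i j / x i k) 0)) = 1"
    "(\<Prod>i=1..n - 1. \<Prod>j=1..v i. \<Prod>k=1..v (i + 1). curly_limit q (x i j / x (i + 1) k) 0) = 1"
    by (auto intro!: prod.neutral)
  then show ?thesis by (simp add: weight_def)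
qed

end

section \<open>The q-difference equations of the vertex\<close>


text \<open>Generic points are found on the real axis just below \<open>1\<close>: a coincidence of
  \<open>x n j\<close> with \<open>q^m\<close> times \<open>x n k\<close> for
  \<open>j \<noteq> k\<close> forces \<open>m \<noteq> 0\<close> and determines a positive real
  \<open>q\<close> by \<open>m\<close> and absolute values, so only the countable set
  \<open>B\<close> has to be avoided.\<close>

lemma one_islimpt_generic: "1 islimpt generic"
  unfolding islimpt_approachable
proof (intro allI impI)
  fix e :: real assume e: "0 < e"
  define B where "B = (\<lambda>(j, k, m :: int). exp (ln (norm (x n j / x n k)) / of_int m)) `
    ({1..v n} \<times> {1..v n} \<times> UNIV)"
  have "countable B" unfolding B_def by (intro countable_image) auto
  moreover have "uncountable {max 0 (1 - e)<..<1}" using e by (simp add: uncountable_open_interval)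
  ultimately have "{max 0 (1 - e)<..<1} - B \<noteq> {}"
    using uncountable_minus_countable by (metis countable_empty)
  then obtain t where "t \<in> {max 0 (1 - e)<..<1} - B" by blast
  then have t: "0 < t" "1 - e < t" "t < 1" "t \<notin> B" by auto
  have "x n j \<noteq> complex_of_real t powi m * x n k"
    if jk: "j \<in> {1..v n}" "k \<in> {1..v n}" "j \<noteq> k" for j k m
  proof
    assume eq: "x n j = complex_of_real t powi m * x n k"
    have "x n j \<noteq> x n k" using inj_onD[OF x_inj, of n j k] n_pos jk by auto
    then have "m \<noteq> 0" using eq by auto
    have "x n k \<noteq> 0" using x_top jk by auto
    then have "norm (x n j / x n k) = t powi m"
      using eq t by (simp add: norm_mult norm_power_int)
    then have "ln (norm (x n j / x n k)) = of_int m * ln t"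
      using t by (simp add: powr_real_of_int' ln_powr flip: powr_real_of_int')
    then have "exp (ln (norm (x n j / x n k)) / of_int m) = t"
      using t \<open>m \<noteq> 0\<close> by simp
    then have "t \<in> B" unfolding B_def using jk by force
    then show False using t by simp
  qed
  then have "complex_of_real t \<in> generic" using t by (auto simp: generic_q_def)
  moreover have "dist (complex_of_real t) 1 = norm (complex_of_real (t - 1))"
    by (simp add: dist_norm)
  then have "dist (complex_of_real t) 1 < e"
    unfolding norm_of_real using t by simp
  ultimately show "\<exists>q\<in>generic. q \<noteq> 1 \<and> dist q 1 < e"
    using t by (intro bexI[of _ "complex_of_real t"]) auto
qed

text \<open>
  The vertex with a separate variable \<open>prod_encode (i, j)\<close> for each Chern root. The
  specialization of all variables with the same \<open>i\<close> gives the vertex of the flag variety.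
\<close>

definition root_vars :: "nat set" where
  "root_vars = prod_encode ` (SIGMA i:{1..n - 1}. {1..v i})"

definition exps :: "(nat \<Rightarrow>\<^sub>0 nat) \<Rightarrow> nat \<Rightarrow> nat \<Rightarrow> nat" where
  "exps m i j = Poly_Mapping.lookup m (prod_encode (i, j))"

definition split_vertex :: "complex \<Rightarrow> complex mfps" where
  "split_vertex q = (if q \<in> generic
    then Abs_mfps (\<lambda>m. if Poly_Mapping.keys m \<subseteq> root_vars then weight q (exps m) else 0) else 1)"

lemma mfps_nth_split_vertex:
  "q \<in> generic \<Longrightarrow> mfps_nth (split_vertex q) m =
    (if Poly_Mapping.keys m \<subseteq> root_vars then weight q (exps m) else 0)"
  by (simp add: split_vertex_def)

lemma finite_root_vars: "finite root_vars"
  by (simp add: root_vars_def)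

lemma root_vars_iff: "prod_encode (i, j) \<in> root_vars \<longleftrightarrow> i \<in> {1..n - 1} \<and> j \<in> {1..v i}"
  unfolding root_vars_def by (auto simp: prod_encode_eq)

sublocale vertex_asymptotics "at 1 within generic" split_vertex "\<lambda>p. case_prod x (prod_decode p)"
proof
  show "((\<lambda>q. q) \<longlongrightarrow> 1) (at 1 within generic)" by (rule tendsto_ident_at)
  show "at 1 within generic \<noteq> bot" using one_islimpt_generic trivial_limit_within by blast
  show "mfps_nth (split_vertex q) 0 = 1" for q
  proof (cases "q \<in> generic")
    case True
    have "exps 0 = (\<lambda>_ _. 0)" by (simp add: exps_def fun_eq_iff)
    then show ?thesis using True weight_0 by (simp add: mfps_nth_split_vertex)
  \<comment> \<open>The value \<open>1\<close> at the remaining \<open>q\<close> was chosen so that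
    the constant term is \<open>1\<close> everywhere.\<close>
  qed (simp add: split_vertex_def mfps_nth_one)
qed

definition root_shift :: "nat \<Rightarrow> nat \<Rightarrow> symbol" where
  "root_shift i j = shift (prod_encode (i, j))"

lemma root_shift_eq: "root_shift i j q m = x i j * inverse q ^ exps m i j"
  by (simp add: root_shift_def shift_def exps_def)

text \<open>\<open>lead\<close> and \<open>tail\<close> are the two factors of
  \<open>weight_step\<close>, divided by \<open>q ^ v (i + 1)\<close>. In \<open>lead\<close> the
  roots are taken at the raised exponent, so the old root \<open>(i, j)\<close> is \<open>q\<close>
  times the new one; in \<open>tail\<close> they are taken at the old exponent.\<close>

definition lead :: "nat \<Rightarrow> nat \<Rightarrow> symbol" where
  "lead i j q m =
    (\<Prod>k\<in>{1..v i} - {j}. q * root_shift i k q m * (root_shift i k q m - q * root_shift i j q m)) *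
    (\<Prod>k=1..v (i + 1). root_shift i j q m - root_shift (i + 1) k q m) *
    (\<Prod>k=1..v (i - 1). q * root_shift i j q m)"

definition tail :: "nat \<Rightarrow> nat \<Rightarrow> symbol" where
  "tail i j q m = (-1) ^ (v (i + 1) - v (i - 1)) *
    (\<Prod>k\<in>{1..v i} - {j}. root_shift i j q m * (root_shift i j q m - q * root_shift i k q m)) *
    (\<Prod>k=1..v (i + 1). root_shift (i + 1) k q m) *
    (\<Prod>k=1..v (i - 1). root_shift (i - 1) k q m - root_shift i j q m)"

lemma q_difference_equation:
  assumes q: "q \<in> generic" and i: "i \<in> {1..n - 1}" and j: "j \<in> {1..v i}"
  shows "scale_coeffs (lead i j q) (split_vertex q) =
    mfps_var (prod_encode (i, j)) * scale_coeffs (tail i j q) (split_vertex q)"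
proof (rule mfps_eqI)
  fix m
  let ?p = "prod_encode (i, j)" and ?V = "split_vertex q"
  let ?e = "Poly_Mapping.single ?p (1::nat)"
  define m0 where "m0 = m - ?e"
  have q0: "q \<noteq> 0" using q by (auto simp: generic_q_def)
  have p: "?p \<in> root_vars" using i j by (simp add: root_vars_iff)
  show "mfps_nth (scale_coeffs (lead i j q) ?V) m = mfps_nth (mfps_var ?p * scale_coeffs (tail i j q) ?V) m"
  proof (cases "exps m i j = 0")
    case True
    \<comment> \<open>The right-hand side has no such monomial, so the left must vanish. The equal
      root \<open>l\<close> of the next level ensures it: if its exponent is \<open>0\<close>, then
      \<open>lead\<close> contains the difference of two equal roots, and otherwise the weight is
      \<open>0\<close>.\<close>
    obtain l where l: "l \<in> {1..v (i + 1)}" "x (i + 1) l = x i j"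
      using x_chain[OF i] j by force
    have "lead i j q m * mfps_nth ?V m = 0"
    proof (cases "exps m (i + 1) l = 0")
      case True
      then have "root_shift i j q m - root_shift (i + 1) l q m = 0"
        using \<open>exps m i j = 0\<close> l by (simp add: root_shift_eq)
      then have "(\<Prod>k=1..v (i + 1). root_shift i j q m - root_shift (i + 1) k q m) = 0"
        using l by (intro prod_zero) auto
      then show ?thesis by (simp add: lead_def)
    next
      case False
      then have "weight q (exps m) = 0"
        using \<open>exps m i j = 0\<close> l by (intro weight_eq_0[OF q i j]) auto
      then show ?thesis using q by (simp add: mfps_nth_split_vertex)
    qed
    then show ?thesis using True by (simp add: mfps_nth_var_mult exps_def)
  next
    case False
    then have m: "m = m0 + ?e" unfolding m0_def
      by (intro poly_mapping_eqI) (auto simp: lookup_add lookup_minus lookup_single when_def exps_def)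
    have keys: "Poly_Mapping.keys m \<subseteq> root_vars \<longleftrightarrow> Poly_Mapping.keys m0 \<subseteq> root_vars"
      unfolding m keys_subset_add_iff using p by simp
    have exps: "exps m = (exps m0)(i := (exps m0 i)(j := Suc (exps m0 i j)))"
      unfolding m by (auto simp: exps_def fun_eq_iff lookup_add lookup_single when_def prod_encode_eq)
    have ij: "root_shift i j q m = inverse q * root_shift i j q m0"
      by (simp add: root_shift_eq exps)
    have other: "root_shift i' k q m = root_shift i' k q m0" if "i' \<noteq> i \<or> k \<noteq> j" for i' k
      using that by (auto simp: root_shift_eq exps)
    let ?y = "\<lambda>i k. root_shift i k q m0"
    have "(\<Prod>k\<in>{1..v i} - {j}. q * root_shift i k q m * (root_shift i k q m - q * root_shift i j q m)) =
        (\<Prod>k\<in>{1..v i} - {j}. q * ?y i k * (?y i k - ?y i j))"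
      using q0 by (intro prod.cong) (auto simp: ij other)
    moreover have "(\<Prod>k=1..v (i + 1). root_shift i j q m - root_shift (i + 1) k q m) * q ^ v (i + 1) =
        (\<Prod>k=1..v (i + 1). ?y i j - q * ?y (i + 1) k)"
    proof -
      have "(\<Prod>k=1..v (i + 1). root_shift i j q m - root_shift (i + 1) k q m) * (\<Prod>k=1..v (i + 1). q) =
          (\<Prod>k=1..v (i + 1). ?y i j - q * ?y (i + 1) k)"
        unfolding prod.distrib[symmetric] using q0
        by (intro prod.cong) (auto simp: ij other field_simps)
      then show ?thesis by simp
    qed
    moreover have "(\<Prod>k=1..v (i - 1). q * root_shift i j q m) = ?y i j ^ v (i - 1)"
      using q0 by (simp add: ij flip: mult.assoc)
    ultimately have lead: "lead i j q m * q ^ v (i + 1) =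
        (\<Prod>k\<in>{1..v i} - {j}. q * ?y i k * (?y i k - ?y i j)) *
        (\<Prod>k=1..v (i + 1). ?y i j - q * ?y (i + 1) k) * ?y i j ^ v (i - 1)"
      unfolding lead_def by (simp add: mult_ac)
    have "weight q (exps m) * (lead i j q m * q ^ v (i + 1)) =
        weight q (exps m0) * tail i j q m0 * q ^ v (i + 1)"
      unfolding lead unfolding exps root_shift_eq
      by (subst weight_step[OF q i j]) (simp add: tail_def root_shift_eq mult_ac)
    then have "weight q (exps m) * lead i j q m = weight q (exps m0) * tail i j q m0"
      using q0 by simp
    moreover have "mfps_nth (mfps_var ?p * scale_coeffs (tail i j q) ?V) m =
        mfps_nth (scale_coeffs (tail i j q) ?V) m0"
      using False unfolding mfps_nth_var_mult exps_def m0_def by simp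
    ultimately show ?thesis
      using q keys by (simp add: mfps_nth_split_vertex mult.commute)
  qed
qed

lemma conj_lead_eq:
  assumes "q \<in> generic" "i \<in> {1..n - 1}" "j \<in> {1..v i}"
  shows "conj_op q (lead i j q) 1 = mfps_var (prod_encode (i, j)) * conj_op q (tail i j q) 1"
  using q_difference_equation[OF assms] by (simp add: conj_op_def mult_ac)

lemma eventually_generic: "\<forall>\<^sub>F q in at 1 within generic. q \<in> generic"
  by (simp add: eventually_at_filter)

text \<open>The vertex does not involve the variables of the framing level. This starts the
  recursion over the levels.\<close>

lemma ratio_top:
  assumes "k \<in> {1..v n}"
  shows "ratio (prod_encode (n, k)) q = 1"
proof -
  let ?p = "prod_encode (n, k)"
  have "?p \<notin> root_vars" using n_pos by (auto simp: root_vars_iff)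
  then have *: "Poly_Mapping.lookup m ?p = 0"
    if "Poly_Mapping.keys m \<subseteq> root_vars" for m :: "nat \<Rightarrow>\<^sub>0 nat"
    using that by (meson in_keys_iff subsetD)
  have "mfps_nth (split_vertex q) m = 0" if "\<not> Poly_Mapping.keys m \<subseteq> root_vars" for m
    using that by (auto simp: split_vertex_def mfps_nth_one)
  then have "inverse q ^ Poly_Mapping.lookup m ?p * mfps_nth (split_vertex q) m =
      mfps_nth (split_vertex q) m" for m
    using * by (cases "Poly_Mapping.keys m \<subseteq> root_vars") simp_all
  then have "scale_coeffs (\<lambda>m. inverse q ^ Poly_Mapping.lookup m ?p) (split_vertex q) = split_vertex q"
    by (intro mfps_eqI) simp
  then show ?thesis by (simp add: ratio_def conj_op_def V_inv)
qed

section \<open>Convergence of the quotients as \<open>q\<close> tends to 1\<close>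

lemma tendsto_q: "((\<lambda>q. q) \<longlongrightarrow> 1) (at 1 within generic)"
  by (rule F_to_1)

lemma ratio_limits:
  obtains R where "\<And>i j. i \<in> {1..n} \<Longrightarrow> j \<in> {1..v i} \<Longrightarrow>
    mfps_tendsto (ratio (prod_encode (i, j))) (R i j) (at 1 within generic)"
proof -
  \<comment> \<open>The framing level is included as the start of the recursion; the measure is the
    distance \<open>n - i\<close> from it.\<close>
  define P where "P = prod_encode ` (SIGMA i:{1..n}. {1..v i})"
  define H where "H N \<longleftrightarrow> (\<forall>p\<in>P. \<forall>b. mdeg b < N \<longrightarrow> convg (\<lambda>q. mfps_nth (ratio p q) b))" for N
  have P: "prod_encode (i, j) \<in> P" if "i \<in> {1..n}" "j \<in> {1..v i}" for i j
    using that by (auto simp: P_def)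
  have tame_root: "tame N (root_shift i j) (x i j)"
    if "H N" "i \<in> {1..n}" "j \<in> {1..v i}" for N i j
    unfolding root_shift_def
    using tame_shift[of N "prod_encode (i, j)"] that P by (simp add: H_def)
  have interior: "\<exists>J K B \<kappa> \<beta>. J \<in> P \<and> n - fst (prod_decode J) < n - fst (prod_decode p) \<and>
      case_prod x (prod_decode J) = case_prod x (prod_decode p) \<and> \<kappa> \<noteq> 0 \<and>
      (\<forall>N. H N \<longrightarrow> tame N K \<kappa> \<and> tame N B \<beta>) \<and>
      (\<forall>\<^sub>F q in at 1 within generic. conj_op q (\<lambda>m. K q m * (shift p q m - shift J q m)) 1 =
        mfps_var p * conj_op q (B q) 1)"
    if p: "p = prod_encode (i, j)" and i: "i \<in> {1..n - 1}" and j: "j \<in> {1..v i}" for p i j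
  proof -
    obtain l where l: "l \<in> {1..v (i + 1)}" "x (i + 1) l = x i j"
      using x_chain[OF i] j by force
    \<comment> \<open>\<open>K\<close> is \<open>lead\<close> without the one factor that vanishes
      in the limit, the difference of the root \<open>(i, j)\<close> and the equal root
      \<open>(i + 1, l)\<close>.\<close>
    define K where "K q m =
      (\<Prod>k\<in>{1..v i} - {j}. q * root_shift i k q m * (root_shift i k q m - q * root_shift i j q m)) *
      (\<Prod>k\<in>{1..v (i + 1)} - {l}. root_shift i j q m - root_shift (i + 1) k q m) *
      (\<Prod>k=1..v (i - 1). q * root_shift i j q m)" for q m
    \<comment> \<open>The limit of \<open>K\<close>, with each factor \<open>1\<close> standing for
      the limit of \<open>q\<close>. It is nonzero because each level enumerates distinct nonzero
      values.\<close>
    define \<kappa> where "\<kappa> =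
      (\<Prod>k\<in>{1..v i} - {j}. 1 * x i k * (x i k - 1 * x i j)) *
      (\<Prod>k\<in>{1..v (i + 1)} - {l}. x i j - x (i + 1) k) *
      (\<Prod>k=1..v (i - 1). 1 * x i j)"
    define \<beta> where "\<beta> = (-1) ^ (v (i + 1) - v (i - 1)) *
      (\<Prod>k\<in>{1..v i} - {j}. x i j * (x i j - 1 * x i k)) *
      (\<Prod>k=1..v (i + 1). x (i + 1) k) *
      (\<Prod>k=1..v (i - 1). x (i - 1) k - x i j)"
    \<comment> \<open>For \<open>i = 1\<close> the claim about level \<open>0\<close> is vacuous,
      since \<open>v 0 = 0\<close>.\<close>
    have low: "i - 1 \<in> {1..n}" if "k \<in> {1..v (i - 1)}" for k
      using that i v_0 by (cases "i = 1") auto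
    have tames: "tame N K \<kappa> \<and> tame N (tail i j) \<beta>" if "H N" for N
      unfolding K_def \<kappa>_def \<beta>_def tail_def[abs_def]
      by (intro conjI tame_mult tame_diff tame_prod tame_const[OF tendsto_q]
          tame_const[OF tendsto_const] tame_root that)
        (use levels[OF i] low j in auto)
    have "x i k \<noteq> x i j" if "k \<in> {1..v i} - {j}" for k
      using inj_onD[OF x_inj[OF levels(1)[OF i]], of k j] that j by blast
    moreover have "x i j \<noteq> x (i + 1) k" if "k \<in> {1..v (i + 1)} - {l}" for k
      using inj_onD[OF x_inj[OF levels(2)[OF i]], of k l] that l by auto
    moreover have "x i k \<noteq> 0" if "k \<in> {1..v i}" for k
      using x_nonzero[OF levels(1)[OF i] that] .
    ultimately have "\<kappa> \<noteq> 0" using j by (simp add: \<kappa>_def)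
    have "lead i j q m = K q m * (shift p q m - shift (prod_encode (i + 1, l)) q m)" for q m
      using l unfolding lead_def K_def
      by (subst prod.remove[of _ l "\<lambda>k. root_shift i j q m - root_shift (i + 1) k q m"])
        (simp_all add: p root_shift_def mult_ac)
    then have "lead i j q = (\<lambda>m. K q m * (shift p q m - shift (prod_encode (i + 1, l)) q m))" for q
      by blast
    then have "\<forall>\<^sub>F q in at 1 within generic.
        conj_op q (\<lambda>m. K q m * (shift p q m - shift (prod_encode (i + 1, l)) q m)) 1 =
        mfps_var p * conj_op q (tail i j q) 1"
      by (intro eventually_mono[OF eventually_generic]) (use conj_lead_eq[OF _ i j] p in simp)
    moreover have "n - (i + 1) < n - i" using levels[OF i] i by auto
    ultimately show ?thesis
      using P[OF levels(2)[OF i] l(1)] l(2) \<open>\<kappa> \<noteq> 0\<close> tames p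
      by (intro exI[of _ "prod_encode (i + 1, l)"] exI[of _ K] exI[of _ "tail i j"] exI[of _ \<kappa>] exI[of _ \<beta>])
        auto
  qed
  have step: "(\<forall>q. ratio p q = 1) \<or>
      (\<exists>J K B \<kappa> \<beta>. J \<in> P \<and> n - fst (prod_decode J) < n - fst (prod_decode p) \<and>
      case_prod x (prod_decode J) = case_prod x (prod_decode p) \<and> \<kappa> \<noteq> 0 \<and>
      (\<forall>N. H N \<longrightarrow> tame N K \<kappa> \<and> tame N B \<beta>) \<and>
      (\<forall>\<^sub>F q in at 1 within generic. conj_op q (\<lambda>m. K q m * (shift p q m - shift J q m)) 1 =
        mfps_var p * conj_op q (B q) 1))" if p: "p \<in> P" for p
  proof -
    from p obtain i j where ij: "p = prod_encode (i, j)" "i \<in> {1..n}" "j \<in> {1..v i}"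
      by (auto simp: P_def)
    show ?thesis
    proof (cases "i = n")
      case True
      then show ?thesis using ratio_top ij by blast
    next
      case False
      then have "i \<in> {1..n - 1}" using ij by auto
      then show ?thesis using interior[OF ij(1)] ij by blast
    qed
  qed
  have nz: "case_prod x (prod_decode p) \<noteq> 0" if "p \<in> P" for p
    using that x_nonzero by (auto simp: P_def)
  have "H N" for N
    unfolding H_def
    by (rule ratio_coeffs_converge[of P "\<lambda>p. n - fst (prod_decode p)"])
      (use nz step in \<open>auto simp: H_def\<close>)
  then have "convg (\<lambda>q. mfps_nth (ratio (prod_encode (i, j)) q) b)"
    if "i \<in> {1..n}" "j \<in> {1..v i}" for i j b
    using P[OF that] lessI[of "mdeg b"] unfolding H_def by blast
  then have "\<exists>R. mfps_tendsto (ratio (prod_encode (i, j))) R (at 1 within generic)"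
    if "i \<in> {1..n}" "j \<in> {1..v i}" for i j
    using that by (intro ratio_limit_exists) auto
  then have "\<exists>R. \<forall>i j. i \<in> {1..n} \<longrightarrow> j \<in> {1..v i} \<longrightarrow>
      mfps_tendsto (ratio (prod_encode (i, j))) (R i j) (at 1 within generic)"
    by (intro choice allI) (metis (no_types))
  then show ?thesis using that by blast
qed

end

section \<open>The Bethe equations\<close>

lemma prod_power_int:
  fixes c :: "'a::field"
  assumes "c \<noteq> 0"
  shows "(\<Prod>i\<in>A. c powi f i) = c powi (\<Sum>i\<in>A. f i)"
  by (induction A rule: infinite_finite_induct) (use assms in \<open>auto simp: power_int_add\<close>)

context flag_chain
begin

abbreviation merge :: "complex mfps \<Rightarrow> complex mfps" where
  "merge \<equiv> subst_vars root_vars (\<lambda>p. fst (prod_decode p))"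

text \<open>\<open>S i j\<close> is \<open>x i j\<close> times the limit of the ratio, still in the
  separate variables, and \<open>S'\<close> supplies the inverses for negative powers of
  roots.\<close>

lemma limit_roots:
  obtains S S' where
    "\<And>i j. i \<in> {1..n} \<Longrightarrow> j \<in> {1..v i} \<Longrightarrow> multiplies (root_shift i j) (S i j)"
    "\<And>i j. i \<in> {1..n} \<Longrightarrow> j \<in> {1..v i} \<Longrightarrow>
      multiplies (\<lambda>q m. inverse (root_shift i j q m)) (S' i j)"
    "\<And>i j. i \<in> {1..n} \<Longrightarrow> j \<in> {1..v i} \<Longrightarrow> S i j * S' i j = 1"
    "\<And>i j. i \<in> {1..n} \<Longrightarrow> j \<in> {1..v i} \<Longrightarrow> mfps_nth (S i j) 0 = x i j"
    "\<And>k. k \<in> {1..v n} \<Longrightarrow> S n k = mfps_const (x n k)"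
proof -
  obtain R where R: "\<And>i j. i \<in> {1..n} \<Longrightarrow> j \<in> {1..v i} \<Longrightarrow>
      mfps_tendsto (ratio (prod_encode (i, j))) (R i j) (at 1 within generic)"
    using ratio_limits by blast
  define S where "S i j = mfps_const (x i j) * R i j" for i j
  define S' where "S' i j = mfps_const (inverse (x i j)) * mfps_inv (R i j)" for i j
  show ?thesis
  proof (rule that[of S S'])
    fix i j assume ij: "i \<in> {1..n}" "j \<in> {1..v i}"
    show "multiplies (root_shift i j) (S i j)"
      using multiplies_shift[OF R[OF ij]] by (simp add: root_shift_def S_def)
    show "multiplies (\<lambda>q m. inverse (root_shift i j q m)) (S' i j)"
      using multiplies_inverse_shift[OF R[OF ij]] by (simp add: root_shift_def S'_def)
    have R0: "mfps_nth (R i j) 0 = 1" by (rule ratio_limit_0[OF R[OF ij]])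
    then show "mfps_nth (S i j) 0 = x i j" by (simp add: S_def)
    have "S i j * S' i j = mfps_const (x i j * inverse (x i j)) * (R i j * mfps_inv (R i j))"
      unfolding S_def S'_def mfps_const_mult by (simp add: mult_ac)
    then show "S i j * S' i j = 1"
      using x_nonzero[OF ij] by (simp add: mfps_inv_right[OF R0])
  next
    fix k assume k: "k \<in> {1..v n}"
    have "mfps_tendsto (\<lambda>q. 1) (R n k) (at 1 within generic)"
      using R[of n k] k n_pos by (simp add: ratio_top[OF k, abs_def])
    then have "R n k = 1"
      using mfps_tendsto_unique[OF _ mfps_tendsto_const F_nontrivial] by blast
    then show "S n k = mfps_const (x n k)" by (simp add: S_def)
  qed
qed

text \<open>On both sides of \<open>conj_lead_eq\<close> the conjugates become multiplications as
  \<open>q\<close> tends to 1, and limits are unique.\<close>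

lemma limit_equation:
  assumes S: "\<And>i j. i \<in> {1..n} \<Longrightarrow> j \<in> {1..v i} \<Longrightarrow> multiplies (root_shift i j) (S i j)"
    and i: "i \<in> {1..n - 1}" and j: "j \<in> {1..v i}"
  shows "(\<Prod>k\<in>{1..v i} - {j}. S i k * (S i k - S i j)) *
      (\<Prod>k=1..v (i + 1). S i j - S (i + 1) k) * (\<Prod>k=1..v (i - 1). S i j) =
    mfps_var (prod_encode (i, j)) * (mfps_const ((-1) ^ (v (i + 1) - v (i - 1))) *
      (\<Prod>k\<in>{1..v i} - {j}. S i j * (S i j - S i k)) *
      (\<Prod>k=1..v (i + 1). S (i + 1) k) * (\<Prod>k=1..v (i - 1). S (i - 1) k - S i j))"
    (is "?L = ?z * ?T")
proof -
  have low: "i - 1 \<in> {1..n}" if "k \<in> {1..v (i - 1)}" for k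
    using that i v_0 by (cases "i = 1") auto
  have "multiplies (lead i j)
      ((\<Prod>k\<in>{1..v i} - {j}. mfps_const 1 * S i k * (S i k - mfps_const 1 * S i j)) *
      (\<Prod>k=1..v (i + 1). S i j - S (i + 1) k) * (\<Prod>k=1..v (i - 1). mfps_const 1 * S i j))"
    unfolding lead_def[abs_def]
    by (intro multiplies_mult multiplies_diff multiplies_prod multiplies_const[OF tendsto_q] S)
      (use levels[OF i] j in auto)
  then have L: "multiplies (lead i j) ?L" by simp
  have "multiplies (tail i j) (mfps_const ((-1) ^ (v (i + 1) - v (i - 1))) *
      (\<Prod>k\<in>{1..v i} - {j}. S i j * (S i j - mfps_const 1 * S i k)) *
      (\<Prod>k=1..v (i + 1). S (i + 1) k) * (\<Prod>k=1..v (i - 1). S (i - 1) k - S i j))"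
    unfolding tail_def[abs_def]
    by (intro multiplies_mult multiplies_diff multiplies_prod multiplies_const[OF tendsto_q]
        multiplies_const[OF tendsto_const] S)
      (use levels[OF i] low j in auto)
  then have T: "multiplies (tail i j) ?T" by simp
  have "mfps_tendsto (\<lambda>q. ?z * conj_op q (tail i j q) 1) (?z * ?T) (at 1 within generic)"
    by (intro mfps_tendsto_mult mfps_tendsto_const multiplies_tendsto T)
  then have "mfps_tendsto (\<lambda>q. conj_op q (lead i j q) 1) (?z * ?T) (at 1 within generic)"
    by (rule mfps_tendsto_cong)
      (rule eventually_mono[OF eventually_generic], simp add: conj_lead_eq[OF _ i j])
  then show ?thesis
    using mfps_tendsto_unique[OF multiplies_tendsto[OF L] _ F_nontrivial] by blast
qed

lemma insertion_limit:
  assumes S: "\<And>i j. i \<in> {1..n - 1} \<Longrightarrow> j \<in> {1..v i} \<Longrightarrow> multiplies (root_shift i j) (S i j)"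
    and S': "\<And>i j. i \<in> {1..n - 1} \<Longrightarrow> j \<in> {1..v i} \<Longrightarrow>
      multiplies (\<lambda>q m. inverse (root_shift i j q m)) (S' i j)"
    and inv: "\<And>i j. i \<in> {1..n - 1} \<Longrightarrow> j \<in> {1..v i} \<Longrightarrow> S i j * S' i j = 1"
    and \<tau>: "\<forall>m\<in>Poly_Mapping.keys \<tau>. Poly_Mapping.keys m \<subseteq> (SIGMA i:{1..n - 1}. {1..v i})"
  shows "\<exists>E. mfps_tendsto
      (\<lambda>q. merge (conj_op q (\<lambda>m. laurent_eval id \<tau> (\<lambda>i j. root_shift i j q m)) 1)) E
      (at 1 within generic) \<and>
    to_fract E = laurent_eval cst \<tau> (\<lambda>i j. to_fract (merge (S i j)))"
proof -
  \<comment> \<open>Power series do not form a field, so negative powers are built from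
    \<open>S'\<close>; in the fraction field \<open>P e i j\<close> becomes an integer power of the
    root.\<close>
  define P where "P e i j = (if 0 \<le> e then S i j ^ nat e else S' i j ^ nat (- e))"
    for e :: int and i j
  define E where "E = (\<Sum>m\<in>Poly_Mapping.keys \<tau>. mfps_const (Poly_Mapping.lookup \<tau> m) *
    (\<Prod>p\<in>Poly_Mapping.keys m. P (Poly_Mapping.lookup m p) (fst p) (snd p)))"
  have P: "multiplies (\<lambda>q m. root_shift i j q m powi e) (P e i j)"
    if "i \<in> {1..n - 1}" "j \<in> {1..v i}" for i j e
    using multiplies_power[OF S[OF that], of "nat e"] multiplies_power[OF S'[OF that], of "nat (- e)"]
    by (simp add: P_def power_int_def)
  have "multiplies (\<lambda>q m. laurent_eval id \<tau> (\<lambda>i j. root_shift i j q m)) E"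
    unfolding laurent_eval_def E_def case_prod_unfold id_apply
  proof (intro multiplies_sum multiplies_mult multiplies_prod multiplies_const tendsto_const)
    fix m p assume "m \<in> Poly_Mapping.keys \<tau>" "p \<in> Poly_Mapping.keys m"
    then have "p \<in> (SIGMA i:{1..n - 1}. {1..v i})" using \<tau> by blast
    then have "fst p \<in> {1..n - 1}" "snd p \<in> {1..v (fst p)}" by auto
    then show "multiplies (\<lambda>q m'. root_shift (fst p) (snd p) q m' powi
        Poly_Mapping.lookup m (fst p, snd p)) (P (Poly_Mapping.lookup m p) (fst p) (snd p))"
      unfolding prod.collapse by (rule P)
  qed
  then have "mfps_tendsto
      (\<lambda>q. merge (conj_op q (\<lambda>m. laurent_eval id \<tau> (\<lambda>i j. root_shift i j q m)) 1)) (merge E)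
      (at 1 within generic)"
    by (intro mfps_tendsto_subst_vars multiplies_tendsto)
  moreover have "to_fract (merge E) = laurent_eval cst \<tau> (\<lambda>i j. to_fract (merge (S i j)))"
  proof -
    note merge_mult = subst_vars_mult[OF finite_root_vars] and merge_1 = subst_vars_1[OF finite_root_vars]
    have merge_power: "merge (f ^ k) = merge f ^ k" for f k
      by (induction k) (simp_all add: merge_mult merge_1)
    have "to_fract (merge (P e i j)) = to_fract (merge (S i j)) powi e"
      if "i \<in> {1..n - 1}" "j \<in> {1..v i}" for i j e
    proof -
      have "to_fract (merge (S i j)) * to_fract (merge (S' i j)) = 1"
        unfolding to_fract_simps(3)[symmetric] merge_mult[symmetric] inv[OF that] merge_1
        by (rule to_fract_simps)
      then have "inverse (to_fract (merge (S i j))) = to_fract (merge (S' i j))"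
        by (rule inverse_unique)
      then show ?thesis by (simp add: P_def power_int_def merge_power to_fract_power)
    qed
    then show ?thesis
      unfolding E_def laurent_eval_def case_prod_unfold subst_vars_sum to_fract_sum merge_mult
        subst_vars_prod[OF finite_root_vars] to_fract_simps(3) to_fract_prod
        subst_vars_const[OF finite_root_vars] cst_def[symmetric]
      using \<tau> by (intro sum.cong arg_cong2[where f = "(*)"] prod.cong refl) fastforce
  qed
  ultimately show ?thesis by blast
qed

text \<open>
  The Bethe equations are the limits of the \<open>q\<close>-difference equations, divided by the factors
  \<open>s i k - s i j\<close>. Read from the bottom level upwards, they also show that no denominator vanishes.
\<close>

lemma bethe_solution:
  obtains s :: "nat \<Rightarrow> nat \<Rightarrow> complex mfps fract" where
    "\<And>i j. i \<in> {1..n} \<Longrightarrow> j \<in> {1..v i} \<Longrightarrow> s i j \<noteq> 0"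
    "\<And>k. k \<in> {1..v n} \<Longrightarrow> s n k = cst (x n k)"
    "\<And>i j k. i \<in> {1..n - 1} \<Longrightarrow> j \<in> {1..v i} \<Longrightarrow> k \<in> {1..v (i + 1)} \<Longrightarrow> s i j \<noteq> s (i + 1) k"
    "\<And>i j. i \<in> {1..n - 1} \<Longrightarrow> j \<in> {1..v i} \<Longrightarrow>
      (\<Prod>k=1..v (i + 1). (s i j - s (i + 1) k) / s (i + 1) k) *
      (\<Prod>k=1..v (i - 1). s i j / (s (i - 1) k - s i j)) =
      (-1) ^ (v (i + 1) - v (i - 1)) * zsharp i * (\<Prod>k\<in>{1..v i} - {j}. - s i j / s i k)"
    "\<And>\<tau>. \<forall>m\<in>Poly_Mapping.keys \<tau>. Poly_Mapping.keys m \<subseteq> (SIGMA i:{1..n - 1}. {1..v i}) \<Longrightarrow>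
      \<exists>E. mfps_tendsto
        (\<lambda>q. merge (conj_op q (\<lambda>m. laurent_eval id \<tau> (\<lambda>i j. root_shift i j q m)) 1)) E
        (at 1 within generic) \<and> to_fract E = laurent_eval cst \<tau> s"
proof -
  obtain S S' where S: "\<And>i j. i \<in> {1..n} \<Longrightarrow> j \<in> {1..v i} \<Longrightarrow> multiplies (root_shift i j) (S i j)"
    and S': "\<And>i j. i \<in> {1..n} \<Longrightarrow> j \<in> {1..v i} \<Longrightarrow>
      multiplies (\<lambda>q m. inverse (root_shift i j q m)) (S' i j)"
    and inv: "\<And>i j. i \<in> {1..n} \<Longrightarrow> j \<in> {1..v i} \<Longrightarrow> S i j * S' i j = 1"
    and S0: "\<And>i j. i \<in> {1..n} \<Longrightarrow> j \<in> {1..v i} \<Longrightarrow> mfps_nth (S i j) 0 = x i j"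
    and Sn: "\<And>k. k \<in> {1..v n} \<Longrightarrow> S n k = mfps_const (x n k)"
    using limit_roots by blast
  define s where "s i j = to_fract (merge (S i j))" for i j
  have s_nonzero: "s i j \<noteq> 0" if "i \<in> {1..n}" "j \<in> {1..v i}" for i j
  proof
    assume "s i j = 0"
    then have "mfps_nth (merge (S i j)) 0 = 0" by (simp add: s_def to_fract_eq_0_iff)
    then show False
      using S0[OF that] x_nonzero[OF that] by (simp add: mfps_nth_0_subst_vars[OF finite_root_vars])
  qed
  \<comment> \<open>Merging variables keeps constant terms, and those of one level are the distinct
    values \<open>x i j\<close>.\<close>
  have s_inj: "s i j \<noteq> s i k" if "i \<in> {1..n}" "j \<in> {1..v i}" "k \<in> {1..v i}" "j \<noteq> k" for i j k
  proof
    assume "s i j = s i k"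
    then have "mfps_nth (merge (S i j)) 0 = mfps_nth (merge (S i k)) 0"
      by (simp add: s_def to_fract_eq_iff)
    then have "x i j = x i k"
      using S0 that by (simp add: mfps_nth_0_subst_vars[OF finite_root_vars])
    then show False using inj_onD[OF x_inj[OF that(1)]] that by blast
  qed
  have eq: "(\<Prod>k\<in>{1..v i} - {j}. s i k) *
      (\<Prod>k=1..v (i + 1). s i j - s (i + 1) k) * (\<Prod>k=1..v (i - 1). s i j) =
    zsharp i * ((-1) ^ (v (i + 1) - v (i - 1)) * (\<Prod>k\<in>{1..v i} - {j}. - s i j) *
      (\<Prod>k=1..v (i + 1). s (i + 1) k) * (\<Prod>k=1..v (i - 1). s (i - 1) k - s i j))"
    if i: "i \<in> {1..n - 1}" and j: "j \<in> {1..v i}" for i j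
  proof -
    let ?D = "\<Prod>k\<in>{1..v i} - {j}. s i k - s i j"
    have const: "mfps_const ((-1) ^ k) = ((-1) ^ k :: complex mfps)" for k
    proof (induction k)
      case (Suc k)
      have "mfps_const (- c) = - (mfps_const c :: complex mfps)" for c
        by (rule mfps_eqI) (simp add: mfps_nth_const)
      then show ?case using Suc by simp
    qed simp
    have merge_neg: "merge ((-1) ^ k) = (-1) ^ k" for k
      using subst_vars_const[OF finite_root_vars, of _ "(-1) ^ k :: complex"] by (simp add: const)
    have var: "to_fract (merge (mfps_var (prod_encode (i, j)))) = zsharp i"
      using i j by (simp add: subst_vars_var[OF finite_root_vars] root_vars_iff zsharp_def)
    have "to_fract (merge ((\<Prod>k\<in>{1..v i} - {j}. S i k * (S i k - S i j)) *
        (\<Prod>k=1..v (i + 1). S i j - S (i + 1) k) * (\<Prod>k=1..v (i - 1). S i j))) =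
      to_fract (merge (mfps_var (prod_encode (i, j)) * ((-1) ^ (v (i + 1) - v (i - 1)) *
        (\<Prod>k\<in>{1..v i} - {j}. S i j * (S i j - S i k)) *
        (\<Prod>k=1..v (i + 1). S (i + 1) k) * (\<Prod>k=1..v (i - 1). S (i - 1) k - S i j))))"
      using limit_equation[of S, OF S i j] unfolding const by (simp only:)
    then have "(\<Prod>k\<in>{1..v i} - {j}. s i k * (s i k - s i j)) *
        (\<Prod>k=1..v (i + 1). s i j - s (i + 1) k) * (\<Prod>k=1..v (i - 1). s i j) =
      zsharp i * ((-1) ^ (v (i + 1) - v (i - 1)) *
        (\<Prod>k\<in>{1..v i} - {j}. s i j * (s i j - s i k)) *
        (\<Prod>k=1..v (i + 1). s (i + 1) k) * (\<Prod>k=1..v (i - 1). s (i - 1) k - s i j))"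
      unfolding subst_vars_mult[OF finite_root_vars] subst_vars_prod[OF finite_root_vars]
        subst_vars_diff to_fract_simps to_fract_prod merge_neg to_fract_power var s_def[symmetric] .
    \<comment> \<open>Moving the sign into \<open>- s i j\<close> exposes the factor
      \<open>?D\<close> common to both sides.\<close>
    moreover have "(\<Prod>k\<in>{1..v i} - {j}. s i j * (s i j - s i k)) =
        (\<Prod>k\<in>{1..v i} - {j}. - s i j) * ?D"
      unfolding prod.distrib[symmetric] by (intro prod.cong) (auto simp: algebra_simps)
    ultimately have "?D * ((\<Prod>k\<in>{1..v i} - {j}. s i k) *
        (\<Prod>k=1..v (i + 1). s i j - s (i + 1) k) * (\<Prod>k=1..v (i - 1). s i j)) =
      ?D * (zsharp i * ((-1) ^ (v (i + 1) - v (i - 1)) * (\<Prod>k\<in>{1..v i} - {j}. - s i j) *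
        (\<Prod>k=1..v (i + 1). s (i + 1) k) * (\<Prod>k=1..v (i - 1). s (i - 1) k - s i j)))"
      unfolding prod.distrib by (simp only: mult_ac)
    moreover have "?D \<noteq> 0"
      using s_inj[OF levels(1)[OF i] _ j] by auto
    ultimately show ?thesis unfolding mult_cancel_left by blast
  qed
  have zsharp: "zsharp i \<noteq> 0" for i
  proof
    assume "zsharp i = 0"
    then have "mfps_nth (mfps_var i) (Poly_Mapping.single i 1) = (0 :: complex)"
      by (simp add: zsharp_def to_fract_eq_0_iff)
    then show False by (simp add: mfps_var_def)
  qed
  have s_chain: "\<forall>j\<in>{1..v i}. \<forall>k\<in>{1..v (i + 1)}. s i j \<noteq> s (i + 1) k" if "i \<in> {1..n - 1}" for i
    using that
  proof (induction i)
    case (Suc i)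
    have low: "(\<Prod>k=1..v i. s i k - s (Suc i) j) \<noteq> 0" if "j \<in> {1..v (Suc i)}" for j
    proof (cases "i = 0")
      case False
      then show ?thesis using Suc that by auto
    qed (simp add: v_0)
    show ?case
    proof (intro ballI)
      fix j k assume j: "j \<in> {1..v (Suc i)}" and k: "k \<in> {1..v (Suc i + 1)}"
      have "(\<Prod>k=1..v (Suc i + 1). s (Suc i) j - s (Suc i + 1) k) \<noteq> 0"
      proof
        \<comment> \<open>Then the left side of \<open>eq\<close> is \<open>0\<close>, whereas the
          right side is a product of nonzero factors, the differences to the level below by
          induction.\<close>
        assume 0: "(\<Prod>k=1..v (Suc i + 1). s (Suc i) j - s (Suc i + 1) k) = 0"
        have "zsharp (Suc i) * ((-1) ^ (v (Suc i + 1) - v (Suc i - 1)) *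
            (\<Prod>k\<in>{1..v (Suc i)} - {j}. - s (Suc i) j) *
            (\<Prod>k=1..v (Suc i + 1). s (Suc i + 1) k) *
            (\<Prod>k=1..v (Suc i - 1). s (Suc i - 1) k - s (Suc i) j)) = 0"
          unfolding eq[OF Suc.prems j, symmetric] 0 by simp
        then show False
          using zsharp low[OF j] s_nonzero[OF levels(1)[OF Suc.prems] j]
            s_nonzero[OF levels(2)[OF Suc.prems]] by auto
      qed
      then show "s (Suc i) j \<noteq> s (Suc i + 1) k" using k by auto
    qed
  qed simp
  show ?thesis
  proof (rule that[of s])
    show "s n k = cst (x n k)" if "k \<in> {1..v n}" for k
      using that by (simp add: s_def Sn subst_vars_const[OF finite_root_vars] cst_def)
    show "(\<Prod>k=1..v (i + 1). (s i j - s (i + 1) k) / s (i + 1) k) *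
        (\<Prod>k=1..v (i - 1). s i j / (s (i - 1) k - s i j)) =
        (-1) ^ (v (i + 1) - v (i - 1)) * zsharp i * (\<Prod>k\<in>{1..v i} - {j}. - s i j / s i k)"
      if i: "i \<in> {1..n - 1}" and j: "j \<in> {1..v i}" for i j
    proof -
      have "(\<Prod>k=1..v (i + 1). s (i + 1) k) \<noteq> 0" "(\<Prod>k\<in>{1..v i} - {j}. s i k) \<noteq> 0"
        using s_nonzero[OF levels(1)[OF i]] s_nonzero[OF levels(2)[OF i]] by auto
      moreover have "(\<Prod>k=1..v (i - 1). s (i - 1) k - s i j) \<noteq> 0"
      proof (cases "i = 1")
        case False
        then have "i - 1 \<in> {1..n - 1}" "i - 1 + 1 = i" using i by auto
        then show ?thesis using s_chain[of "i - 1"] j by auto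
      qed (simp add: v_0)
      ultimately show ?thesis
        using eq[OF i j] unfolding prod_dividef by (simp add: divide_simps) (simp add: mult_ac)
    qed
    show "\<exists>E. mfps_tendsto
        (\<lambda>q. merge (conj_op q (\<lambda>m. laurent_eval id \<tau> (\<lambda>i j. root_shift i j q m)) 1)) E
        (at 1 within generic) \<and> to_fract E = laurent_eval cst \<tau> s"
      if "\<forall>m\<in>Poly_Mapping.keys \<tau>. Poly_Mapping.keys m \<subseteq> (SIGMA i:{1..n - 1}. {1..v i})" for \<tau>
      unfolding s_def[abs_def]
      by (rule insertion_limit[of S S']) (use S S' inv levels that in blast)+
  qed (use s_nonzero s_chain in auto)
qed

section \<open>The vertex of the partial flag variety\<close>


text \<open>The exponents contributing to one monomial in the \<open>z_i\<close>, before the cone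
  condition of \<open>vertex_degrees\<close> is imposed.\<close>

definition flag_degrees :: "(nat \<Rightarrow>\<^sub>0 nat) \<Rightarrow> (nat \<Rightarrow> nat \<Rightarrow> nat) set" where
  "flag_degrees m = {d. (\<forall>i j. (i, j) \<notin> (SIGMA i:{1..n - 1}. {1..v i}) \<longrightarrow> d i j = 0) \<and>
    (\<forall>i\<in>{1..n - 1}. (\<Sum>j=1..v i. d i j) = Poly_Mapping.lookup m i)}"

lemma lookup_push_root_vars:
  "Poly_Mapping.lookup (push root_vars (\<lambda>p. fst (prod_decode p)) M) i =
    (if i \<in> {1..n - 1} then \<Sum>j=1..v i. exps M i j else 0)"
proof -
  have "{p \<in> root_vars. fst (prod_decode p) = i} =
      (if i \<in> {1..n - 1} then (\<lambda>j. prod_encode (i, j)) ` {1..v i} else {})"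
    unfolding root_vars_def by (auto simp: image_iff)
  moreover have "inj_on (\<lambda>j. prod_encode (i, j)) {1..v i}"
    by (auto simp: inj_on_def prod_encode_eq)
  ultimately show ?thesis
    unfolding lookup_push[OF finite_root_vars] by (auto simp: sum.reindex exps_def)
qed

lemma bij_betw_exps:
  assumes m: "Poly_Mapping.keys m \<subseteq> {1..n - 1}"
  shows "bij_betw exps (push_fiber root_vars (\<lambda>p. fst (prod_decode p)) m) (flag_degrees m)"
  unfolding bij_betw_def
proof
  let ?fib = "push_fiber root_vars (\<lambda>p. fst (prod_decode p)) m"
  show "inj_on exps ?fib"
  proof (rule inj_onI, rule poly_mapping_eqI)
    fix M N k assume "exps M = exps N"
    then have "exps M (fst (prod_decode k)) (snd (prod_decode k)) =
        exps N (fst (prod_decode k)) (snd (prod_decode k))" by simp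
    then show "Poly_Mapping.lookup M k = Poly_Mapping.lookup N k" by (simp add: exps_def)
  qed
  show "exps ` ?fib = flag_degrees m"
  proof
    show "exps ` ?fib \<subseteq> flag_degrees m"
    proof (rule image_subsetI)
      fix M assume M: "M \<in> ?fib"
      have "exps M i j = 0" if "(i, j) \<notin> (SIGMA i:{1..n - 1}. {1..v i})" for i j
      proof -
        have "prod_encode (i, j) \<notin> root_vars" using that by (simp add: root_vars_iff)
        then have "prod_encode (i, j) \<notin> Poly_Mapping.keys M" using M by (auto simp: push_fiber_def)
        then show ?thesis by (simp add: exps_def in_keys_iff)
      qed
      moreover have "(\<Sum>j=1..v i. exps M i j) = Poly_Mapping.lookup m i" if "i \<in> {1..n - 1}" for i
        using M that lookup_push_root_vars[of M i] by (simp add: push_fiber_def)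
      ultimately show "exps M \<in> flag_degrees m" by (simp add: flag_degrees_def)
    qed
    show "flag_degrees m \<subseteq> exps ` ?fib"
    proof
      fix d assume d: "d \<in> flag_degrees m"
      define M where "M = (\<Sum>p\<in>root_vars. Poly_Mapping.single p (case_prod d (prod_decode p)))"
      have M: "Poly_Mapping.lookup M p = (if p \<in> root_vars then case_prod d (prod_decode p) else 0)" for p
        using finite_root_vars by (simp add: M_def lookup_sum lookup_single when_def)
      have "exps M i j = d i j" for i j
        using d root_vars_iff[of i j] by (auto simp: exps_def M flag_degrees_def)
      then have e: "exps M = d" by blast
      have "Poly_Mapping.keys M \<subseteq> root_vars" by (auto simp: in_keys_iff M split: if_splits)
      moreover have "push root_vars (\<lambda>p. fst (prod_decode p)) M = m"
      proof (rule poly_mapping_eqI)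
        fix i
        have "Poly_Mapping.lookup m i = 0" if "i \<notin> {1..n - 1}"
        proof -
          have "i \<notin> Poly_Mapping.keys m" using m that by blast
          then show ?thesis by (simp add: in_keys_iff)
        qed
        then show "Poly_Mapping.lookup (push root_vars (\<lambda>p. fst (prod_decode p)) M) i = Poly_Mapping.lookup m i"
          unfolding lookup_push_root_vars e using d by (auto simp: flag_degrees_def)
      qed
      ultimately have "M \<in> ?fib" by (simp add: push_fiber_def)
      then show "d \<in> exps ` ?fib" using e by blast
    qed
  qed
qed

lemma finite_flag_degrees:
  "Poly_Mapping.keys m \<subseteq> {1..n - 1} \<Longrightarrow> finite (flag_degrees m)"
  using bij_betw_exps finite_push_fiber[OF finite_root_vars] bij_betw_finite by blast

lemma mfps_nth_merge_split_vertex: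
  assumes q: "q \<in> generic"
  shows "mfps_nth (merge (scale_coeffs (\<lambda>M. t (exps M)) (split_vertex q))) m =
    (if Poly_Mapping.keys m \<subseteq> {1..n - 1} then \<Sum>d\<in>flag_degrees m. t d * weight q d else 0)"
proof (cases "Poly_Mapping.keys m \<subseteq> {1..n - 1}")
  case True
  have "mfps_nth (merge (scale_coeffs (\<lambda>M. t (exps M)) (split_vertex q))) m =
      (\<Sum>M\<in>push_fiber root_vars (\<lambda>p. fst (prod_decode p)) m. t (exps M) * weight q (exps M))"
    unfolding subst_vars_def mfps_nth_Abs
    by (rule sum.cong) (auto simp: push_fiber_def mfps_nth_split_vertex[OF q])
  also have "\<dots> = (\<Sum>d\<in>flag_degrees m. t d * weight q d)"
    by (rule sum.reindex_bij_betw[OF bij_betw_exps[OF True]])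
  finally show ?thesis using True by simp
next
  case False
  then obtain i where "i \<notin> {1..n - 1}" "i \<in> Poly_Mapping.keys m" by blast
  then have i: "i \<notin> {1..n - 1}" "Poly_Mapping.lookup m i \<noteq> 0" by (simp_all add: in_keys_iff)
  then have "push_fiber root_vars (\<lambda>p. fst (prod_decode p)) m = {}"
    using lookup_push_root_vars[of _ i] by (auto simp: push_fiber_def)
  then show ?thesis using False by (simp add: subst_vars_def)
qed

text \<open>The inclusion of one subset in the next gives an injection \<open>J\<close> matching
  equal roots. Outside the cone some level violates the inequalities for every injection, in
  particular for this one, and the weight then has a vanishing factor.\<close>

lemma weight_outside_cone:
  assumes q: "q \<in> generic" and d: "d \<in> flag_degrees m" "d \<notin> vertex_degrees n v"
  shows "weight q d = 0"
proof -
  from d obtain i where i: "i \<in> {1..n - 2}" and no: "\<And>J. inj_on J {1..v i} \<Longrightarrow>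
      J ` {1..v i} \<subseteq> {1..v (i + 1)} \<Longrightarrow> \<exists>k\<in>{1..v i}. d i k < d (i + 1) (J k)"
    unfolding vertex_degrees_def flag_degrees_def by (auto simp: not_le)
  have i': "i \<in> {1..n - 1}" using i by auto
  then have "\<forall>j\<in>{1..v i}. \<exists>k\<in>{1..v (i + 1)}. x (i + 1) k = x i j"
    using x_chain by force
  then obtain J where J: "\<And>j. j \<in> {1..v i} \<Longrightarrow> J j \<in> {1..v (i + 1)} \<and> x (i + 1) (J j) = x i j"
    by metis
  have "inj_on J {1..v i}"
  proof (rule inj_onI)
    fix j k assume "j \<in> {1..v i}" "k \<in> {1..v i}" "J j = J k"
    then show "j = k" using J inj_onD[OF x_inj[OF levels(1)[OF i']]] by metis
  qed
  then obtain k where "k \<in> {1..v i}" "d i k < d (i + 1) (J k)"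
    using no J by blast
  then show ?thesis using J by (intro weight_eq_0[OF q i']) auto
qed

text \<open>Counts the power of \<open>csqrt h\<close> left by the factors between adjacent levels.
  The degree of level \<open>i\<close> occurs \<open>v (i + 1)\<close> times positively and
  \<open>v (i - 1)\<close> times negatively, and the framing has degree \<open>0\<close>.\<close>

lemma total_exponent:
  fixes d :: "nat \<Rightarrow> nat \<Rightarrow> nat"
  assumes top: "\<And>k. d n k = 0"
  shows "(\<Sum>i=1..n - 1. \<Sum>j=1..v i. \<Sum>k=1..v (i + 1). int (d i j) - int (d (i + 1) k)) =
    int (\<Sum>i=1..n - 1. (v (i + 1) - v (i - 1)) * (\<Sum>j=1..v i. d i j))"
proof -
  define D where "D i = int (\<Sum>j=1..v i. d i j)" for i
  have base: "(\<Sum>i=1..N. int (v i) * D (i + 1)) + int (v 0) * D 1 =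
      (\<Sum>i=1..N. int (v (i - 1)) * D i) + int (v N) * D (N + 1)" for N
    by (induction N) auto
  have Dn: "D n = 0" "n - 1 + 1 = n" using top n_pos by (simp_all add: D_def)
  have shift: "(\<Sum>i=1..n - 1. int (v i) * D (i + 1)) =
      (\<Sum>i=1..n - 1. int (v (i - 1)) * D i)"
    using base[of "n - 1", unfolded Dn v_0] by simp
  have "(\<Sum>i=1..n - 1. \<Sum>j=1..v i. \<Sum>k=1..v (i + 1). int (d i j) - int (d (i + 1) k)) =
      (\<Sum>i=1..n - 1. int (v (i + 1)) * D i - int (v i) * D (i + 1))"
    by (simp add: sum_subtractf D_def sum_distrib_left)
  also have "\<dots> = (\<Sum>i=1..n - 1. (int (v (i + 1)) - int (v (i - 1))) * D i)"
    using shift by (simp add: sum_subtractf left_diff_distrib)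
  also have "\<dots> = (\<Sum>i=1..n - 1. int (v (i + 1) - v (i - 1)) * D i)"
    using v_pred_le by (intro sum.cong) (auto simp: of_nat_diff)
  finally show ?thesis by (simp add: D_def)
qed

text \<open>Each \<open>curly\<close> is normalized by its own power of \<open>csqrt h\<close>. The
  exponents within a level cancel by antisymmetry, and those between levels add up to
  \<open>e\<close>, so dividing by \<open>(- csqrt h) ^ e\<close> removes all growth and leaves the
  sign \<open>(-1) ^ e\<close>.\<close>

lemma vertex_weight_tendsto:
  fixes d :: "nat \<Rightarrow> nat \<Rightarrow> nat"
  assumes q: "q \<in> generic" and top: "\<And>k. d n k = 0"
  defines "e \<equiv> \<Sum>i=1..n - 1. (v (i + 1) - v (i - 1)) * (\<Sum>j=1..v i. d i j)"
  shows "((\<lambda>h. csqrt q ^ e *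
      (\<Prod>i=1..n - 1. \<Prod>j=1..v i. \<Prod>k=1..v i.
        inverse (curly q h (x i j / x i k) (int (d i j) - int (d i k)))) *
      (\<Prod>i=1..n - 1. \<Prod>j=1..v i. \<Prod>k=1..v (i + 1).
        curly q h (x i j / x (i + 1) k) (int (d i j) - int (d (i + 1) k))) / (- csqrt h) ^ e)
    \<longlongrightarrow> weight q d) (inf at_infinity (principal (generic_h (v n) (x n) q)))"
proof -
  let ?F = "inf at_infinity (principal (generic_h (v n) (x n) q))"
  let ?D = "\<lambda>i j i' k. int (d i j) - int (d i' k)"
  define A where "A h i j i' k = curly q h (x i j / x i' k) (?D i j i' k) / csqrt h powi ?D i j i' k"
    for h i j i' k
  have qn: "norm q < 1" "q \<noteq> 0" using q by (auto simp: generic_q_def)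
  have A: "((\<lambda>h. A h i j i' k) \<longlongrightarrow> curly_limit q (x i j / x i' k) (?D i j i' k)) ?F"
    if ij: "i \<in> {1..n}" "j \<in> {1..v i}" "i' \<in> {1..n}" "k \<in> {1..v i'}" for i j i' k
    unfolding A_def
  proof (rule curly_tendsto[OF qn])
    show "x i j / x i' k \<noteq> 0" using x_nonzero ij by simp
    show "h \<noteq> q powi m * (x i j / x i' k)" if h: "h \<in> generic_h (v n) (x n) q" for h m
    proof
      assume eq: "h = q powi m * (x i j / x i' k)"
      obtain l l' where l: "l \<in> {1..v n}" "x i j = x n l" "l' \<in> {1..v n}" "x i' k = x n l'"
        using x_in_top[OF ij(1,2)] x_in_top[OF ij(3,4)] by auto
      then have "h * x n l' \<noteq> q powi m * x n l" using h by (simp add: generic_h_def)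
      then show False using eq l x_top by simp
    qed
  qed
  \<comment> \<open>Factors within a level occur inverted, so their limits must not vanish.\<close>
  have inner: "curly_limit q (x i j / x i k) (?D i j i k) \<noteq> 0"
    if i: "i \<in> {1..n}" and j: "j \<in> {1..v i}" and k: "k \<in> {1..v i}" for i j k
  proof (cases "j = k")
    case True
    then show ?thesis using x_nonzero[OF i k] curly_limit_1_0[OF qn(1)] by simp
  next
    case False
    then have "x i j \<noteq> x i k" using inj_onD[OF x_inj[OF i]] j k by blast
    then have "q powi m \<noteq> x i j / x i k" for m by (rule generic_x[OF q i j i k])
    moreover have "x i j / x i k \<noteq> 0" using x_nonzero i j k by simp
    ultimately show ?thesis by (intro curly_limit_nonzero qn)
  qed
  have "((\<lambda>h. (- csqrt q) ^ e *
      (\<Prod>i=1..n - 1. \<Prod>j=1..v i. \<Prod>k=1..v i. inverse (A h i j i k)) *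
      (\<Prod>i=1..n - 1. \<Prod>j=1..v i. \<Prod>k=1..v (i + 1). A h i j (i + 1) k)) \<longlongrightarrow> weight q d) ?F"
    unfolding weight_def e_def
  proof (intro tendsto_mult tendsto_const tendsto_prod tendsto_inverse)
    fix i j k assume i: "i \<in> {1..n - 1}" and j: "j \<in> {1..v i}"
    note i' = levels(1,2)[OF i]
    show "((\<lambda>h. A h i j i k) \<longlongrightarrow> curly_limit q (x i j / x i k) (?D i j i k)) ?F"
      "curly_limit q (x i j / x i k) (?D i j i k) \<noteq> 0" if "k \<in> {1..v i}"
      using A[OF i'(1) j i'(1) that] inner[OF i'(1) j that] .
    show "((\<lambda>h. A h i j (i + 1) k) \<longlongrightarrow> curly_limit q (x i j / x (i + 1) k) (?D i j (i + 1) k)) ?F"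
      if "k \<in> {1..v (i + 1)}"
      using A[OF i'(1) j i'(2) that] .
  qed
  moreover have "\<forall>\<^sub>F h in ?F. (- csqrt q) ^ e *
      (\<Prod>i=1..n - 1. \<Prod>j=1..v i. \<Prod>k=1..v i. inverse (A h i j i k)) *
      (\<Prod>i=1..n - 1. \<Prod>j=1..v i. \<Prod>k=1..v (i + 1). A h i j (i + 1) k) =
    csqrt q ^ e *
      (\<Prod>i=1..n - 1. \<Prod>j=1..v i. \<Prod>k=1..v i.
        inverse (curly q h (x i j / x i k) (?D i j i k))) *
      (\<Prod>i=1..n - 1. \<Prod>j=1..v i. \<Prod>k=1..v (i + 1).
        curly q h (x i j / x (i + 1) k) (?D i j (i + 1) k)) / (- csqrt h) ^ e"
  proof -
    have "\<forall>\<^sub>F h in ?F. h \<noteq> 0"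
      unfolding eventually_inf_principal
      using eventually_not_equal_at_infinity[of 0] by eventually_elim auto
    then show ?thesis
    proof eventually_elim
      case (elim h)
      let ?c = "\<lambda>i j i' k. curly q h (x i j / x i' k) (?D i j i' k)"
      have h: "csqrt h \<noteq> 0" using elim by simp
      have "(\<Prod>i=1..n - 1. \<Prod>j=1..v i. \<Prod>k=1..v i. csqrt h powi ?D i j i k) = csqrt h powi
          (\<Sum>i=1..n - 1. \<Sum>j=1..v i. \<Sum>k=1..v i. ?D i j i k)"
        by (simp only: prod_power_int[OF h])
      also have "(\<Sum>i=1..n - 1. \<Sum>j=1..v i. \<Sum>k=1..v i. ?D i j i k) = 0"
        by (simp add: sum_subtractf sum_distrib_left)
      finally have "(\<Prod>i=1..n - 1. \<Prod>j=1..v i. \<Prod>k=1..v i. csqrt h powi ?D i j i k) = 1" by simp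
      then have 1: "(\<Prod>i=1..n - 1. \<Prod>j=1..v i. \<Prod>k=1..v i. inverse (A h i j i k)) =
          (\<Prod>i=1..n - 1. \<Prod>j=1..v i. \<Prod>k=1..v i. inverse (?c i j i k))"
        by (simp add: A_def divide_inverse prod.distrib)
      have "(\<Prod>i=1..n - 1. \<Prod>j=1..v i. \<Prod>k=1..v (i + 1). csqrt h powi ?D i j (i + 1) k) = csqrt h powi
          (\<Sum>i=1..n - 1. \<Sum>j=1..v i. \<Sum>k=1..v (i + 1). ?D i j (i + 1) k)"
        by (simp only: prod_power_int[OF h])
      also have "\<dots> = csqrt h ^ e"
        unfolding total_exponent[of d, OF top] e_def power_int_of_nat ..
      finally have 2: "(\<Prod>i=1..n - 1. \<Prod>j=1..v i. \<Prod>k=1..v (i + 1). A h i j (i + 1) k) =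
          (\<Prod>i=1..n - 1. \<Prod>j=1..v i. \<Prod>k=1..v (i + 1). ?c i j (i + 1) k) / csqrt h ^ e"
        by (simp add: A_def prod_dividef)
      have combine: "a * P * (Q / b) = c * P * Q / b'" if "a / b = c / b'" for a b b' c P Q :: complex
      proof -
        have "a * P * (Q / b) = (a / b) * P * Q" by simp
        also have "\<dots> = c * P * Q / b'" unfolding that by simp
        finally show ?thesis .
      qed
      have "(- csqrt q) ^ e / csqrt h ^ e = csqrt q ^ e / (- csqrt h) ^ e"
        by (cases "even e") simp_all
      then show ?case unfolding 1 2 by (rule combine)
    qed
  qed
  ultimately show ?thesis by (rule Lim_transform_eventually)
qed

end

section \<open>From partial flags with framing to chains\<close>

definition framed_dims :: "nat \<Rightarrow> nat \<Rightarrow> (nat \<Rightarrow> nat) \<Rightarrow> nat \<Rightarrow> nat" where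
  "framed_dims n w v i = (if i = 0 then 0 else if i = n then w else v i)"

definition framed_point :: "nat \<Rightarrow> (nat \<Rightarrow> complex) \<Rightarrow> (nat \<Rightarrow> nat \<Rightarrow> complex) \<Rightarrow> nat \<Rightarrow> nat \<Rightarrow> complex" where
  "framed_point n a x i = (if i = n then a else x i)"

text \<open>The values of \<open>v\<close> at \<open>0\<close> and \<open>n\<close>, and of
  \<open>x\<close> at \<open>n\<close>, are arbitrary in the given data; the framed versions
  overwrite them by the empty level and the framing.\<close>

lemma flag_chain_framed:
  assumes dims: "flag_dims n w v" and a: "inj_on a {1..w}" "\<And>j. j \<in> {1..w} \<Longrightarrow> a j \<noteq> 0"
    and x: "fixed_point n w v a x"
  shows "flag_chain n (framed_dims n w v) (framed_point n a x)"
proof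
  have n: "n \<ge> 2" using dims by (simp add: flag_dims_def)
  then show "1 \<le> n" by simp
  show "framed_dims n w v 0 = 0" by (simp add: framed_dims_def)
  show "inj_on (framed_point n a x i) {1..framed_dims n w v i}" if "i \<in> {1..n}" for i
    using that a(1) x by (auto simp: framed_dims_def framed_point_def fixed_point_def)
  show "framed_point n a x i ` {1..framed_dims n w v i} \<subseteq>
      framed_point n a x (i + 1) ` {1..framed_dims n w v (i + 1)}" if i: "i \<in> {1..n - 1}" for i
  proof (cases "i = n - 1")
    case True
    then show ?thesis using x n by (simp add: framed_dims_def framed_point_def fixed_point_def)
  next
    case False
    then have "i \<in> {1..n - 2}" "i \<noteq> n" "i + 1 \<noteq> n" "i \<noteq> 0" using i by auto
    then show ?thesis using x by (simp add: framed_dims_def framed_point_def fixed_point_def)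
  qed
  show "framed_point n a x n k \<noteq> 0" if "k \<in> {1..framed_dims n w v n}" for k
    using that a(2) n by (simp add: framed_dims_def framed_point_def)
qed

lemma vertex_degrees_framed: "vertex_degrees n (framed_dims n w v) = vertex_degrees n v"
proof -
  have v: "framed_dims n w v i = v i" if "i \<in> {1..n - 1}" for i
    using levels[OF that] that by (auto simp: framed_dims_def)
  have 1: "(SIGMA i:{1..n - 1}. {1..framed_dims n w v i}) = (SIGMA i:{1..n - 1}. {1..v i})"
    using v by (intro Sigma_cong) auto
  have 2: "framed_dims n w v i = v i" "framed_dims n w v (i + 1) = v (i + 1)" if "i \<in> {1..n - 2}" for i
    using that by (intro v; auto)+
  show ?thesis unfolding vertex_degrees_def 1 by (intro Collect_cong conj_cong refl ball_cong) (simp_all add: 2 2(2)[simplified])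
qed

lemma dim'_framed:
  assumes "n \<ge> 2" "i \<in> {1..n - 1}"
  shows "framed_dims n w v (i + 1) - framed_dims n w v (i - 1) = dim' n w v i"
  using assms by (auto simp: framed_dims_def dim'_def)

lemma vertex_term_framed:
  fixes n w :: nat and v :: "nat \<Rightarrow> nat" and a :: "nat \<Rightarrow> complex"
    and x :: "nat \<Rightarrow> nat \<Rightarrow> complex" and d :: "nat \<Rightarrow> nat \<Rightarrow> nat"
  assumes n: "n \<ge> 2" and top: "\<And>k. d n k = 0"
  defines "vv \<equiv> framed_dims n w v" and "xx \<equiv> framed_point n a x"
  shows "vertex_term n w v a x \<tau> q h d =
    csqrt q ^ (\<Sum>i=1..n - 1. (vv (i + 1) - vv (i - 1)) * (\<Sum>j=1..vv i. d i j)) *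
      (\<Prod>i=1..n - 1. \<Prod>j=1..vv i. \<Prod>k=1..vv i.
        inverse (curly q h (xx i j / xx i k) (int (d i j) - int (d i k)))) *
      (\<Prod>i=1..n - 1. \<Prod>j=1..vv i. \<Prod>k=1..vv (i + 1).
        curly q h (xx i j / xx (i + 1) k) (int (d i j) - int (d (i + 1) k))) *
    laurent_eval id \<tau> (\<lambda>i j. x i j * q powi (- int (d i j)))"
proof -
  have v: "vv i = v i" "xx i = x i" if "i \<in> {1..n - 1}" for i
    using levels[OF that] that by (auto simp: vv_def xx_def framed_dims_def framed_point_def)
  have E: "(\<Sum>i=1..n - 1. (vv (i + 1) - vv (i - 1)) * (\<Sum>j=1..vv i. d i j)) =
      (\<Sum>i=1..n - 1. dim' n w v i * (\<Sum>j=1..v i. d i j))"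
  proof (rule sum.cong[OF refl])
    fix i assume i: "i \<in> {1..n - 1}"
    show "(vv (i + 1) - vv (i - 1)) * (\<Sum>j=1..vv i. d i j) = dim' n w v i * (\<Sum>j=1..v i. d i j)"
      unfolding v[OF i] unfolding vv_def dim'_framed[OF n i] ..
  qed
  have W: "(\<Prod>i=1..n - 1. \<Prod>j=1..vv i. \<Prod>k=1..vv i.
        inverse (curly q h (xx i j / xx i k) (int (d i j) - int (d i k)))) =
      (\<Prod>i=1..n - 1. \<Prod>j=1..v i. \<Prod>k=1..v i.
        inverse (curly q h (x i j / x i k) (int (d i j) - int (d i k))))"
    by (rule prod.cong) (simp_all add: v)
  let ?U = "\<lambda>i. \<Prod>j=1..vv i. \<Prod>k=1..vv (i + 1).
        curly q h (xx i j / xx (i + 1) k) (int (d i j) - int (d (i + 1) k))"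
  \<comment> \<open>The factor \<open>i = n - 1\<close> becomes the framing product, because
    \<open>d n k = 0\<close>.\<close>
  have "{1..n - 1} = insert (n - 1) {1..n - 2}" using n by auto
  moreover have "n - 1 \<notin> {1..n - 2}" using n by auto
  ultimately have "prod ?U {1..n - 1} = ?U (n - 1) * prod ?U {1..n - 2}" by simp
  moreover have "?U (n - 1) =
      (\<Prod>j=1..v (n - 1). \<Prod>k=1..w. curly q h (x (n - 1) j / a k) (int (d (n - 1) j)))"
    using n top by (simp add: vv_def xx_def framed_dims_def framed_point_def)
  moreover have "prod ?U {1..n - 2} = (\<Prod>i=1..n - 2. \<Prod>j=1..v i. \<Prod>k=1..v (i + 1).
        curly q h (x i j / x (i + 1) k) (int (d i j) - int (d (i + 1) k)))"
  proof (rule prod.cong[OF refl])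
    fix i assume i: "i \<in> {1..n - 2}"
    then have "i \<in> {1..n - 1}" "i + 1 \<in> {1..n - 1}" by auto
    then show "?U i = (\<Prod>j=1..v i. \<Prod>k=1..v (i + 1).
        curly q h (x i j / x (i + 1) k) (int (d i j) - int (d (i + 1) k)))"
      by (simp only: v)
  qed
  ultimately show ?thesis unfolding vertex_term_def E W by simp
qed

text \<open>Each coefficient is a finite sum, so the limit of large \<open>h\<close> is taken term
  by term; the sum may then be extended beyond the cone, where weights vanish.\<close>

lemma compact_vertex_framed:
  fixes n w :: nat and v :: "nat \<Rightarrow> nat" and a :: "nat \<Rightarrow> complex"
    and x :: "nat \<Rightarrow> nat \<Rightarrow> complex"
  assumes dims: "flag_dims n w v" and a: "inj_on a {1..w}" "\<And>j. j \<in> {1..w} \<Longrightarrow> a j \<noteq> 0"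
    and x: "fixed_point n w v a x"
    and \<tau>: "\<forall>m\<in>Poly_Mapping.keys \<tau>. Poly_Mapping.keys m \<subseteq> (SIGMA i:{1..n - 1}. {1..v i})"
  defines "vv \<equiv> framed_dims n w v" and "xx \<equiv> framed_point n a x"
  shows "compact_vertex n w v a x \<tau> (\<lambda>q. flag_chain.merge n vv
    (scale_coeffs (\<lambda>m. laurent_eval id \<tau> (\<lambda>i j. flag_chain.root_shift xx i j q m))
      (flag_chain.split_vertex n vv xx q)))"
proof -
  interpret flag_chain n vv xx
    unfolding vv_def xx_def by (rule flag_chain_framed[OF dims a x])
  have n: "n \<ge> 2" using dims by (simp add: flag_dims_def)
  have v: "vv i = v i" "xx i = x i" if "i \<in> {1..n - 1}" for i
    using levels[OF that] that by (auto simp: vv_def xx_def framed_dims_def framed_point_def)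
  have top: "vv n = w" "xx n = a"
    using n by (simp_all add: vv_def xx_def framed_dims_def framed_point_def)
  show ?thesis
    unfolding compact_vertex_def mfps_tendsto_def
  proof (intro ballI allI)
    fix q m assume "q \<in> generic_q w a"
    then have q: "q \<in> generic" by (simp add: top)
    let ?F = "inf at_infinity (principal (generic_h w a q))"
    define t where "t d = laurent_eval id \<tau> (\<lambda>i j. x i j * q powi (- int (d i j)))"
      for d :: "nat \<Rightarrow> nat \<Rightarrow> nat"
    have "laurent_eval id \<tau> (\<lambda>i j. root_shift i j q M) = t (exps M)" for M
    proof -
      have "root_shift i j q M = x i j * q powi (- int (exps M i j))"
        if "m' \<in> Poly_Mapping.keys \<tau>" "(i, j) \<in> Poly_Mapping.keys m'" for m' i j
      proof -
        have "i \<in> {1..n - 1}" using \<tau> that by blast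
        then show ?thesis by (simp add: root_shift_eq v power_int_minus power_inverse)
      qed
      then show ?thesis
        unfolding laurent_eval_def t_def
        by (intro sum.cong prod.cong arg_cong2[where f = "(*)"] refl) auto
    qed
    then have rhs: "mfps_nth (merge (scale_coeffs (\<lambda>m. laurent_eval id \<tau> (\<lambda>i j. root_shift i j q m))
          (split_vertex q))) m =
        (if Poly_Mapping.keys m \<subseteq> {1..n - 1} then \<Sum>d\<in>flag_degrees m. t d * weight q d else 0)"
      using mfps_nth_merge_split_vertex[OF q, of t m] by simp
    show "((\<lambda>h. mfps_nth (bare_vertex_sharp n w v a x \<tau> q h) m) \<longlongrightarrow>
        mfps_nth (merge (scale_coeffs (\<lambda>m. laurent_eval id \<tau> (\<lambda>i j. root_shift i j q m))
          (split_vertex q))) m) ?F"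
    proof (cases "Poly_Mapping.keys m \<subseteq> {1..n - 1}")
      case False
      then show ?thesis unfolding rhs by (simp add: bare_vertex_sharp_def bare_vertex_def)
    next
      case True
      let ?C = "flag_degrees m \<inter> vertex_degrees n v"
      have deg: "{d \<in> vertex_degrees n v. \<forall>i\<in>{1..n - 1}. (\<Sum>j=1..v i. d i j) = Poly_Mapping.lookup m i} = ?C"
      proof -
        have "(SIGMA i:{1..n - 1}. {1..vv i}) = (SIGMA i:{1..n - 1}. {1..v i})"
          using v by (intro Sigma_cong) auto
        moreover have "(\<Sum>j=1..vv i. d i j) = (\<Sum>j=1..v i. d i j)" if "i \<in> {1..n - 1}"
          for i and d :: "nat \<Rightarrow> nat \<Rightarrow> nat" using v[OF that] by simp
        ultimately show ?thesis unfolding flag_degrees_def vertex_degrees_def by auto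
      qed
      have term_lim: "((\<lambda>h. vertex_term n w v a x \<tau> q h d /
          (\<Prod>i=1..n - 1. ((- csqrt h) ^ dim' n w v i) ^ Poly_Mapping.lookup m i)) \<longlongrightarrow> weight q d * t d) ?F"
        if d: "d \<in> ?C" for d
      proof -
        have dn: "d n k = 0" for k 
        proof -
          have "(n, k) \<notin> (SIGMA i:{1..n - 1}. {1..vv i})" using n by auto
          then show ?thesis using d unfolding flag_degrees_def by blast
        qed
        \<comment> \<open>The passage to \<open>z\<^sup>\<sharp>\<close> depends only on
          \<open>m\<close>, but the row sums of \<open>d\<close> are the entries of
          \<open>m\<close>, so its exponent is the \<open>e\<close> of
          \<open>vertex_weight_tendsto\<close>.\<close>
        have "(\<Prod>i=1..n - 1. ((- csqrt h) ^ dim' n w v i) ^ Poly_Mapping.lookup m i) =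
            (- csqrt h) ^ (\<Sum>i=1..n - 1. (vv (i + 1) - vv (i - 1)) * (\<Sum>j=1..vv i. d i j))" for h
        proof -
          have "((- csqrt h) ^ dim' n w v i) ^ Poly_Mapping.lookup m i =
              (- csqrt h) ^ ((vv (i + 1) - vv (i - 1)) * (\<Sum>j=1..vv i. d i j))"
            if "i \<in> {1..n - 1}" for i
          proof -
            have "(\<Sum>j=1..vv i. d i j) = Poly_Mapping.lookup m i"
              using d that by (simp add: flag_degrees_def)
            then show ?thesis
              unfolding dim'_framed[OF n that, of w v, folded vv_def, symmetric] power_mult by simp
          qed
          then show ?thesis unfolding power_sum by (intro prod.cong) auto
        qed
        then show ?thesis
          using tendsto_mult[OF vertex_weight_tendsto[OF q, of d, OF dn] tendsto_const[of "t d"]]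
          unfolding vertex_term_framed[OF n, of d, OF dn] vv_def[symmetric] xx_def[symmetric] t_def[symmetric] top
          by (simp add: mult_ac)
      qed
      have "mfps_nth (bare_vertex_sharp n w v a x \<tau> q h) m =
          (\<Sum>d\<in>?C. vertex_term n w v a x \<tau> q h d /
            (\<Prod>i=1..n - 1. ((- csqrt h) ^ dim' n w v i) ^ Poly_Mapping.lookup m i))" for h
        using True unfolding bare_vertex_sharp_def bare_vertex_def mfps_nth_Abs deg
        by (simp add: sum_divide_distrib)
      moreover have "(\<Sum>d\<in>flag_degrees m. t d * weight q d) = (\<Sum>d\<in>?C. weight q d * t d)"
      proof (rule sum.mono_neutral_cong_right)
        show "\<forall>d\<in>flag_degrees m - ?C. t d * weight q d = 0"
          using weight_outside_cone[OF q, of _ m] vertex_degrees_framed[of n w v]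
          by (auto simp: vv_def)
      qed (use finite_flag_degrees[OF True] in auto)
      moreover have "((\<lambda>h. \<Sum>d\<in>?C. vertex_term n w v a x \<tau> q h d /
          (\<Prod>i=1..n - 1. ((- csqrt h) ^ dim' n w v i) ^ Poly_Mapping.lookup m i))
          \<longlongrightarrow> (\<Sum>d\<in>?C. weight q d * t d)) ?F"
        by (rule tendsto_sum, rule term_lim)
      ultimately show ?thesis
        unfolding rhs if_P[OF True] by (simp only:)
    qed
  qed
qed

text \<open>One \<open>s\<close> serves every \<open>\<tau>\<close>, because it is built from limits
  of ratios of the vertex without insertion.\<close>

theorem mainTheorem2:
  fixes n w :: nat and v :: "nat \<Rightarrow> nat"
    and a :: "nat \<Rightarrow> complex" and x :: "nat \<Rightarrow> nat \<Rightarrow> complex"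
  assumes "flag_dims n w v"
    and "inj_on a {1..w}" and "\<And>j. j \<in> {1..w} \<Longrightarrow> a j \<noteq> 0"
    and "fixed_point n w v a x"
  shows "\<exists>s. bethe_roots n w v (\<lambda>j. cst (a j)) (\<lambda>i. (-1) ^ dim' n w v i * zsharp i) s \<and>
             (\<forall>\<tau>. tautological n v \<tau> \<longrightarrow>
                (\<exists>E. quantum_eigenvalue n w v a x \<tau> E \<and> to_fract E = laurent_eval cst \<tau> s))"
proof -
  define vv where "vv = framed_dims n w v"
  define xx where "xx = framed_point n a x"
  interpret flag_chain n vv xx
    unfolding vv_def xx_def by (rule flag_chain_framed[OF assms])
  have n: "n \<ge> 2" using assms(1) by (simp add: flag_dims_def)
  have v: "vv i = v i" if "i \<in> {1..n - 1}" for i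
    using levels[OF that] that by (auto simp: vv_def framed_dims_def)
  have top: "vv n = w" "xx n = a"
    using n by (simp_all add: vv_def xx_def framed_dims_def framed_point_def)
  have Sigma: "(SIGMA i:{1..n - 1}. {1..vv i}) = (SIGMA i:{1..n - 1}. {1..v i})"
    using v by (intro Sigma_cong) auto
  obtain s where s_nonzero: "\<And>i j. i \<in> {1..n} \<Longrightarrow> j \<in> {1..vv i} \<Longrightarrow> s i j \<noteq> 0"
    and s_top: "\<And>k. k \<in> {1..vv n} \<Longrightarrow> s n k = cst (xx n k)"
    and s_chain: "\<And>i j k. i \<in> {1..n - 1} \<Longrightarrow> j \<in> {1..vv i} \<Longrightarrow> k \<in> {1..vv (i + 1)} \<Longrightarrow>
      s i j \<noteq> s (i + 1) k"
    and s_eq: "\<And>i j. i \<in> {1..n - 1} \<Longrightarrow> j \<in> {1..vv i} \<Longrightarrow>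
      (\<Prod>k=1..vv (i + 1). (s i j - s (i + 1) k) / s (i + 1) k) *
      (\<Prod>k=1..vv (i - 1). s i j / (s (i - 1) k - s i j)) =
      (-1) ^ (vv (i + 1) - vv (i - 1)) * zsharp i * (\<Prod>k\<in>{1..vv i} - {j}. - s i j / s i k)"
    and s_limit: "\<And>\<tau>. \<forall>m\<in>Poly_Mapping.keys \<tau>. Poly_Mapping.keys m \<subseteq> (SIGMA i:{1..n - 1}. {1..vv i}) \<Longrightarrow>
      \<exists>E. mfps_tendsto
        (\<lambda>q. merge (conj_op q (\<lambda>m. laurent_eval id \<tau> (\<lambda>i j. root_shift i j q m)) 1)) E
        (at 1 within generic) \<and> to_fract E = laurent_eval cst \<tau> s"
    using bethe_solution by blast
  show ?thesis
  proof (intro exI[of _ s] conjI allI impI)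
    show "bethe_roots n w v (\<lambda>j. cst (a j)) (\<lambda>i. (-1) ^ dim' n w v i * zsharp i) s"
      unfolding bethe_roots_def
    proof (intro conjI ballI)
      fix i k assume i: "i \<in> {1..n - 1}" and k: "k \<in> {1..v i}"
      then show "s i k \<noteq> 0" using s_nonzero[OF levels(1)[OF i]] v by auto
    next
      fix i j k assume i: "i \<in> {2..n - 1}" and j: "j \<in> {1..v (i - 1)}" and k: "k \<in> {1..v i}"
      then have "i - 1 \<in> {1..n - 1}" "i \<in> {1..n - 1}" "i - 1 + 1 = i" by auto
      then show "s (i - 1) j \<noteq> s i k" using s_chain[of "i - 1" j k] v j k by simp
    next
      fix i k assume i: "i \<in> {1..n - 1}" and k: "k \<in> {1..v i}"
      have "(if i = n - 1 then \<Prod>j=1..w. (s i k - cst (a j)) / cst (a j)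
          else \<Prod>j=1..v (i + 1). (s i k - s (i + 1) j) / s (i + 1) j) =
          (\<Prod>j=1..vv (i + 1). (s i k - s (i + 1) j) / s (i + 1) j)"
      proof (cases "i = n - 1")
        case True
        then have "i + 1 = n" using n by simp
        then show ?thesis using True s_top top by simp
      next
        case False
        then have "i + 1 \<in> {1..n - 1}" using i by auto
        then show ?thesis using False v by simp
      qed
      moreover have "(if i = 1 then 1 else \<Prod>j=1..v (i - 1). s i k / (s (i - 1) j - s i k)) =
          (\<Prod>j=1..vv (i - 1). s i k / (s (i - 1) j - s i k))"
      proof (cases "i = 1")
        case False
        then have "i - 1 \<in> {1..n - 1}" using i by auto
        then show ?thesis using False v by simp
      qed (simp add: v_0)
      ultimately show "(if i = n - 1 then \<Prod>j=1..w. (s i k - cst (a j)) / cst (a j)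
          else \<Prod>j=1..v (i + 1). (s i k - s (i + 1) j) / s (i + 1) j) *
          (if i = 1 then 1 else \<Prod>j=1..v (i - 1). s i k / (s (i - 1) j - s i k)) =
          (-1) ^ dim' n w v i * zsharp i * (\<Prod>j\<in>{1..v i} - {k}. - s i k / s i j)"
        using s_eq[OF i, of k] k v[OF i] dim'_framed[OF n i, of w v] by (simp add: vv_def)
    qed
  next
    fix \<tau> assume "tautological n v \<tau>"
    then have \<tau>: "\<forall>m\<in>Poly_Mapping.keys \<tau>. Poly_Mapping.keys m \<subseteq> (SIGMA i:{1..n - 1}. {1..v i})"
      by (simp add: tautological_def)
    let ?t = "\<lambda>\<tau> q m. laurent_eval id \<tau> (\<lambda>i j. root_shift i j q m)"
    let ?V = "\<lambda>\<tau> q. merge (scale_coeffs (?t \<tau> q) (split_vertex q))"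
    let ?R = "\<lambda>q. merge (conj_op q (?t \<tau> q) 1)"
    obtain E where E: "mfps_tendsto ?R E (at 1 within generic)" "to_fract E = laurent_eval cst \<tau> s"
      using s_limit[of \<tau>] \<tau> Sigma by auto
    have V: "compact_vertex n w v a x \<tau> (?V \<tau>)"
      if "\<forall>m\<in>Poly_Mapping.keys \<tau>. Poly_Mapping.keys m \<subseteq> (SIGMA i:{1..n - 1}. {1..v i})" for \<tau>
      unfolding vv_def xx_def by (rule compact_vertex_framed[OF assms that])
    have t1: "?t 1 q m = 1" for q m by (simp add: laurent_eval_def)
    have V1: "?V 1 q = merge (split_vertex q)" for q
      unfolding t1 by (simp add: scale_coeffs_def mfps_nth_inverse)
    have "mfps_nth (?V 1 q) 0 = 1" for q
      unfolding V1 by (simp add: mfps_nth_0_subst_vars[OF finite_root_vars] V_0)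
    then have V1_nonzero: "?V 1 q \<noteq> 0" for q by (metis mfps_nth_simps(1) zero_neq_one)
    \<comment> \<open>Multiplying by the vertex undoes the conjugation, and \<open>merge\<close> is
      a ring homomorphism; so the quotient of vertices is itself a power series.\<close>
    have "?R q * ?V 1 q = ?V \<tau> q" for q
      unfolding V1 subst_vars_mult[OF finite_root_vars, symmetric]
      by (simp add: conj_op_def mult_ac) (simp add: V_inv flip: mult.assoc)
    then have ratio: "to_fract (?R q) = to_fract (?V \<tau> q) / to_fract (?V 1 q)" for q
      using V1_nonzero[of q] by (simp add: field_simps to_fract_eq_0_iff flip: to_fract_simps(3))
    have "compact_vertex n w v a x 1 (?V 1)" by (rule V) simp
    then have "quantum_eigenvalue n w v a x \<tau> E"
      unfolding quantum_eigenvalue_def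
      using V[OF \<tau>] V1_nonzero ratio E(1)[unfolded top]
      by (intro exI[of _ "?V \<tau>"] exI[of _ "?V 1"] exI[of _ ?R] conjI ballI)
    then show "\<exists>E. quantum_eigenvalue n w v a x \<tau> E \<and> to_fract E = laurent_eval cst \<tau> s"
      using E(2) by blast
  qed
qed

end
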